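(* Let $p$ be a prime and $\alpha,\beta$ integers different from $1$, and assume that either $p>3$, or $p=3$ and neither $\alpha$ nor $\beta$ is congruent to $7$ modulo $9$. Suppose $v_p(\alpha-1)=v_p(\beta-1)=m>0$ and $\ell\ge 2m$, where $\ell=v_p(\alpha-\beta)$ (with $\ell=\infty$ if $\alpha=\beta$). Then $|G_p|=p^{7m}$, the nilpotency class of $G_p$ is $5$, $o(a)=o(b)=p^{3m}$ and $o(c)=p^{2m}$.
   Context: $G(\alpha,\beta)=\langle A,B\mid A^{[A,B]}=A^{\alpha},\ B^{[B,A]}=B^{\beta}\rangle$ with $[x,y]=x^{-1}y^{-1}xy$, $y^x=x^{-1}yx$, and $C=[A,B]$. The group $G(\alpha,\beta)$ is finite and nilpotent, hence the direct product of its Sylow subgroups; $G_p$ denotes its Sylow $p$-subgroup and $a,b,c$ denote the images of $A,B,C$ under the canonical projection $G(\alpha,\beta)\to G_p$. $v_p$ is the $p$-adic valuation and $o(x)$ the order of $x$. *)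

theory Defs
  imports "HOL-Algebra.Algebra" "HOL-Computational_Algebra.Primes" "HOL-Number_Theory.Cong"
begin

text \<open>A letter is (generator, inverted?); generator False = A, True = B.\<close>
type_synonym letter = "bool \<times> bool"
type_synonym word = "letter list"

definition inv_letter :: "letter \<Rightarrow> letter" where
  "inv_letter x = (fst x, \<not> snd x)"

definition inv_word :: "word \<Rightarrow> word" where
  "inv_word w = rev (map inv_letter w)"

definition wpow :: "word \<Rightarrow> int \<Rightarrow> word" where
  "wpow w n = (if n \<ge> 0 then concat (replicate (nat n) w)
               else concat (replicate (nat (- n)) (inv_word w)))"

definition comm_word :: "word \<Rightarrow> word \<Rightarrow> word" where
  "comm_word x y = inv_word x @ inv_word y @ x @ y"

definition conj_word :: "word \<Rightarrow> word \<Rightarrow> word" where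
  "conj_word y x = inv_word x @ y @ x"

definition wA :: word where "wA = [(False, False)]"
definition wB :: word where "wB = [(True, False)]"

inductive pres_eq :: "word set \<Rightarrow> word \<Rightarrow> word \<Rightarrow> bool" for R where
  pe_refl: "pres_eq R u u"
| pe_sym: "pres_eq R u v \<Longrightarrow> pres_eq R v u"
| pe_trans: "pres_eq R u v \<Longrightarrow> pres_eq R v w \<Longrightarrow> pres_eq R u w"
| pe_cancel: "pres_eq R (u @ [x, inv_letter x] @ v) (u @ v)"
| pe_rel: "r \<in> R \<Longrightarrow> pres_eq R (u @ r @ v) (u @ v)"

definition word_class :: "word set \<Rightarrow> word \<Rightarrow> word set" where
  "word_class R u = {w. pres_eq R u w}"

definition presented_group :: "word set \<Rightarrow> word set monoid" where
  "presented_group R =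
     \<lparr> carrier = range (word_class R),
       monoid.mult = (\<lambda>S T. word_class R ((SOME x. x \<in> S) @ (SOME y. y \<in> T))),
       monoid.one = word_class R [] \<rparr>"

definition G_rels :: "int \<Rightarrow> int \<Rightarrow> word set" where
  "G_rels \<alpha> \<beta> =
     { conj_word wA (comm_word wA wB) @ inv_word (wpow wA \<alpha>),
       conj_word wB (comm_word wB wA) @ inv_word (wpow wB \<beta>) }"

definition Gab :: "int \<Rightarrow> int \<Rightarrow> word set monoid" where
  "Gab \<alpha> \<beta> = presented_group (G_rels \<alpha> \<beta>)"

definition genA :: "int \<Rightarrow> int \<Rightarrow> word set" where
  "genA \<alpha> \<beta> = word_class (G_rels \<alpha> \<beta>) wA"
definition genB :: "int \<Rightarrow> int \<Rightarrow> word set" where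
  "genB \<alpha> \<beta> = word_class (G_rels \<alpha> \<beta>) wB"
definition genC :: "int \<Rightarrow> int \<Rightarrow> word set" where
  "genC \<alpha> \<beta> = word_class (G_rels \<alpha> \<beta>) (comm_word wA wB)"

definition is_sylow :: "('a, 'b) monoid_scheme \<Rightarrow> nat \<Rightarrow> 'a set \<Rightarrow> bool" where
  "is_sylow G p P \<longleftrightarrow> subgroup P G \<and> card P = p ^ multiplicity p (order G)"

text \<open>The p-component of g: the image of g under the projection of the finite nilpotent
  group onto its Sylow p-subgroup, i.e. g^e with e = 1 mod the p-part of o(g) and
  e = 0 mod the p'-part of o(g).\<close>
definition pcomp :: "('a, 'b) monoid_scheme \<Rightarrow> nat \<Rightarrow> 'a \<Rightarrow> 'a" where
  "pcomp G p g =
     (let q = p ^ multiplicity p (group.ord G g) in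
      g [^]\<^bsub>G\<^esub> (SOME e::nat. [e = 1] (mod q) \<and> [e = 0] (mod (group.ord G g div q))))"

text \<open>Lower central series: lcs H 0 = H = gamma_1, lcs H (Suc n) = [lcs H n, H].\<close>
fun lcs :: "('a, 'b) monoid_scheme \<Rightarrow> nat \<Rightarrow> 'a set" where
  "lcs H 0 = carrier H"
| "lcs H (Suc n) = generate H
     {inv\<^bsub>H\<^esub> x \<otimes>\<^bsub>H\<^esub> inv\<^bsub>H\<^esub> y \<otimes>\<^bsub>H\<^esub> x \<otimes>\<^bsub>H\<^esub> y | x y. x \<in> lcs H n \<and> y \<in> carrier H}"

definition nil_class :: "('a, 'b) monoid_scheme \<Rightarrow> nat" where
  "nil_class H = (LEAST c. lcs H c = {\<one>\<^bsub>H\<^esub>})"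

end

theory Submission
  imports Defs "HOL-Number_Theory.Pocklington"
begin

text \<open>
  Write \<open>q = p ^ m\<close>. Evaluating the commutators of suitable powers of \<open>A\<close> and \<open>B\<close> in two ways gives relations
  between powers of \<open>A\<close>, \<open>B\<close> and \<open>C\<close>. They show that \<open>A\<close>, \<open>B\<close>, \<open>C\<close> have finite order, that every prime
  dividing the order of \<open>A\<close> divides \<open>\<alpha> - 1\<close>, and, since \<open>G = <B><C><A>\<close>, that the group is finite. For an
  exponent \<open>e\<close> that is \<open>1\<close> modulo the \<open>p\<close>-part and \<open>0\<close> modulo the rest of these orders, the powers \<open>A ^ e\<close>, \<open>B ^ e\<close>
  satisfy the same relations and generate a normal subgroup \<open>S\<close>. The same relations, read \<open>p\<close>-adically, bound the
  orders of \<open>A ^ e\<close>, \<open>B ^ e\<close>, \<open>C ^ e\<close> by \<open>q ^ 3\<close>, \<open>q ^ 3\<close>, \<open>q ^ 2\<close> and place the \<open>q ^ 2\<close>-th power of \<open>B ^ e\<close> in the group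
  generated by \<open>A ^ e\<close>, so that \<open>S\<close> has at most \<open>q ^ 7\<close> elements, its index is prime to \<open>p\<close>, and its class is at most 5.
  An explicit action of the group on \<open>q ^ 7\<close> points, transitive under \<open>S\<close>, shows that all these bounds are attained.
\<close>

section \<open>Geometric sums\<close>

text \<open>\<open>key_relation\<close> drives all upper bounds, with a different i each time. It
  involves the M-th power of \<open>a c\<close> with M = \<alpha>^i, so \<alpha>^i and \<beta>^i
  must be natural numbers: i = 2 achieves this for every sign and gives finite orders, i =
  \<open>totient d\<close> gives their prime divisors, and i = 1, once the exponents are replaced by
  positive representatives, gives the p-adic bounds. For i = 1 the decisive exponent is
  \<open>mac_exp \<alpha> (nat \<alpha>)\<close>, roughly (\<alpha> - 1)^2 / 2. For odd p its
  valuation is exactly 2m unless p = 3 and \<alpha> is 7 modulo 9; this is where the excluded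
  residue comes from. The exponents of C on the two sides of that relation differ by \<alpha> -
  \<beta>, and l >= 2m makes the leftover power of C harmless. The lower bounds need a model whose
  coordinates are truncated binomial expansions modulo q^3. Their denominators 2 and 3 are the
  obstacle there: 2 is invertible, but 3 is not when p = 3, so those congruences are checked modulo
  3 q^3.\<close>

definition gsum :: "int \<Rightarrow> nat \<Rightarrow> int" where
  "gsum x n = (\<Sum>j<n. x ^ j)"

lemma gsum_0 [simp]: "gsum x 0 = 0"
  by (simp add: gsum_def)

lemma gsum_Suc: "gsum x (Suc n) = 1 + x * gsum x n"
  unfolding gsum_def by (subst sum.lessThan_Suc_shift) (simp add: sum_distrib_left)

lemma gsum_1 [simp]: "gsum x (Suc 0) = 1"
  by (simp add: gsum_Suc)

lemma gsum_Suc_right: "gsum x (Suc n) = gsum x n + x ^ n"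
  by (simp add: gsum_def)

lemma gsum_eq: "(x - 1) * gsum x n = x ^ n - 1"
  by (induction n) (auto simp: gsum_Suc algebra_simps)

lemma gsum_add: "gsum x (m + n) = gsum x m + x ^ m * gsum x n"
  by (induction m) (auto simp: gsum_Suc algebra_simps)

lemma gsum_mult: "gsum x (m * n) = gsum x m * gsum (x ^ m) n"
  by (induction n) (auto simp: gsum_Suc gsum_add algebra_simps)

lemma dvd_power_minus_one: "d dvd x - 1 \<Longrightarrow> d dvd x ^ n - (1::int)"
  by (metis dvd_mult2 gsum_eq)

lemma dvd_of_dvd_diff: "d dvd x - y \<Longrightarrow> d dvd y \<Longrightarrow> d dvd (x::int)"
  using dvd_add[of d "x - y" y] by simp

lemma coprime_of_dvd_diff_one: "d dvd x - 1 \<Longrightarrow> coprime d (x::int)"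
proof (rule coprimeI)
  fix r assume "d dvd x - 1" "r dvd d" "r dvd x"
  then have "r dvd x - (x - 1)" by (meson dvd_diff dvd_trans)
  then show "is_unit r" by simp
qed

lemma gsum_cong_length:
  assumes "d dvd x - 1"
  shows "d dvd gsum x n - int n"
proof (induction n)
  case (Suc n)
  have "gsum x (Suc n) - int (Suc n) = (gsum x n - int n) + (x ^ n - 1)"
    by (simp add: gsum_Suc_right)
  with Suc dvd_power_minus_one[OF assms] show ?case by (metis dvd_add)
qed simp

text \<open>The binomial expansion to first order in \<open>x - 1\<close>, doubled so that n(n-1)/2
  needs no division.\<close>

lemma gsum_cong_length2:
  assumes "d dvd x - 1"
  shows "2 * d * d dvd 2 * (gsum x n - int n) - (x - 1) * int n * (int n - 1)"
proof (induction n)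
  case (Suc n)
  obtain k where k: "x - 1 = d * k" using assms by auto
  obtain l where l: "gsum x n - int n = d * l" using gsum_cong_length[OF assms] by blast
  have x: "x = 1 + d * k" and g: "gsum x n = int n + d * l" using k l by auto
  have "2 * (gsum x (Suc n) - int (Suc n)) - (x - 1) * int (Suc n) * (int (Suc n) - 1)
     = (2 * (gsum x n - int n) - (x - 1) * int n * (int n - 1)) + 2 * d * d * (k * l)"
    unfolding gsum_Suc g by (simp add: x algebra_simps)
  with Suc show ?case by (metis dvd_add dvd_triv_left)
qed simp

text \<open>Peel off one prime q of n at a time:
  \<open>gsum x (q * h) = gsum x q * gsum (x ^ q) h\<close>, where the first factor is q modulo q
  and \<open>x ^ q\<close> inherits the hypothesis on x.\<close>

lemma dvd_gsum_of_primes: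
  assumes "n > 0" "\<And>q. Factorial_Ring.prime q \<Longrightarrow> q dvd n \<Longrightarrow> int q dvd x - 1" "n dvd h"
  shows "int n dvd gsum x h"
  using assms
proof (induction n arbitrary: x h rule: less_induct)
  case (less n)
  show ?case
  proof (cases "n = 1")
    case False
    then obtain q where q: "Factorial_Ring.prime q" "q dvd n" using prime_factor_nat by blast
    then obtain n' where n': "n = q * n'" by auto
    obtain h' where h': "h = n * h'" using less.prems by auto
    have h: "h = q * (n' * h')" by (simp add: h' n')
    have qx: "int q dvd x - 1" using less.prems q by auto
    have "n' < n" "n' > 0" using q n' less.prems(1) prime_gt_1_nat[OF q(1)] by auto
    then have "int n' dvd gsum (x ^ q) (n' * h')"
      using less.IH[of n' "x ^ q" "n' * h'"] less.prems(2) n' dvd_power_minus_one by auto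
    moreover have "int q dvd gsum x q"
      using gsum_cong_length[OF qx, of q] by (rule dvd_of_dvd_diff) simp
    ultimately show ?thesis
      unfolding h gsum_mult n' of_nat_mult by (rule mult_dvd_mono[rotated])
  qed simp
qed

text \<open>Each factor \<open>gsum (x ^ h) p\<close> of the sum is p modulo
  \<open>p ^ (m + 1)\<close>: its first-order term carries p(p-1)/2, a multiple of p because p is
  odd. The extra factor x matches the exponent in \<open>a_pow_b\<close>.\<close>

lemma gsum_prime_power_cong:
  assumes "odd p" and m: "m > 0" and x: "int p ^ m dvd x - 1"
  shows "int p ^ (e + m) dvd x * gsum x (p ^ e) - int p ^ e"
proof (induction e)
  case 0
  then show ?case using x by simp
next
  case (Suc e)
  let ?h = "p ^ e"
  have "int p ^ (m + 1) dvd gsum (x ^ ?h) p - int p"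
  proof -
    have d: "int p ^ m dvd x ^ ?h - 1" by (rule dvd_power_minus_one[OF x])
    have "2 * int p ^ m * int p ^ m dvd 2 * (gsum (x ^ ?h) p - int p) - (x ^ ?h - 1) * int p * (int p - 1)"
      by (rule gsum_cong_length2[OF d])
    moreover have "int p ^ (m + 1) dvd int p ^ m * int p ^ m"
      unfolding power_add[symmetric] by (rule le_imp_power_dvd) (use m in simp)
    ultimately have "int p ^ (m + 1) dvd 2 * (gsum (x ^ ?h) p - int p) - (x ^ ?h - 1) * int p * (int p - 1)"
      unfolding mult.assoc[of 2 "int p ^ m"] using dvd_trans dvd_mult_right by blast
    moreover have "int p ^ (m + 1) dvd (x ^ ?h - 1) * int p * (int p - 1)"
      using d by (simp add: mult.commute mult_dvd_mono)
    ultimately have "int p ^ (m + 1) dvd 2 * (gsum (x ^ ?h) p - int p)"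
      by (rule dvd_of_dvd_diff)
    moreover have "coprime (int p ^ (m + 1)) 2" using assms(1) by simp
    ultimately show ?thesis by (meson coprime_dvd_mult_right_iff)
  qed
  then obtain y where y: "gsum (x ^ ?h) p = int p + int p ^ (m + 1) * y"
    by (auto simp: dvd_def algebra_simps)
  obtain z where z: "x * gsum x ?h = int p ^ e + int p ^ (e + m) * z"
    using Suc by (auto simp: dvd_def algebra_simps)
  have "x * gsum x (p ^ Suc e) = (x * gsum x ?h) * gsum (x ^ ?h) p"
    by (simp add: gsum_mult power_Suc2 del: power_Suc)
  also have "\<dots> = int p ^ Suc e + int p ^ (Suc e + m) * (z + z * int p ^ m * y + y)"
    unfolding y z by (simp add: algebra_simps power_add)
  finally show ?case by simp
qed

text \<open>Lifting the exponent: in \<open>x ^ (p ^ e) - 1 = (x - 1) * gsum x (p ^ e)\<close> the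
  sum contributes \<open>p ^ e\<close>.\<close>

lemma power_prime_power_cong:
  assumes "odd p" and m: "m > 0" and x: "int p ^ m dvd x - 1" and r: "p ^ e dvd r"
  shows "int p ^ (e + m) dvd x ^ r - 1"
proof -
  have "int p ^ e dvd x * gsum x (p ^ e)"
  proof -
    have "int p ^ e dvd x * gsum x (p ^ e) - int p ^ e"
      by (rule dvd_trans[OF _ gsum_prime_power_cong[OF assms(1-3), of e]]) (simp add: le_imp_power_dvd)
    then show ?thesis by (rule dvd_of_dvd_diff) simp
  qed
  moreover have "coprime (int p ^ e) x"
  proof -
    have "int p dvd x - 1" using x m by (meson dvd_power dvd_trans)
    then have "coprime (int p) x" by (rule coprime_of_dvd_diff_one)
    then show ?thesis by simp
  qed
  ultimately have "int p ^ e dvd gsum x (p ^ e)" by (simp add: coprime_dvd_mult_right_iff)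
  then have "int p ^ (e + m) dvd x ^ (p ^ e) - 1"
    unfolding gsum_eq[symmetric] power_add using x by (metis mult.commute mult_dvd_mono)
  moreover obtain k where "r = p ^ e * k" using r by auto
  ultimately show ?thesis using dvd_power_minus_one[of _ "x ^ (p ^ e)" k] by (simp add: power_mult)
qed

section \<open>Relations between powers of the generators\<close>

context group
begin

lemma mult_inv_cancel [simp]:
  assumes "x \<in> carrier G" "y \<in> carrier G"
  shows "x \<otimes> (inv x \<otimes> y) = y" "inv x \<otimes> (x \<otimes> y) = y"
  using assms by (simp_all add: m_assoc[symmetric])

lemma conj_swap_iff:
  assumes "x \<in> carrier G" "y \<in> carrier G" "z \<in> carrier G"
  shows "x \<otimes> y = y \<otimes> z \<longleftrightarrow> inv y \<otimes> x = z \<otimes> inv y"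
proof
  assume "x \<otimes> y = y \<otimes> z"
  then have "inv y \<otimes> (x \<otimes> y) \<otimes> inv y = inv y \<otimes> (y \<otimes> z) \<otimes> inv y" by simp
  then show "inv y \<otimes> x = z \<otimes> inv y" using assms by (simp add: m_assoc)
next
  assume "inv y \<otimes> x = z \<otimes> inv y"
  then have "y \<otimes> (inv y \<otimes> x) \<otimes> y = y \<otimes> (z \<otimes> inv y) \<otimes> y" by simp
  then show "x \<otimes> y = y \<otimes> z" using assms by (simp add: m_assoc)
qed

text \<open>An equation \<open>x y = y z\<close> says that z is x conjugated by y, and conjugation
  respects powers. Conjugations are kept in this inverse-free shape throughout.\<close>

lemma int_pow_conj:
  assumes "x \<in> carrier G" "y \<in> carrier G" "z \<in> carrier G" "x \<otimes> y = y \<otimes> z"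
  shows "x [^] (k::int) \<otimes> y = y \<otimes> z [^] k"
proof -
  have nat: "x [^] n \<otimes> y = y \<otimes> z [^] n" for n :: nat
  proof (induction n)
    case (Suc n)
    have "x [^] Suc n \<otimes> y = x [^] n \<otimes> (x \<otimes> y)" using assms by (simp add: m_assoc)
    also have "\<dots> = (x [^] n \<otimes> y) \<otimes> z" using assms by (simp add: m_assoc)
    finally show ?case using assms Suc by (simp add: m_assoc)
  qed (use assms in simp)
  show ?thesis
  proof (cases k rule: int_cases2)
    case (nonneg n)
    then show ?thesis using nat[of n] by (simp add: int_pow_int)
  next
    case (nonpos n)
    have "inv (x [^] n) \<otimes> (x [^] n \<otimes> y) \<otimes> inv (z [^] n)
        = inv (x [^] n) \<otimes> (y \<otimes> z [^] n) \<otimes> inv (z [^] n)"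
      by (simp only: nat)
    then have "inv (x [^] n) \<otimes> y = y \<otimes> inv (z [^] n)" using assms by (simp add: m_assoc)
    then show ?thesis using assms nonpos by (simp add: int_pow_neg int_pow_int)
  qed
qed

lemma int_pow_commute:
  assumes "x \<in> carrier G" "y \<in> carrier G" "x \<otimes> y = y \<otimes> x"
  shows "x [^] (k::int) \<otimes> y = y \<otimes> x [^] k"
  using int_pow_conj[of x y x k] assms by simp

lemma semidirect_pow:
  assumes "x \<in> carrier G" "c \<in> carrier G" "x \<otimes> c = c \<otimes> x [^] (g::int)"
  shows "x [^] (k::int) \<otimes> c [^] (n::nat) = c [^] n \<otimes> x [^] (k * g ^ n)"
proof (induction n arbitrary: k)
  case (Suc n)
  have "x [^] k \<otimes> c [^] Suc n = (x [^] k \<otimes> c [^] n) \<otimes> c" using assms by (simp add: m_assoc)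
  also have "\<dots> = c [^] n \<otimes> (x [^] (k * g ^ n) \<otimes> c)" using Suc assms by (simp add: m_assoc)
  also have "x [^] (k * g ^ n) \<otimes> c = c \<otimes> (x [^] g) [^] (k * g ^ n)"
    using assms by (intro int_pow_conj) auto
  finally show ?case using assms by (simp add: m_assoc int_pow_pow mult_ac)
qed (use assms in simp)

text \<open>Moving every c to the left raises the factors x to the powers g, g^2, ..., g^n; this is
  how geometric sums enter.\<close>

lemma semidirect_mult_pow:
  assumes "x \<in> carrier G" "c \<in> carrier G" "x \<otimes> c = c \<otimes> x [^] (g::int)"
  shows "(x \<otimes> c) [^] (n::nat) = c [^] n \<otimes> x [^] (g * gsum g n)"
proof (induction n)
  case (Suc n)
  have "(x \<otimes> c) [^] Suc n = c [^] n \<otimes> x [^] (g * gsum g n) \<otimes> (x \<otimes> c)" using assms Suc by simp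
  also have "\<dots> = c [^] n \<otimes> (x [^] (g * gsum g n + 1) \<otimes> c [^] (1::nat))"
    using assms by (simp add: m_assoc int_pow_mult)
  also have "\<dots> = c [^] n \<otimes> (c [^] (1::nat) \<otimes> x [^] ((g * gsum g n + 1) * g ^ 1))"
    by (simp only: semidirect_pow[OF assms])
  finally show ?case using assms by (simp add: m_assoc gsum_Suc algebra_simps)
qed (use assms in simp)

lemma pow_eq_one_of_pow_eq:
  assumes "x \<in> carrier G" "x [^] (i::int) = x [^] (j::int)"
  shows "x [^] (i - j) = \<one>"
  using assms by (simp add: int_pow_diff)

end

section \<open>The defining relations and the key relation\<close>

text \<open>The exponent that arises from a^(-n) (a c)^n = c^n
  a^(-\<open>mac_exp \<alpha> n\<close>).\<close>

definition mac_exp :: "int \<Rightarrow> nat \<Rightarrow> int" where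
  "mac_exp x n = int n * x ^ n - x * gsum x n"

text \<open>Inverse-free forms of c = [a,b], a^c = a^\<alpha> and, because [b,a] is the inverse of
  c, b^[b,a] = b^\<beta>. The elements live in an arbitrary group so that the consequences also
  apply to powers of the generators and to subgroups.\<close>

locale macdonald = group G for G (structure) +
  fixes a b c :: 'a and \<alpha> \<beta> :: int
  assumes a_closed [simp, intro]: "a \<in> carrier G"
    and b_closed [simp, intro]: "b \<in> carrier G"
    and c_closed [simp, intro]: "c \<in> carrier G"
    and ab: "a \<otimes> b = b \<otimes> (a \<otimes> c)"
    and ac: "a \<otimes> c = c \<otimes> a [^] \<alpha>"
    and cb: "c \<otimes> b = b [^] \<beta> \<otimes> c"
begin

lemma ba: "b \<otimes> a = a \<otimes> (b \<otimes> inv c)"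
  using arg_cong[OF ab, of "\<lambda>x. x \<otimes> inv c"] by (simp add: m_assoc)

lemma bc: "b \<otimes> inv c = inv c \<otimes> b [^] \<beta>"
  using conj_swap_iff[of b "inv c" "b [^] \<beta>"] cb by simp

lemma ca: "inv c \<otimes> a = a [^] \<alpha> \<otimes> inv c"
  using conj_swap_iff[of a c "a [^] \<alpha>"] ac by simp

text \<open>The symmetry of the presentation: exchanging a with b and \<alpha> with \<beta> inverts
  c. Every result about a thereby yields one about b.\<close>

lemma swap: "macdonald G b a (inv c) \<beta> \<alpha>"
  by unfold_locales (use ba bc ca in auto)

lemma a_c: "a [^] (k::int) \<otimes> c [^] (n::nat) = c [^] n \<otimes> a [^] (k * \<alpha> ^ n)"
  using ac by (intro semidirect_pow) auto

lemma b_c: "c [^] (n::nat) \<otimes> b [^] (k::int) = b [^] (k * \<beta> ^ n) \<otimes> c [^] n"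
proof -
  have "b [^] k \<otimes> inv c [^] n = inv c [^] n \<otimes> b [^] (k * \<beta> ^ n)"
    using bc by (intro semidirect_pow) auto
  then show ?thesis
    using conj_swap_iff[of "b [^] k" "inv c [^] n" "b [^] (k * \<beta> ^ n)"]
    by (simp add: nat_pow_inv)
qed

lemma a_b: "a [^] (k::int) \<otimes> b = b \<otimes> (a \<otimes> c) [^] k"
  using ab by (intro int_pow_conj) auto

lemma ac_pow: "(a \<otimes> c) [^] (n::nat) = c [^] n \<otimes> a [^] (\<alpha> * gsum \<alpha> n)"
  using ac by (intro semidirect_mult_pow) auto

lemma a_pow_b: "a [^] int n \<otimes> b = b \<otimes> (c [^] n \<otimes> a [^] (\<alpha> * gsum \<alpha> n))"
  using a_b[of "int n"] by (simp only: int_pow_int ac_pow)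

text \<open>Obtained by evaluating the commutator of \<open>a ^ M\<close> and \<open>b\<close> in two ways, once by conjugating
  \<open>a ^ M\<close> with \<open>b\<close> and once by conjugating \<open>b\<close> with \<open>a ^ M = c ^ -i a c ^ i\<close>.\<close>
lemma key_relation:
  assumes M: "int M = \<alpha> ^ i" and N: "int N = \<beta> ^ i"
  shows "b [^] mac_exp \<beta> N \<otimes> c [^] (i + N) = c [^] (i + M) \<otimes> a [^] (- mac_exp \<alpha> M)"
proof -
  define Z where "Z = (a \<otimes> c) [^] M"
  define V where "V = (b \<otimes> inv c) [^] N"
  define D where "D = b [^] (int N) \<otimes> c [^] i"
  have [simp]: "Z \<in> carrier G" "V \<in> carrier G" "D \<in> carrier G" by (auto simp: Z_def V_def D_def)
  have a1: "a \<otimes> c [^] i = c [^] i \<otimes> a [^] int M" using a_c[of 1 i] M by simp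
  have b1: "c [^] i \<otimes> b = D" using b_c[of i 1] N by (simp add: D_def)
  have X1: "a [^] int M \<otimes> b = b \<otimes> Z" using a_b[of "int M"] by (simp add: Z_def int_pow_int)
  have V1: "b [^] int N \<otimes> a = a \<otimes> V"
    using int_pow_conj[of b a "b \<otimes> inv c" "int N"] ba by (simp add: V_def int_pow_int)
  \<comment> \<open>By \<open>b1\<close>, D is also \<open>c ^ i b\<close>. This form carries a
    first to \<open>a ^ M\<close> and then to Z; the form \<open>b ^ N c ^ i\<close> gives the next
    equation, and comparing the two expresses D through V and Z.\<close>
  have "a \<otimes> D = D \<otimes> Z"
  proof -
    have "a \<otimes> D = (a \<otimes> c [^] i) \<otimes> b" unfolding b1[symmetric] by (simp add: m_assoc)
    also have "\<dots> = c [^] i \<otimes> (a [^] int M \<otimes> b)" unfolding a1 by (simp add: m_assoc)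
    also have "\<dots> = D \<otimes> Z" unfolding X1 b1[symmetric] by (simp add: m_assoc)
    finally show ?thesis .
  qed
  moreover have "a \<otimes> (V \<otimes> c [^] i) = D \<otimes> a [^] int M"
  proof -
    have "a \<otimes> (V \<otimes> c [^] i) = b [^] int N \<otimes> (a \<otimes> c [^] i)" 
      using arg_cong[OF V1, of "\<lambda>x. x \<otimes> c [^] i"] by (simp add: m_assoc)
    then show ?thesis unfolding a1 D_def by (simp add: m_assoc)
  qed
  ultimately have "a \<otimes> D = a \<otimes> (V \<otimes> c [^] i) \<otimes> a [^] (- int M) \<otimes> Z"
    by (simp add: int_pow_neg m_assoc)
  then have "a \<otimes> D = a \<otimes> (V \<otimes> c [^] i \<otimes> a [^] (- int M) \<otimes> Z)"
    by (simp add: m_assoc)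
  then have D1: "D = V \<otimes> c [^] i \<otimes> a [^] (- int M) \<otimes> Z" by simp
  have "a [^] (- int M) \<otimes> Z = c [^] M \<otimes> a [^] (- mac_exp \<alpha> M)"
  proof -
    have "a [^] (- int M) \<otimes> Z = (a [^] (- int M) \<otimes> c [^] M) \<otimes> a [^] (\<alpha> * gsum \<alpha> M)"
      by (simp add: Z_def ac_pow m_assoc)
    also have "\<dots> = c [^] M \<otimes> (a [^] (- int M * \<alpha> ^ M) \<otimes> a [^] (\<alpha> * gsum \<alpha> M))"
      by (simp only: a_c) (simp add: m_assoc)
    finally show ?thesis by (simp add: mac_exp_def flip: int_pow_mult)
  qed
  then have D2: "D = V \<otimes> (c [^] (i + M) \<otimes> a [^] (- mac_exp \<alpha> M))"
    using D1 by (simp add: m_assoc nat_pow_mult[symmetric])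
  have "c [^] N \<otimes> V = b [^] (\<beta> * gsum \<beta> N)"
    unfolding V_def using macdonald.ac_pow[OF swap, of N] by (simp add: nat_pow_inv)
  then have "c [^] N \<otimes> D = b [^] (\<beta> * gsum \<beta> N) \<otimes> (c [^] (i + M) \<otimes> a [^] (- mac_exp \<alpha> M))"
    by (subst D2) (simp add: m_assoc[symmetric])
  moreover have "c [^] N \<otimes> D = b [^] (int N * \<beta> ^ N) \<otimes> c [^] (i + N)"
  proof -
    have "c [^] N \<otimes> D = (c [^] N \<otimes> b [^] int N) \<otimes> c [^] i" by (simp add: D_def m_assoc)
    also have "\<dots> = b [^] (int N * \<beta> ^ N) \<otimes> c [^] (i + N)"
      unfolding b_c by (simp add: m_assoc nat_pow_mult add.commute)
    finally show ?thesis .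
  qed
  moreover have "int N * \<beta> ^ N = \<beta> * gsum \<beta> N + mac_exp \<beta> N" by (simp add: mac_exp_def)
  ultimately show ?thesis by (simp add: int_pow_mult m_assoc)
qed

text \<open>Conjugating the key relation by \<open>c\<close> scales \<open>a\<close> and \<open>b\<close> in opposite directions; the quotient of the
  two relations is free of the exponents of \<open>c\<close> that differ.\<close>
lemma key_relation_conj:
  assumes M: "int M = \<alpha> ^ i" and N: "int N = \<beta> ^ i"
  shows "b [^] (\<alpha> * (\<beta> - 1) * mac_exp \<beta> N) \<otimes> c [^] (i + M)
       = c [^] (i + M) \<otimes> a [^] ((\<alpha> - 1) * mac_exp \<alpha> M)"
proof -
  define W Y where "W = mac_exp \<beta> N" and "Y = mac_exp \<alpha> M"
  define K L where "K = c [^] (i + N)" and "L = c [^] (i + M)"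
  \<comment> \<open>Conjugation by c raises a to the power \<alpha>, so conjugating in the other
    direction extracts an \<alpha>-th root of \<open>a ^ (- Y)\<close>, which need not be a known
    power of a. Raising to the power \<alpha> at the end removes it.\<close>
  define U where "U = c \<otimes> a [^] (- Y) \<otimes> inv c"
  have [simp]: "K \<in> carrier G" "L \<in> carrier G" "U \<in> carrier G" by (auto simp: K_def L_def U_def)
  have cK: "c \<otimes> K = K \<otimes> c" and cL: "c \<otimes> L = L \<otimes> c"
    by (simp_all add: K_def L_def nat_pow_comm[of c _ 1, simplified])
  have R: "b [^] W \<otimes> K = L \<otimes> a [^] (- Y)"
    using key_relation[OF M N] by (simp add: W_def Y_def K_def L_def)
  have Uc: "U \<otimes> c = c \<otimes> a [^] (- Y)" by (simp add: U_def m_assoc)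
  have "c \<otimes> (a [^] \<alpha>) [^] (- Y) = a [^] (-Y) \<otimes> c"
    by (rule int_pow_conj[symmetric]) (auto simp: ac)
  then have Ua: "U [^] \<alpha> = a [^] (- Y)"
  proof -
    have "U [^] \<alpha> \<otimes> c = c \<otimes> (a [^] (- Y)) [^] \<alpha>" by (rule int_pow_conj) (auto simp: Uc)
    also have "\<dots> = a [^] (- Y) \<otimes> c"
      using \<open>c \<otimes> (a [^] \<alpha>) [^] (- Y) = _\<close> by (simp add: int_pow_pow mult.commute)
    finally show ?thesis by simp
  qed
  have "b [^] (\<beta> * W) \<otimes> K = L \<otimes> U"
  proof -
    have "b [^] (\<beta> * W) \<otimes> K \<otimes> c = b [^] (\<beta> * W) \<otimes> c \<otimes> K" by (simp add: m_assoc cK)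
    also have "b [^] (\<beta> * W) \<otimes> c = c \<otimes> b [^] W" using b_c[of 1 W] by (simp add: mult.commute)
    also have "c \<otimes> b [^] W \<otimes> K = c \<otimes> L \<otimes> a [^] (- Y)" by (simp add: m_assoc R)
    also have "\<dots> = L \<otimes> U \<otimes> c" by (simp add: cL m_assoc Uc)
    finally show ?thesis by simp
  qed
  moreover have "b [^] (\<beta> * W) \<otimes> K = b [^] ((\<beta> - 1) * W) \<otimes> (b [^] W \<otimes> K)"
    using int_pow_mult[of b "(\<beta> - 1) * W" W] by (simp add: m_assoc[symmetric] left_diff_distrib)
  ultimately have "b [^] ((\<beta> - 1) * W) \<otimes> (L \<otimes> U [^] \<alpha>) = L \<otimes> U" by (simp add: R Ua)
  then have "b [^] ((\<beta> - 1) * W) \<otimes> L \<otimes> U [^] \<alpha> \<otimes> U [^] (- \<alpha>) = L \<otimes> U [^] (1::int) \<otimes> U [^] (- \<alpha>)"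
    by (simp add: m_assoc)
  then have "b [^] ((\<beta> - 1) * W) \<otimes> L = L \<otimes> U [^] (1 - \<alpha>)"
    by (simp add: m_assoc int_pow_mult[symmetric] del: int_pow_1)
  then have "(b [^] ((\<beta> - 1) * W)) [^] \<alpha> \<otimes> L = L \<otimes> (U [^] (1 - \<alpha>)) [^] \<alpha>"
    by (intro int_pow_conj) auto
  moreover have "(U [^] (1 - \<alpha>)) [^] \<alpha> = (U [^] \<alpha>) [^] (1 - \<alpha>)" by (simp add: int_pow_pow mult.commute)
  ultimately show ?thesis
    unfolding Ua by (simp add: int_pow_pow W_def Y_def L_def algebra_simps)
qed

lemma commutes_c:
  assumes "z \<in> carrier G" "z \<otimes> a = a \<otimes> z" "z \<otimes> b = b \<otimes> z"
  shows "z \<otimes> c = c \<otimes> z"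
proof -
  have "b \<otimes> a \<otimes> (z \<otimes> c) = b \<otimes> (a \<otimes> z) \<otimes> c" using assms(1) by (simp add: m_assoc)
  also have "\<dots> = b \<otimes> z \<otimes> (a \<otimes> c)" using assms(1) unfolding assms(2)[symmetric] by (simp add: m_assoc)
  also have "\<dots> = z \<otimes> (a \<otimes> b)" using assms(1) unfolding ab assms(3)[symmetric] by (simp add: m_assoc)
  also have "\<dots> = a \<otimes> (z \<otimes> b)"
    using assms(1) by (simp add: m_assoc[symmetric] assms(2))
  also have "\<dots> = a \<otimes> b \<otimes> z" using assms(1) unfolding assms(3) by (simp add: m_assoc)
  also have "\<dots> = b \<otimes> a \<otimes> (c \<otimes> z)" using assms(1) unfolding ab by (simp add: m_assoc)
  finally show ?thesis using assms by simp
qed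

text \<open>A power of a commuting with b commutes with both generators, hence with c; but c raises
  it to the power \<alpha>.\<close>

lemma commute_a_pow_kill:
  assumes "a [^] (k::int) \<otimes> b = b \<otimes> a [^] k"
  shows "a [^] (k * (\<alpha> - 1)) = \<one>"
proof -
  have "a [^] k \<otimes> c = c \<otimes> a [^] k"
    using assms by (intro commutes_c) (auto intro: int_pow_commute)
  then have "a [^] (k * \<alpha>) = a [^] k" using a_c[of k 1] by simp
  from pow_eq_one_of_pow_eq[OF _ this] show ?thesis by (simp add: algebra_simps)
qed

text \<open>By \<open>key_relation_conj\<close>, a power of c conjugates \<open>b ^ l\<close> to
  \<open>a ^ k\<close>. Raising to \<beta>^(i+M) undoes the conjugation on the b side, so a power of
  a equals \<open>b ^ l\<close> and commutes with b.\<close>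

lemma a_pow_eq_one:
  assumes M: "int M = \<alpha> ^ i" and N: "int N = \<beta> ^ i"
  shows "a [^] ((\<alpha> - 1)\<^sup>2 * mac_exp \<alpha> M * \<beta> ^ (i + M)) = \<one>"
proof -
  define k l where "k = (\<alpha> - 1) * mac_exp \<alpha> M" and "l = \<alpha> * (\<beta> - 1) * mac_exp \<beta> N"
  have "b [^] l \<otimes> c [^] (i + M) = c [^] (i + M) \<otimes> a [^] k"
    using key_relation_conj[OF M N] by (simp add: k_def l_def)
  then have "(b [^] l) [^] (\<beta> ^ (i + M)) \<otimes> c [^] (i + M) = c [^] (i + M) \<otimes> (a [^] k) [^] (\<beta> ^ (i + M))"
    by (intro int_pow_conj) auto
  moreover have "(b [^] l) [^] (\<beta> ^ (i + M)) \<otimes> c [^] (i + M) = c [^] (i + M) \<otimes> b [^] l"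
    by (simp add: b_c int_pow_pow)
  ultimately have "a [^] (k * \<beta> ^ (i + M)) = b [^] l" by (simp add: int_pow_pow)
  then have "a [^] (k * \<beta> ^ (i + M)) \<otimes> b = b \<otimes> a [^] (k * \<beta> ^ (i + M))"
    using int_pow_commute[of b b l] by simp
  from commute_a_pow_kill[OF this] show ?thesis by (simp add: k_def power2_eq_square mult_ac)
qed

text \<open>As for \<open>a_pow_eq_one\<close>, except that \<beta> is now invertible modulo a
  period of b, so the factor \<beta>^(i+M) can be divided out of the exponent.\<close>

lemma a_pow_central:
  assumes M: "int M = \<alpha> ^ i" and N: "int N = \<beta> ^ i" and z: "b [^] z = \<one>" "coprime \<beta> z"
  shows "a [^] ((\<alpha> - 1) * mac_exp \<alpha> M) \<otimes> b = b \<otimes> a [^] ((\<alpha> - 1) * mac_exp \<alpha> M)"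
proof -
  define k l where "k = (\<alpha> - 1) * mac_exp \<alpha> M" and "l = \<alpha> * (\<beta> - 1) * mac_exp \<beta> N"
  have 1: "b [^] l \<otimes> c [^] (i + M) = c [^] (i + M) \<otimes> a [^] k"
    using key_relation_conj[OF M N] by (simp add: k_def l_def)
  obtain x where "[\<beta> ^ (i + M) * x = 1] (mod z)"
    using z(2) by (metis cong_solve_coprime_int coprime_power_left_iff)
  then obtain y where y: "\<beta> ^ (i + M) * x = 1 + z * y" by (metis cong_iff_lin cong_sym_eq)
  have "b [^] (l * (z * y)) = \<one>" using z(1)
    using int_pow_pow[of b z "l * y"] by (simp add: mult_ac)
  then have "b [^] l = b [^] (l * x * \<beta> ^ (i + M))"
    using y by (simp add: mult_ac int_pow_mult distrib_left)
  then have "c [^] (i + M) \<otimes> a [^] k = c [^] (i + M) \<otimes> b [^] (l * x)"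
    using 1 by (simp add: b_c)
  then have "a [^] k = b [^] (l * x)" by simp
  then show ?thesis using int_pow_commute[of b b "l * x"] by (simp add: k_def)
qed

end

lemma (in group) macdonaldI:
  assumes ab: "a \<in> carrier G" "b \<in> carrier G" and c: "c = inv a \<otimes> inv b \<otimes> a \<otimes> b"
    and a: "inv c \<otimes> (a \<otimes> c) \<otimes> inv (a [^] \<alpha>) = \<one>"
    and b: "c \<otimes> (b \<otimes> inv c) \<otimes> inv (b [^] \<beta>) = \<one>"
  shows "macdonald G a b c \<alpha> \<beta>"
proof
  show cl: "c \<in> carrier G" using ab by (simp add: c)
  have "inv c \<otimes> (a \<otimes> c) = a [^] \<alpha>"
    using a ab cl by (metis int_pow_closed inv_closed inv_equality inv_inv m_closed)
  then show "a \<otimes> c = c \<otimes> a [^] \<alpha>" using ab cl by (metis m_closed mult_inv_cancel(1))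
  have "c \<otimes> (b \<otimes> inv c) = b [^] \<beta>"
    using b ab cl by (metis int_pow_closed inv_closed inv_equality inv_inv m_closed)
  from arg_cong[OF this, of "\<lambda>x. x \<otimes> c"] show "c \<otimes> b = b [^] \<beta> \<otimes> c" using ab cl by (simp add: m_assoc)
  show "a \<otimes> b = b \<otimes> (a \<otimes> c)" unfolding c using ab by (simp add: m_assoc)
qed (use ab in auto)

lemma mac_exp_mult: "(x - 1) * mac_exp x n = (x - 1) * int n * x ^ n - x * (x ^ n - 1)"
  unfolding mac_exp_def gsum_eq[symmetric] by (simp add: algebra_simps)

text \<open>If it vanished, \<open>x ^ M * (x\<^sup>2 - x - 1) + 1\<close> would be 0, and x would
  divide 1.\<close>

lemma mac_exp_square_nonzero:
  assumes "int M = x\<^sup>2" "\<bar>x\<bar> \<noteq> 1" "x \<noteq> 0"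
  shows "mac_exp x M \<noteq> 0"
proof
  assume "mac_exp x M = 0"
  then have "(x - 1) * x\<^sup>2 * x ^ M - x * (x ^ M - 1) = 0"
    using mac_exp_mult[of x M] assms(1) by simp
  then have "x * (x ^ M * (x\<^sup>2 - x - 1) + 1) = 0"
    by (simp add: algebra_simps power2_eq_square)
  then have "x ^ M * (x\<^sup>2 - x - 1) + 1 = 0" using assms(3) by simp
  moreover have "M > 0" using assms(1,3) by (metis of_nat_0_less_iff zero_less_power2)
  then have "x dvd x ^ M * (x\<^sup>2 - x - 1)" by (simp add: dvd_power)
  ultimately have "x dvd 1" by (metis dvd_add_right_iff dvd_0_right)
  then show False using assms(2) by (simp add: zdvd1_eq)
qed

lemma (in group) int_pow_cong:
  assumes "x \<in> carrier G" "int (ord x) dvd k - l"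
  shows "x [^] k = x [^] (l::int)"
proof -
  have "x [^] (k - l) = \<one>" using assms by (simp add: int_pow_eq_id)
  then have "x [^] (k - l) \<otimes> x [^] l = x [^] l" using assms by simp
  then show ?thesis using assms by (simp add: int_pow_mult[symmetric])
qed

section \<open>Finite orders and their prime divisors\<close>

context macdonald
begin

lemma change_exponents:
  assumes "a [^] \<alpha>' = a [^] \<alpha>" "b [^] \<beta>' = b [^] \<beta>"
  shows "macdonald G a b c \<alpha>' \<beta>'"
  by unfold_locales (use assms ab ac cb in auto)

lemma ord_a_pos:
  assumes "\<bar>\<alpha>\<bar> \<noteq> 1" "\<alpha> \<noteq> 0" "\<beta> \<noteq> 0"
  shows "ord a > 0"
proof -
  have "\<alpha> \<noteq> 1" using assms(1) by auto
  \<comment> \<open>The choice i = 2 makes \<alpha>^i and \<beta>^i natural numbers whatever the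
    signs of \<alpha> and \<beta>.\<close>
  define M N where "M = nat (\<alpha>\<^sup>2)" and "N = nat (\<beta>\<^sup>2)"
  have M: "int M = \<alpha>\<^sup>2" and N: "int N = \<beta>\<^sup>2" by (simp_all add: M_def N_def)
  have "int (ord a) dvd (\<alpha> - 1)\<^sup>2 * mac_exp \<alpha> M * \<beta> ^ (2 + M)"
    using a_pow_eq_one[OF M N] by (simp add: int_pow_eq_id)
  moreover have "(\<alpha> - 1)\<^sup>2 * mac_exp \<alpha> M * \<beta> ^ (2 + M) \<noteq> 0"
    using assms \<open>\<alpha> \<noteq> 1\<close> mac_exp_square_nonzero[OF M] by simp
  ultimately show ?thesis by (metis dvd_0_left_iff of_nat_0 neq0_conv)
qed

text \<open>If a prime q divided both \<alpha> and \<open>ord a = q * k\<close>, then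
  \<open>a ^ (k * \<alpha>)\<close> would be trivial; it is conjugate to \<open>a ^ k\<close>, which
  would then be trivial too.\<close>

lemma coprime_ord_a:
  assumes "ord a > 0"
  shows "coprime \<alpha> (int (ord a))"
proof (rule ccontr)
  assume "\<not> coprime \<alpha> (int (ord a))"
  then obtain q where q: "Factorial_Ring.prime q" "q dvd \<alpha>" "q dvd int (ord a)"
    by (metis coprime_iff_gcd_eq_1 gcd_dvd1 gcd_dvd2 dvd_trans is_unit_gcd prime_factor_int[of "gcd \<alpha> (int (ord a))"] abs_gcd_int)
  then obtain k where k: "int (ord a) = q * k" by blast
  obtain l where l: "\<alpha> = q * l" using q by blast
  have "a [^] (k * \<alpha>) = \<one>" unfolding int_pow_eq_id[OF a_closed] using k l by (simp add: mult_ac)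
  then have "a [^] k = \<one>" using a_c[of k 1] by simp
  then have "q * k dvd k" by (simp add: int_pow_eq_id k[symmetric])
  moreover have "k > 0" using k q(1) assms
    by (metis prime_gt_0_int zero_less_mult_pos of_nat_0_less_iff)
  ultimately have "q \<le> 1" using zdvd_imp_le[of "q * k" k] by simp
  then show False using prime_gt_1_int[OF q(1)] by simp
qed

text \<open>The element \<open>a c\<close> is a conjugate of a, so its power with exponent
  \<open>ord a\<close> is trivial; on the other hand \<open>a c\<close> acts on a like c, by raising
  to the power \<alpha>.\<close>

lemma ord_a_dvd_power:
  "int (ord a) dvd \<alpha> ^ ord a - 1"
proof -
  have "b \<otimes> (a \<otimes> c) [^] ord a = b" using a_b[of "int (ord a)"] by (simp add: int_pow_int)
  then have 1: "(a \<otimes> c) [^] ord a = \<one>" by simp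
  have "a [^] (1::int) \<otimes> (a \<otimes> c) [^] ord a = (a \<otimes> c) [^] ord a \<otimes> a [^] (1 * \<alpha> ^ ord a)"
  proof (rule semidirect_pow)
    have "a \<otimes> (a \<otimes> c) = a \<otimes> (c \<otimes> a [^] \<alpha>)" by (simp only: ac)
    then show "a \<otimes> (a \<otimes> c) = a \<otimes> c \<otimes> a [^] \<alpha>"
      by (simp only: m_assoc a_closed c_closed int_pow_closed)
  qed auto
  then have "a [^] (\<alpha> ^ ord a) = a [^] (1::int)" by (simp add: 1)
  from pow_eq_one_of_pow_eq[OF _ this] show ?thesis by (simp add: int_pow_eq_id)
qed

lemma c_pow_ord_a: "c [^] ord a = a [^] (- (\<alpha> * gsum \<alpha> (ord a)))"
proof -
  have "b \<otimes> (c [^] ord a \<otimes> a [^] (\<alpha> * gsum \<alpha> (ord a))) = b"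
    using a_pow_b[of "ord a"] by (simp add: int_pow_int)
  then have "c [^] ord a \<otimes> a [^] (\<alpha> * gsum \<alpha> (ord a)) = \<one>" by simp
  then show ?thesis by (simp add: int_pow_neg inv_equality)
qed

lemma ord_c_dvd: "ord c dvd ord a * ord a"
proof -
  have "c [^] (ord a * ord a) = \<one>"
    unfolding nat_pow_pow[OF c_closed, symmetric] c_pow_ord_a
    by (simp add: int_pow_int[symmetric] int_pow_pow int_pow_eq_id)
  then show ?thesis by (simp add: pow_eq_id)
qed

text \<open>If \<open>d\<close> is the order of \<open>\<alpha>\<close> modulo \<open>r\<close>, then the key relation for \<open>i = totient d\<close> forces \<open>d\<close> to divide
  \<open>totient d\<close>, so that \<open>d = 1\<close>.\<close>
lemma prime_dvd_ord_a_pos: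
  assumes pos: "\<alpha> > 0" "\<beta> > 0" "ord a > 0" "ord b > 0"
    and r: "Factorial_Ring.prime r" "r dvd ord a"
  shows "int r dvd \<alpha> - 1"
proof (rule ccontr)
  assume not: "\<not> int r dvd \<alpha> - 1"
  define A where "A = nat \<alpha>"
  have A: "\<alpha> = int A" using pos by (simp add: A_def)
  have cop: "coprime A (ord a)" using coprime_ord_a[OF pos(3)] A by simp
  then have copr: "coprime r A" using r(2) by (metis coprime_commute coprime_divisors dvd_refl)
  define d where "d = Pocklington.ord r A"
  have "[A ^ ord a = 1] (mod r)"
  proof -
    have "int r dvd \<alpha> ^ ord a - 1" using ord_a_dvd_power r(2) by (meson dvd_trans of_nat_dvd_iff)
    then have "[int (A ^ ord a) = int 1] (mod int r)" by (simp add: A cong_iff_dvd_diff)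
    then show ?thesis by (simp only: cong_int_iff)
  qed
  then have "d dvd ord a" unfolding d_def by (simp only: ord_divides)
  then have copd: "coprime A d" using cop by (metis coprime_divisors dvd_refl)
  have d0: "d > 0" using \<open>d dvd ord a\<close> pos(3) by (meson dvd_pos_nat)
  define i M N where "i = totient d" and "M = A ^ i" and "N = nat (\<beta> ^ i)"
  have M: "int M = \<alpha> ^ i" and N: "int N = \<beta> ^ i"
    using pos by (simp_all add: M_def N_def A)
  have M0: "M > 0" using pos A by (simp add: M_def)
  have "[M = 1] (mod d)" unfolding M_def i_def by (rule euler_theorem) (use copd in simp)
  then have "d dvd M - 1" by (rule cong_to_1_nat)
  then have "[A ^ (M - 1) = 1] (mod r)" by (simp add: d_def ord_divides')
  then have "[A * A ^ (M - 1) = A * 1] (mod r)" by (rule cong_scalar_left)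
  then have "[A ^ M = A] (mod r)" using M0 by (simp add: power_eq_if)
  then have "[int (A ^ M) = int A] (mod int r)" by (simp only: cong_int_iff)
  then have "int r dvd \<alpha> ^ M - \<alpha>" by (simp add: A cong_iff_dvd_diff)
  then obtain z where z: "\<alpha> ^ M = \<alpha> + int r * z" by (auto simp: dvd_def algebra_simps)
  have "int (ord a) dvd (\<alpha> - 1) * mac_exp \<alpha> M * (\<alpha> - 1)"
  proof -
    have "a [^] ((\<alpha> - 1) * mac_exp \<alpha> M) \<otimes> b = b \<otimes> a [^] ((\<alpha> - 1) * mac_exp \<alpha> M)"
      by (rule a_pow_central[OF M N, of "int (ord b)"])
        (use macdonald.coprime_ord_a[OF swap pos(4)] in \<open>auto simp: int_pow_int\<close>)
    from commute_a_pow_kill[OF this] show ?thesis by (simp add: int_pow_eq_id)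
  qed
  then have "int r dvd (\<alpha> - 1) * mac_exp \<alpha> M * (\<alpha> - 1)"
    using r(2) by (meson dvd_trans of_nat_dvd_iff)
  moreover have pr: "Factorial_Ring.prime (int r)" using r(1) by simp
  ultimately have "int r dvd (\<alpha> - 1) * mac_exp \<alpha> M"
    using not by (simp add: prime_dvd_mult_iff)
  then have "int r dvd (\<alpha> - 1) * int M * \<alpha> ^ M - \<alpha> * (\<alpha> ^ M - 1)" by (simp only: mac_exp_mult)
  \<comment> \<open>Since M is 1 modulo d, \<alpha>^M is \<alpha> modulo r. Up to multiples of r the
    exponent becomes \<alpha> (\<alpha> - 1)(M - 1), and only the last factor can absorb r.\<close>
  also have "(\<alpha> - 1) * int M * \<alpha> ^ M - \<alpha> * (\<alpha> ^ M - 1)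
      = \<alpha> * ((\<alpha> - 1) * (int M - 1)) + int r * (z * ((\<alpha> - 1) * int M - \<alpha>))"
    unfolding z by (simp add: algebra_simps)
  finally have "int r dvd \<alpha> * ((\<alpha> - 1) * (int M - 1))"
    by (metis dvd_add_left_iff dvd_triv_left)
  moreover have "\<not> int r dvd \<alpha>"
    using copr r(1) A by (metis coprime_absorb_left int_dvd_int_iff not_prime_unit)
  ultimately have "int r dvd int M - 1" using not pr by (simp add: prime_dvd_mult_iff)
  then have "[int M = int 1] (mod int r)" by (simp add: cong_iff_dvd_diff)
  then have "[A ^ i = 1] (mod r)" unfolding M_def by (simp only: cong_int_iff)
  then have "d dvd totient d" by (simp add: d_def ord_divides' i_def)
  then have "d \<le> totient d" using d0 by (intro dvd_imp_le) auto
  then have "d = 1" using d0 totient_less[of d] by linarith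
  then have "[A = 1] (mod r)" using ord_divides[of A 1 r] by (simp add: d_def)
  then have "[int A = int 1] (mod int r)" by (simp only: cong_int_iff)
  then show False using not by (simp add: A cong_iff_dvd_diff)
qed

text \<open>The relations see \<alpha> and \<beta> only modulo \<open>ord a\<close> and
  \<open>ord b\<close>, so both may be replaced by positive representatives.\<close>

lemma prime_dvd_ord_a:
  assumes pos: "ord a > 0" "ord b > 0" and r: "Factorial_Ring.prime r" "r dvd ord a"
  shows "int r dvd \<alpha> - 1"
proof -
  define \<alpha>' \<beta>' where "\<alpha>' = \<alpha> mod int (ord a) + int (ord a)" and "\<beta>' = \<beta> mod int (ord b) + int (ord b)"
  have a': "int (ord a) dvd \<alpha>' - \<alpha>" and b': "int (ord b) dvd \<beta>' - \<beta>"
    by (simp_all add: \<alpha>'_def \<beta>'_def mod_eq_dvd_iff[symmetric])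
  interpret m: macdonald G a b c \<alpha>' \<beta>'
    by (rule change_exponents) (use int_pow_cong a' b' in auto)
  have "\<alpha>' > 0" "\<beta>' > 0" using pos by (simp_all add: \<alpha>'_def \<beta>'_def add_nonneg_pos)
  then have "int r dvd \<alpha>' - 1" using m.prime_dvd_ord_a_pos pos r by blast
  moreover have "int r dvd \<alpha>' - \<alpha>" using a' r(2) by (meson dvd_trans of_nat_dvd_iff)
  ultimately have "int r dvd (\<alpha>' - 1) - (\<alpha>' - \<alpha>)" by (rule dvd_diff)
  then show ?thesis by simp
qed

end

section \<open>Projection of the generators to their p-parts\<close>

text \<open>Split n into parts dividing \<open>p ^ t\<close> and N. Modulo the first, e is 1 and
  \<open>gsum x (e - 1)\<close> vanishes, so \<open>gsum x e\<close> is 1 and \<open>x ^ e\<close>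
  is x; modulo the second, e and \<open>gsum x e\<close> both vanish. These are the congruences
  under which e-th powers of a and c satisfy the old relations.\<close>

lemma idempotent_exponent_gsum:
  fixes p t N n e :: nat
  assumes "coprime (p ^ t) N" "p ^ t dvd e - 1" "e > 0" "N dvd e" and n: "n dvd p ^ t * N" "n > 0"
    and x: "\<And>q. Factorial_Ring.prime q \<Longrightarrow> q dvd n \<Longrightarrow> int q dvd x - 1"
  shows "int n dvd gsum x e - int e" and "int n dvd int e * (x ^ e - x)"
proof -
  obtain n1 n2 where n12: "n = n1 * n2" "n1 dvd p ^ t" "n2 dvd N"
    using division_decomp[OF n(1)] by blast
  have pos: "n1 > 0" "n2 > 0" using n n12 by auto
  have e1: "n1 dvd e - 1" "n2 dvd e" using assms n12 by (auto intro: dvd_trans)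
  have cop: "coprime (int n1) (int n2)" using n12 assms(1) by (metis coprime_divisors coprime_int_iff)
  have x1: "int n1 dvd gsum x (e - 1)" and x2: "int n2 dvd gsum x e"
    using pos e1 x n12 by (auto intro!: dvd_gsum_of_primes)
  have e: "e = Suc (e - 1)" using assms(3) by simp
  have i1: "int n1 dvd int e - 1" 
  proof -
    have "int n1 dvd int (e - 1)" using e1(1) by simp
    then show ?thesis using assms(3) by (simp add: of_nat_diff)
  qed
  have "gsum x e - int e = x * gsum x (e - 1) - (int e - 1)" by (subst e, subst gsum_Suc) simp
  then have "int n1 dvd gsum x e - int e" using x1 i1 by (simp only: dvd_diff dvd_mult)
  moreover have "int n2 dvd gsum x e - int e" using x2 e1(2) by simp
  ultimately show "int n dvd gsum x e - int e" unfolding n12 of_nat_mult using cop by (intro divides_mult)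
  have "x ^ e - x = x * (x ^ (e - 1) - 1)" by (subst (1) e) (simp add: algebra_simps)
  also have "\<dots> = x * ((x - 1) * gsum x (e - 1))" by (simp add: gsum_eq)
  finally have "int n1 dvd x ^ e - x" using x1 by simp
  then show "int n dvd int e * (x ^ e - x)" unfolding n12 of_nat_mult mult.commute[of "int n1"]
    using e1(2) by (intro mult_dvd_mono) auto
qed

context macdonald
begin

lemma idempotent_power_a_b:
  assumes e: "int (ord a) dvd gsum \<alpha> e - int e" "int (ord a) dvd int e * (\<alpha> ^ e - \<alpha>)"
  shows "a [^] e \<otimes> c [^] e = c [^] e \<otimes> (a [^] e) [^] \<alpha>"
    and "a [^] e \<otimes> b = b \<otimes> (a [^] e \<otimes> c [^] e)"
proof -
  have 1: "a [^] (int e * \<alpha> ^ e) = a [^] (int e * \<alpha>)"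
    by (rule int_pow_cong) (use e(2) in \<open>simp_all add: algebra_simps\<close>)
  have 2: "a [^] (\<alpha> * gsum \<alpha> e) = a [^] (int e * \<alpha>)"
  proof (rule int_pow_cong)
    have "\<alpha> * gsum \<alpha> e - int e * \<alpha> = \<alpha> * (gsum \<alpha> e - int e)" by (simp add: algebra_simps)
    then show "int (ord a) dvd \<alpha> * gsum \<alpha> e - int e * \<alpha>" using e(1) by simp
  qed simp
  show 3: "a [^] e \<otimes> c [^] e = c [^] e \<otimes> (a [^] e) [^] \<alpha>"
    using a_c[of "int e" e] 1 by (simp add: int_pow_int[symmetric] int_pow_pow)
  show "a [^] e \<otimes> b = b \<otimes> (a [^] e \<otimes> c [^] e)"
    unfolding 3 using a_pow_b[of e] 2 by (simp add: int_pow_int[symmetric] int_pow_pow)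
qed

text \<open>For an idempotent exponent, e-th powers project onto the p-parts of the orders.\<close>
lemma idempotent_power:
  fixes p t N e :: nat
  assumes cop: "coprime (p ^ t) N" "p ^ t dvd e - 1" "e > 0" "N dvd e"
    and ords: "ord a dvd p ^ t * N" "ord b dvd p ^ t * N" "ord c dvd p ^ t * N"
    and pos: "ord a > 0" "ord b > 0"
  shows "macdonald G (a [^] e) (b [^] e) (c [^] e) \<alpha> \<beta>"
    and "a [^] e \<otimes> b = b \<otimes> (a [^] e \<otimes> c [^] e)"
    and "b [^] e \<otimes> a = a \<otimes> (b [^] e \<otimes> inv c [^] e)"
proof -
  interpret s: macdonald G b a "inv c" \<beta> \<alpha> by (rule swap)
  note A = idempotent_exponent_gsum[OF cop ords(1) pos(1)]
  note B = idempotent_exponent_gsum[OF cop ords(2) pos(2)]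
  have a1: "a [^] e \<otimes> c [^] e = c [^] e \<otimes> (a [^] e) [^] \<alpha>"
    and a2: "a [^] e \<otimes> b = b \<otimes> (a [^] e \<otimes> c [^] e)"
    using idempotent_power_a_b A[OF prime_dvd_ord_a[OF pos]] by blast+
  have b1: "b [^] e \<otimes> inv c [^] e = inv c [^] e \<otimes> (b [^] e) [^] \<beta>"
    and b2: "b [^] e \<otimes> a = a \<otimes> (b [^] e \<otimes> inv c [^] e)"
    using s.idempotent_power_a_b B[OF s.prime_dvd_ord_a[OF pos(2,1)]] by blast+
  show "a [^] e \<otimes> b = b \<otimes> (a [^] e \<otimes> c [^] e)"
    and "b [^] e \<otimes> a = a \<otimes> (b [^] e \<otimes> inv c [^] e)" by (fact a2 b2)+
  \<comment> \<open>Conjugation by \<open>b ^ e\<close> multiplies a by \<open>c ^ e\<close>; the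
    e-th power of the product is then computed as for \<open>a c\<close>, with \<gamma> in place of
    \<alpha>.\<close>
  have b3: "a \<otimes> b [^] e = b [^] e \<otimes> (a \<otimes> c [^] e)"
    using arg_cong[OF b2, of "\<lambda>x. x \<otimes> c [^] e"] by (simp add: m_assoc nat_pow_inv)
  define \<gamma> where "\<gamma> = \<alpha> ^ e"
  have ag: "a \<otimes> c [^] e = c [^] e \<otimes> a [^] \<gamma>" using a_c[of 1 e] by (simp add: \<gamma>_def)
  have cidem: "(c [^] e) [^] e = c [^] e"
  proof -
    have "p ^ t * N dvd (e - 1) * e" using cop by (intro mult_dvd_mono)
    then have "int (ord c) dvd int ((e - 1) * e)" using ords(3) by (meson dvd_trans of_nat_dvd_iff)
    also have "int ((e - 1) * e) = int (e * e) - int e" using cop(3) by (simp add: of_nat_diff algebra_simps)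
    finally have "c [^] int (e * e) = c [^] int e" by (intro int_pow_cong) auto
    then show ?thesis by (simp add: nat_pow_pow int_pow_int del: of_nat_mult)
  qed
  have "a [^] int e \<otimes> b [^] e = b [^] e \<otimes> (a \<otimes> c [^] e) [^] int e"
    by (rule int_pow_conj) (auto simp: b3)
  also have "(a \<otimes> c [^] e) [^] int e = (c [^] e) [^] e \<otimes> a [^] (\<gamma> * gsum \<gamma> e)"
    unfolding int_pow_int by (rule semidirect_mult_pow) (auto simp: ag)
  also have "\<dots> = c [^] e \<otimes> a [^] (int e * \<gamma>)"
  proof -
    have "int (ord a) dvd gsum \<gamma> e - int e"
      by (rule A) (auto simp: \<gamma>_def intro!: dvd_power_minus_one prime_dvd_ord_a[OF pos])
    then have "int (ord a) dvd \<gamma> * (gsum \<gamma> e - int e)" by simp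
    then have "a [^] (\<gamma> * gsum \<gamma> e) = a [^] (int e * \<gamma>)"
      by (intro int_pow_cong) (auto simp: algebra_simps)
    then show ?thesis by (simp add: cidem)
  qed
  also have "\<dots> = a [^] e \<otimes> c [^] e" using a_c[of "int e" e] by (simp add: int_pow_int \<gamma>_def)
  finally have ab': "a [^] e \<otimes> b [^] e = b [^] e \<otimes> (a [^] e \<otimes> c [^] e)" by (simp add: int_pow_int)
  have "c [^] e \<otimes> b [^] e = (b [^] e) [^] \<beta> \<otimes> c [^] e"
    using conj_swap_iff[of "b [^] e" "inv c [^] e" "(b [^] e) [^] \<beta>"] b1 by (simp add: nat_pow_inv)
  then show "macdonald G (a [^] e) (b [^] e) (c [^] e) \<alpha> \<beta>"
    by unfold_locales (use ab' a1 in auto)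
qed

end

section \<open>Generators of prime power order\<close>

lemma six_dvd_falling: "(6::int) dvd int n * (int n - 1) * (int n - 2)"
proof (induction n)
  case (Suc n)
  have "even (int n * (int n - 1))" by simp
  then obtain t where "int n * (int n - 1) = 2 * t" by blast
  then have "(6::int) dvd 3 * (int n * (int n - 1))" by simp
  moreover have "int (Suc n) * (int (Suc n) - 1) * (int (Suc n) - 2)
      = int n * (int n - 1) * (int n - 2) + 3 * (int n * (int n - 1))"
    by (simp add: algebra_simps)
  ultimately show ?case using Suc by (simp only: dvd_add)
qed simp

text \<open>Binomial expansion up to order u^2, multiplied by 6 to stay in the integers.\<close>

lemma gsum_expand:
  "\<exists>k. 6 * gsum (1 + u) n
     = 6 * int n + 3 * int n * (int n - 1) * u + int n * (int n - 1) * (int n - 2) * u\<^sup>2 + 6 * u ^ 3 * k"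
proof (induction n)
  case (Suc n)
  then obtain k where k: "6 * gsum (1 + u) n
     = 6 * int n + 3 * int n * (int n - 1) * u + int n * (int n - 1) * (int n - 2) * u\<^sup>2 + 6 * u ^ 3 * k" ..
  obtain l where l: "int n * (int n - 1) * (int n - 2) = 6 * l" using six_dvd_falling by blast
  have "6 * gsum (1 + u) (Suc n) = 6 + (1 + u) * (6 * gsum (1 + u) n)"
    by (simp add: gsum_Suc algebra_simps)
  also have "\<dots> = 6 * int (Suc n) + 3 * int (Suc n) * (int (Suc n) - 1) * u
      + (int n * (int n - 1) * (int n - 2) + 3 * int n * (int n - 1)) * u\<^sup>2
      + u ^ 3 * (int n * (int n - 1) * (int n - 2)) + 6 * u ^ 3 * (k + u * k)"
    unfolding k by (simp add: algebra_simps power2_eq_square power3_eq_cube)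
  also have "int n * (int n - 1) * (int n - 2) + 3 * int n * (int n - 1)
      = int (Suc n) * (int (Suc n) - 1) * (int (Suc n) - 2)" by (simp add: algebra_simps)
  also have "u ^ 3 * (int n * (int n - 1) * (int n - 2)) = 6 * u ^ 3 * l" unfolding l by simp
  finally have "6 * gsum (1 + u) (Suc n) = 6 * int (Suc n) + 3 * int (Suc n) * (int (Suc n) - 1) * u
      + int (Suc n) * (int (Suc n) - 1) * (int (Suc n) - 2) * u\<^sup>2 + 6 * u ^ 3 * (l + (k + u * k))"
    by (simp only: distrib_left add.assoc)
  then show ?case by blast
qed simp

text \<open>The exponent belonging to i = 1. The terms of order 0 and 1 in \<open>x - 1\<close>
  cancel, and the remaining cofactor begins with 3 + (x - 1), which alone decides the
  valuation.\<close>

lemma mac_exp_expand: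
  assumes "x > 0"
  shows "\<exists>k. 6 * mac_exp x (nat x)
     = x * (x - 1)\<^sup>2 * (3 + (x - 1) + 3 * (x - 1)\<^sup>2 - (x - 1) ^ 3 + 6 * (x - 1) * k)"
proof -
  define u where "u = x - 1"
  have x: "x = 1 + u" and n: "int (nat x) = 1 + u" using assms by (auto simp: u_def)
  obtain k where k: "6 * gsum (1 + u) (nat x) = 6 * (1 + u) + 3 * (1 + u) * u * u + (1 + u) * u * (u - 1) * u\<^sup>2 + 6 * u ^ 3 * k"
    using gsum_expand[of u "nat x"] unfolding n by (auto simp: algebra_simps)
  obtain l where l: "(1 + u) * u * (u - 1) = 6 * l"
    using six_dvd_falling[of "nat x"] unfolding n by (auto simp: algebra_simps)
  have pw: "x ^ nat x = 1 + u * gsum (1 + u) (nat x)" using gsum_eq[of x "nat x"] by (simp add: x)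
  have "6 * mac_exp x (nat x) = x * (6 + u * (6 * gsum (1 + u) (nat x)) - 6 * gsum (1 + u) (nat x))"
    unfolding mac_exp_def pw n by (simp add: x algebra_simps)
  also have "\<dots> = x * u\<^sup>2 * (3 + u + 3 * u\<^sup>2 - u ^ 3 + 6 * u * (u * k - k) + u * ((1 + u) * u * (u - 1)))"
    unfolding k by (simp add: algebra_simps power2_eq_square power3_eq_cube)
  also have "\<dots> = x * u\<^sup>2 * (3 + u + 3 * u\<^sup>2 - u ^ 3 + 6 * u * (u * k - k + l))"
    unfolding l by (simp add: algebra_simps)
  finally show ?thesis unfolding u_def by blast
qed

text \<open>For p > 3 the cofactor in \<open>mac_exp_expand\<close> is 3 modulo p, a unit. For p = 3
  write x - 1 = 3w: the cofactor is 3 times a number congruent to 1 + w modulo 3, and 3 divides 1 +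
  w exactly when x is 7 modulo 9.\<close>

lemma mac_exp_valuation:
  fixes p :: nat and x :: int
  assumes p: "Factorial_Ring.prime p" "p > 3 \<or> p = 3 \<and> \<not> [x = 7] (mod 9)"
    and m: "m > 0" and x: "x - 1 = int p ^ m * u" "\<not> int p dvd u" "x > 0"
  obtains y where "mac_exp x (nat x) = int p ^ (2 * m) * y" "\<not> int p dvd y"
proof -
  have pi: "Factorial_Ring.prime (int p)" using p by simp
  obtain k where k: "6 * mac_exp x (nat x)
     = x * (x - 1)\<^sup>2 * (3 + (x - 1) + 3 * (x - 1)\<^sup>2 - (x - 1) ^ 3 + 6 * (x - 1) * k)"
    using mac_exp_expand[OF x(3)] by blast
  define w where "w = int p ^ (m - 1) * u"
  have w: "x - 1 = int p * w" using x(1) m by (cases m) (auto simp: w_def)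
  have nx: "\<not> int p dvd x"
  proof
    assume "int p dvd x"
    then have "int p dvd x - (x - 1)" using w by (metis dvd_diff dvd_triv_left)
    then show False using pi by (simp add: not_prime_unit)
  qed
  have sq: "(x - 1)\<^sup>2 = int p ^ (2 * m) * u\<^sup>2"
    by (simp add: x(1) power_mult_distrib power_mult[symmetric] mult.commute)
  obtain d z where d: "\<not> int p dvd d" and z: "\<not> int p dvd z"
    and eq: "d * mac_exp x (nat x) = x * (x - 1)\<^sup>2 * z"
  proof (cases "p = 3")
    case True
    define z where "z = 1 + w + 9 * w\<^sup>2 - 9 * w ^ 3 + 6 * w * k"
    have "3 * (2 * mac_exp x (nat x)) = 3 * (x * (x - 1)\<^sup>2 * z)"
      using k unfolding w z_def by (simp add: True algebra_simps power2_eq_square power3_eq_cube)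
    then have 1: "2 * mac_exp x (nat x) = x * (x - 1)\<^sup>2 * z" by simp
    have "\<not> int p dvd z"
    proof
      assume "int p dvd z"
      then have "3 dvd 1 + w + 3 * (3 * w\<^sup>2 - 3 * w ^ 3 + 2 * w * k)" by (simp add: True z_def algebra_simps)
      then have "3 dvd 1 + w" by (metis dvd_add_left_iff dvd_triv_left)
      then have "[x = 7] (mod 9)"
      proof -
        obtain t where "1 + w = 3 * t" using \<open>3 dvd 1 + w\<close> by blast
        then have "x - 7 = 9 * (t - 1)" using w True by simp
        then show ?thesis unfolding cong_iff_dvd_diff by (metis dvd_triv_left)
      qed
      then show False using p True by simp
    qed
    with that[of 2 z] 1 True show ?thesis by simp
  next
    case False
    then have p5: "p > 3" using p by auto
    define z where "z = 3 + int p * (w + 3 * (int p * w\<^sup>2) - (int p)\<^sup>2 * w ^ 3 + 6 * w * k)"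
    have 1: "6 * mac_exp x (nat x) = x * (x - 1)\<^sup>2 * z"
      unfolding k unfolding w z_def by (simp add: algebra_simps power2_eq_square power3_eq_cube)
    have n3: "\<not> int p dvd 3" using p5 by (auto dest: zdvd_imp_le)
    have "\<not> int p dvd 2" using p5 by (auto dest: zdvd_imp_le)
    then have "\<not> int p dvd 2 * 3" using n3 pi prime_dvd_mult_iff by blast
    moreover have "\<not> int p dvd z" unfolding z_def using n3 by (metis dvd_add_left_iff dvd_triv_left)
    ultimately show ?thesis using that[of 6 z] 1 by simp
  qed
  have "int p ^ (2 * m) dvd d * mac_exp x (nat x)" unfolding eq sq by simp
  moreover have "coprime (int p ^ (2 * m)) d" using d pi by (simp add: prime_imp_coprime)
  ultimately obtain y where y: "mac_exp x (nat x) = int p ^ (2 * m) * y"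
    by (meson coprime_dvd_mult_right_iff dvdE)
  have "int p ^ (2 * m) * (d * y) = int p ^ (2 * m) * (x * u\<^sup>2 * z)" using eq unfolding y sq by (simp add: mult_ac)
  then have "d * y = x * u\<^sup>2 * z" using pi by simp
  moreover have "\<not> int p dvd x * u\<^sup>2 * z"
    using nx x(2) z pi by (simp add: prime_dvd_mult_iff prime_dvd_power_iff)
  ultimately have "\<not> int p dvd y" by (metis dvd_mult)
  with y that show ?thesis by blast
qed

text \<open>A factor y prime to p is invertible modulo the period \<open>p ^ s\<close> and can be
  removed from an exponent.\<close>

lemma (in group) prime_power_part:
  assumes x: "x \<in> carrier G" "x [^] (int p ^ s) = \<one>" and p: "Factorial_Ring.prime p" "\<not> int p dvd y"
  obtains l where "x [^] (int p ^ v) = (x [^] (int p ^ v * y)) [^] (l::int)"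
proof -
  have "coprime y (int p ^ s)" using p by (metis coprime_commute coprime_power_right_iff prime_imp_coprime prime_nat_int_transfer)
  then obtain l where "[y * l = 1] (mod int p ^ s)" using cong_solve_coprime_int by blast
  then obtain z where z: "y * l = 1 + int p ^ s * z" by (metis cong_iff_lin cong_sym_eq)
  have "x [^] (int p ^ s * (int p ^ v * z)) = \<one>" using x by (simp flip: int_pow_pow)
  then have "x [^] (int p ^ v * (y * l)) = x [^] (int p ^ v)"
    unfolding z using x(1) by (simp add: int_pow_mult distrib_left mult_ac)
  then show ?thesis using that[of l] x by (simp add: int_pow_pow mult.assoc)
qed

lemma (in group) prime_power_part_commute:
  assumes x: "x \<in> carrier G" "x [^] (int p ^ s) = \<one>" and p: "Factorial_Ring.prime p" "\<not> int p dvd y"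
    and z: "z \<in> carrier G" "x [^] (int p ^ v * y) \<otimes> z = z \<otimes> x [^] (int p ^ v * y)"
  shows "x [^] (int p ^ v) \<otimes> z = z \<otimes> x [^] (int p ^ v)"
proof -
  obtain l where l: "x [^] (int p ^ v) = (x [^] (int p ^ v * y)) [^] (l::int)"
    using prime_power_part[OF x p] .
  show ?thesis unfolding l by (rule int_pow_commute) (use x z in auto)
qed

lemma (in group) prime_power_part_one:
  assumes x: "x \<in> carrier G" "x [^] (int p ^ s) = \<one>" and p: "Factorial_Ring.prime p" "\<not> int p dvd y"
    and "x [^] (int p ^ v * y) = \<one>"
  shows "x [^] (int p ^ v) = \<one>"
  using prime_power_part[OF x p, of v] assms(5) by (metis int_pow_one)

lemma (in group) int_pow_one_mult:
  assumes "x \<in> carrier G" "x [^] (d::int) = \<one>" "d dvd k"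
  shows "x [^] k = \<one>"
  using assms by (auto simp: int_pow_pow[symmetric])

lemma (in group) int_pow_eq_mod:
  assumes "x \<in> carrier G" "x [^] (d::int) = \<one>" "d dvd k - l"
  shows "x [^] k = x [^] l"
  using int_pow_one_mult[OF assms] assms(1) by (metis int_pow_cong int_pow_eq_id)

section \<open>p-adic bounds for the orders\<close>

text \<open>The exponent s in \<open>tors\<close> is an arbitrary initial bound, sharpened below to
  3m. Positivity allows the key relations with i = 1, that is M = \<alpha> and N = \<beta>.\<close>

locale macdonald_p = macdonald +
  fixes p m s :: nat and u v :: int
  assumes p: "Factorial_Ring.prime p" and odd_p: "odd p" and m: "m > 0"
    and pos: "\<alpha> > 0" "\<beta> > 0"
    and u: "\<alpha> - 1 = int p ^ m * u" "\<not> int p dvd u"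
    and v: "\<beta> - 1 = int p ^ m * v" "\<not> int p dvd v"
    and diff: "int p ^ (2 * m) dvd \<alpha> - \<beta>"
    and small: "p > 3 \<or> p = 3 \<and> \<not> [\<alpha> = 7] (mod 9) \<and> \<not> [\<beta> = 7] (mod 9)"
    and tors: "a [^] (int p ^ s) = \<one>" "b [^] (int p ^ s) = \<one>"
begin

lemma swap_p: "macdonald_p G b a (inv c) \<beta> \<alpha> p m s v u"
proof -
  interpret s: macdonald G b a "inv c" \<beta> \<alpha> by (rule swap)
  show ?thesis
    by unfold_locales (use p odd_p m pos u v diff small tors in \<open>auto simp: dvd_diff_commute\<close>)
qed

lemma prime_int: "Factorial_Ring.prime (int p)" using p by simp

lemma mac_exp_\<alpha>:
  obtains y where "mac_exp \<alpha> (nat \<alpha>) = int p ^ (2 * m) * y" "\<not> int p dvd y"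
  using mac_exp_valuation[OF p _ m u pos(1)] small by blast

lemma \<alpha>_dvd: "int p ^ m dvd \<alpha> - 1" using u by simp

lemma \<beta>_coprime: "coprime \<beta> (int p ^ k)"
proof -
  have "int p dvd \<beta> - 1" using v m by (simp add: dvd_power)
  from coprime_of_dvd_diff_one[OF this] show ?thesis by (simp add: coprime_commute)
qed

text \<open>The exponent in \<open>a_pow_central\<close> for i = 1 has valuation exactly m + 2m, and
  its unit part can be removed.\<close>

lemma a_q3_central: "a [^] (int p ^ (3 * m)) \<otimes> b = b \<otimes> a [^] (int p ^ (3 * m))"
proof -
  obtain y where y: "mac_exp \<alpha> (nat \<alpha>) = int p ^ (2 * m) * y" "\<not> int p dvd y" using mac_exp_\<alpha> .
  have eq: "(\<alpha> - 1) * mac_exp \<alpha> (nat \<alpha>) = int p ^ (3 * m) * (u * y)"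
    unfolding u y by (simp add: algebra_simps flip: power_add)
  have "\<not> int p dvd u * y" using u y prime_int by (simp add: prime_dvd_mult_iff)
  then show ?thesis
    using a_pow_central[of "nat \<alpha>" 1 "nat \<beta>" "int p ^ s"] pos tors \<beta>_coprime unfolding eq
    by (intro prime_power_part_commute[OF a_closed tors(1) p]) auto
qed

lemma a_q4: "a [^] (int p ^ (4 * m)) = \<one>"
proof -
  have "int p ^ (3 * m) * (\<alpha> - 1) = int p ^ (4 * m) * u"
    unfolding u by (simp add: algebra_simps flip: power_add)
  then show ?thesis
    using commute_a_pow_kill[OF a_q3_central] u(2) by (metis prime_power_part_one[OF a_closed tors(1) p])
qed

text \<open>Conjugating \<open>a ^ (p ^ e)\<close> by b produces the factor
  \<open>c ^ (p ^ e)\<close> and changes the exponent of a only by a multiple of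
  \<open>p ^ (e + m)\<close>. If b does not move this power of a, the factor of c must be
  trivial.\<close>

lemma c_pow_one:
  assumes "a [^] (int p ^ e) \<otimes> b = b \<otimes> a [^] (int p ^ e)" "a [^] (int p ^ (e + m)) = \<one>"
  shows "c [^] (p ^ e) = \<one>"
proof -
  have "b \<otimes> (c [^] (p ^ e) \<otimes> a [^] (\<alpha> * gsum \<alpha> (p ^ e))) = b \<otimes> a [^] (int p ^ e)"
    using a_pow_b[of "p ^ e"] assms(1) by (simp del: of_nat_power add: of_nat_power[symmetric])
  then have "c [^] (p ^ e) \<otimes> a [^] (\<alpha> * gsum \<alpha> (p ^ e)) = a [^] (int p ^ e)" by simp
  moreover have "a [^] (\<alpha> * gsum \<alpha> (p ^ e)) = a [^] (int p ^ e)"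
    by (rule int_pow_eq_mod[OF a_closed assms(2)]) (rule gsum_prime_power_cong[OF odd_p m \<alpha>_dvd])
  ultimately show ?thesis by simp
qed

lemma c_q3: "c [^] (p ^ (3 * m)) = \<one>"
  by (rule c_pow_one[OF a_q3_central]) (use a_q4 in \<open>simp add: algebra_simps\<close>)

text \<open>The key relation for i = 1, solved for the power of b. The exponents 1 + \<alpha> and 1
  + \<beta> of c nearly cancel: what remains is \<alpha> - \<beta>, divisible by
  \<open>p ^ (2 * m)\<close>. The number x is an inverse of the power of \<alpha> picked up when a
  passes c.\<close>

lemma b_pow_eq:
  obtains r x where "b [^] mac_exp \<beta> (nat \<beta>) = c [^] (r::nat) \<otimes> a [^] (- (mac_exp \<alpha> (nat \<alpha>) * x))"
    "p ^ (2 * m) dvd r" "int p ^ (4 * m) dvd x * \<alpha> ^ (1 + nat \<beta>) - 1"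
proof -
  define Y W where "Y = mac_exp \<alpha> (nat \<alpha>)" and "W = mac_exp \<beta> (nat \<beta>)"
  define n where "n = 1 + nat \<beta>"
  \<comment> \<open>A natural representative of \<alpha> - \<beta> modulo q^3, a period of c by
    \<open>c_q3\<close>.\<close>
  define r where "r = nat ((\<alpha> - \<beta>) mod int p ^ (3 * m))"
  have p0: "int p > 0" using p prime_gt_0_nat by simp
  then have r: "int r = (\<alpha> - \<beta>) mod int p ^ (3 * m)" by (simp add: r_def)
  have R: "b [^] W \<otimes> c [^] n = c [^] (1 + nat \<alpha>) \<otimes> a [^] (- Y)"
    using key_relation[of "nat \<alpha>" 1 "nat \<beta>"] pos by (simp add: Y_def W_def n_def)
  have "c [^] int (1 + nat \<alpha>) = c [^] int (r + n)"
  proof (rule int_pow_eq_mod[OF c_closed])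
    show "c [^] (int p ^ (3 * m)) = \<one>" using c_q3 by (metis int_pow_int of_nat_power)
    have "int (1 + nat \<alpha>) - int (r + n) = (\<alpha> - \<beta>) - (\<alpha> - \<beta>) mod int p ^ (3 * m)"
      using pos r by (simp add: n_def)
    then show "int p ^ (3 * m) dvd int (1 + nat \<alpha>) - int (r + n)" by (simp add: dvd_minus_mod)
  qed
  then have c1: "c [^] (1 + nat \<alpha>) = c [^] r \<otimes> c [^] n"
    by (simp only: int_pow_int nat_pow_mult[OF c_closed])
  have "coprime (\<alpha> ^ n) (int p ^ (4 * m))"
    using macdonald_p.\<beta>_coprime[OF swap_p] by simp
  then obtain x where "[\<alpha> ^ n * x = 1] (mod int p ^ (4 * m))" using cong_solve_coprime_int by blast
  then have x: "int p ^ (4 * m) dvd x * \<alpha> ^ n - 1" by (simp add: cong_iff_dvd_diff mult.commute)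
  have "a [^] (- (Y * x)) \<otimes> c [^] n = c [^] n \<otimes> a [^] (- (Y * x) * \<alpha> ^ n)" by (rule a_c)
  also have "a [^] (- (Y * x) * \<alpha> ^ n) = a [^] (- Y)"
  proof (rule int_pow_eq_mod[OF a_closed a_q4])
    have "- (Y * x) * \<alpha> ^ n - - Y = - Y * (x * \<alpha> ^ n - 1)" by (simp add: algebra_simps)
    then show "int p ^ (4 * m) dvd - (Y * x) * \<alpha> ^ n - - Y" using x by simp
  qed
  finally have "b [^] W \<otimes> c [^] n = c [^] r \<otimes> a [^] (- (Y * x)) \<otimes> c [^] n"
    using R unfolding c1 by (simp add: m_assoc)
  then have 1: "b [^] W = c [^] r \<otimes> a [^] (- (Y * x))" by simp
  have "int p ^ (2 * m) dvd int r"
    unfolding r by (rule dvd_mod) (use diff in \<open>auto intro: le_imp_power_dvd\<close>)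
  then have "p ^ (2 * m) dvd r" by (metis of_nat_dvd_iff of_nat_power)
  with 1 x that show ?thesis by (simp add: Y_def W_def n_def)
qed

text \<open>The q-th power of \<open>b_pow_eq\<close> is free of c and relates powers of a and b
  alone. Inserted into \<open>key_relation_conj\<close>, it leaves a power of a whose exponent is
  \<open>p ^ (3 * m) * y * E\<close> up to units and multiples of q^4. Here E is u + v modulo p,
  hence 2u, and p is odd, so E is a unit.\<close>

lemma a_q3: "a [^] (int p ^ (3 * m)) = \<one>"
proof -
  define Y W where "Y = mac_exp \<alpha> (nat \<alpha>)" and "W = mac_exp \<beta> (nat \<beta>)"
  obtain r x where rx: "b [^] W = c [^] (r::nat) \<otimes> a [^] (- (Y * x))"
    "p ^ (2 * m) dvd r" "int p ^ (4 * m) dvd x * \<alpha> ^ (1 + nat \<beta>) - 1"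
    using b_pow_eq unfolding Y_def W_def .
  obtain y where y: "Y = int p ^ (2 * m) * y" "\<not> int p dvd y" unfolding Y_def using mac_exp_\<alpha> .
  define f where "f = Y * x"
  \<comment> \<open>Commutation is needed to take the q-th power factor by factor: f carries
    \<open>p ^ (2 * m)\<close> and \<open>\<alpha> ^ r - 1\<close> carries
    \<open>p ^ (3 * m)\<close>, together more than the period \<open>p ^ (4 * m)\<close> of
    a.\<close>
  have "a [^] (- f) \<otimes> c [^] r = c [^] r \<otimes> a [^] (- f * \<alpha> ^ r)" by (rule a_c)
  also have "a [^] (- f * \<alpha> ^ r) = a [^] (- f)"
  proof (rule int_pow_eq_mod[OF a_closed a_q4])
    have "int p ^ (2 * m + m) dvd \<alpha> ^ r - 1"
      by (rule power_prime_power_cong[OF odd_p m \<alpha>_dvd rx(2)])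
    then have "int p ^ (2 * m) * int p ^ (2 * m + m) dvd Y * (\<alpha> ^ r - 1)"
      unfolding y by (intro mult_dvd_mono) auto
    moreover have "int p ^ (4 * m) dvd int p ^ (2 * m) * int p ^ (2 * m + m)"
      unfolding power_add[symmetric] by (rule le_imp_power_dvd) simp
    ultimately have "int p ^ (4 * m) dvd - x * (Y * (\<alpha> ^ r - 1))" by (meson dvd_mult dvd_trans)
    moreover have "- f * \<alpha> ^ r - - f = - x * (Y * (\<alpha> ^ r - 1))" by (simp add: f_def algebra_simps)
    ultimately show "int p ^ (4 * m) dvd - f * \<alpha> ^ r - - f" by simp
  qed
  finally have com: "c [^] r \<otimes> a [^] (- f) = a [^] (- f) \<otimes> c [^] r" by simp
  have "(b [^] W) [^] (int p ^ m) = (c [^] r) [^] (int p ^ m) \<otimes> (a [^] (- f)) [^] (int p ^ m)"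
    unfolding rx(1) f_def[symmetric] using com by (intro int_pow_mult_distrib) auto
  moreover have "(c [^] r) [^] (int p ^ m) = \<one>"
  proof -
    have "p ^ (3 * m) dvd r * p ^ m" using mult_dvd_mono[OF rx(2), of "p ^ m" "p ^ m"] by (simp flip: power_add)
    then obtain z where z: "r * p ^ m = p ^ (3 * m) * z" ..
    have "(c [^] r) [^] (int p ^ m) = c [^] (r * p ^ m)"
      by (metis c_closed int_pow_int nat_pow_pow of_nat_power)
    then show ?thesis unfolding z using c_q3 by (simp flip: nat_pow_pow)
  qed
  ultimately have bq: "b [^] (W * int p ^ m) = a [^] (- f * int p ^ m)" by (simp add: int_pow_pow)
  define L where "L = 1 + nat \<alpha>"
  have "b [^] (\<alpha> * (\<beta> - 1) * W) = (b [^] (W * int p ^ m)) [^] (v * \<alpha>)"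
    unfolding v by (simp add: int_pow_pow mult_ac)
  also have "\<dots> = a [^] (- (f * \<alpha> * (\<beta> - 1)))" unfolding bq v by (simp add: int_pow_pow mult_ac)
  finally have "a [^] (- (f * \<alpha> * (\<beta> - 1))) \<otimes> c [^] L = c [^] L \<otimes> a [^] ((\<alpha> - 1) * Y)"
    using key_relation_conj[of "nat \<alpha>" 1 "nat \<beta>"] pos by (simp add: Y_def W_def L_def)
  then have "c [^] L \<otimes> a [^] (- (f * \<alpha> * (\<beta> - 1)) * \<alpha> ^ L) = c [^] L \<otimes> a [^] ((\<alpha> - 1) * Y)"
    by (simp only: a_c)
  then have "a [^] ((\<alpha> - 1) * Y) = a [^] (- (f * \<alpha> * (\<beta> - 1)) * \<alpha> ^ L)" by simp
  from pow_eq_one_of_pow_eq[OF a_closed this]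
  have E0: "a [^] ((\<alpha> - 1) * Y + f * \<alpha> * (\<beta> - 1) * \<alpha> ^ L) = \<one>" by simp
  define n where "n = 1 + nat \<beta>"
  define E where "E = u * \<alpha> ^ n + \<alpha> ^ (1 + L) * v"
  \<comment> \<open>Multiplying by \<open>\<alpha> ^ n\<close> cancels the inverse x hidden in
    f.\<close>
  have "int p ^ (4 * m) dvd ((\<alpha> - 1) * Y + f * \<alpha> * (\<beta> - 1) * \<alpha> ^ L) * \<alpha> ^ n - int p ^ (3 * m) * (y * E)"
  proof -
    have "((\<alpha> - 1) * Y + f * \<alpha> * (\<beta> - 1) * \<alpha> ^ L) * \<alpha> ^ n - int p ^ (3 * m) * (y * E)
       = (x * \<alpha> ^ n - 1) * (Y * (\<alpha> ^ (1 + L) * (\<beta> - 1)))"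
    proof -
      have "int p ^ (3 * m) * (y * E) = Y * ((\<alpha> - 1) * \<alpha> ^ n + \<alpha> ^ (1 + L) * (\<beta> - 1))"
      proof -
        have "int p ^ (3 * m) = int p ^ (2 * m) * int p ^ m" by (simp flip: power_add)
        then show ?thesis unfolding y u v E_def by (simp add: algebra_simps)
      qed
      then show ?thesis unfolding f_def by (simp add: algebra_simps)
    qed
    then show ?thesis using rx(3) by (simp add: n_def)
  qed
  moreover have "a [^] (((\<alpha> - 1) * Y + f * \<alpha> * (\<beta> - 1) * \<alpha> ^ L) * \<alpha> ^ n) = \<one>"
    using E0 by (simp flip: int_pow_pow)
  ultimately have E1: "a [^] (int p ^ (3 * m) * (y * E)) = \<one>"
    using int_pow_eq_mod[OF a_closed a_q4] by metis
  have "\<not> int p dvd E"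
  proof
    assume dvd: "int p dvd E"
    have pa: "int p dvd \<alpha> - 1" using u m by (simp add: dvd_power)
    have 1: "int p dvd \<alpha> ^ k - 1" for k by (rule dvd_power_minus_one[OF pa])
    have "int p dvd u - v"
    proof -
      have "int p ^ m * (u - v) = \<alpha> - \<beta>" using u v by (simp add: algebra_simps)
      then have "int p ^ m * int p ^ m dvd int p ^ m * (u - v)" using diff by (simp flip: power_add mult_2)
      then have "int p ^ m dvd u - v" using prime_int by simp
      then show ?thesis using m by (meson dvd_power dvd_trans)
    qed
    moreover have "2 * u = E - u * (\<alpha> ^ n - 1) - v * (\<alpha> ^ (1 + L) - 1) + (u - v)"
      by (simp add: E_def algebra_simps)
    ultimately have "int p dvd 2 * u" using dvd 1 by (metis dvd_add dvd_diff dvd_mult)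
    then have "int p dvd 2" using u prime_int prime_dvd_mult_iff by blast
    then show False using odd_p p
      by (metis int_dvd_int_iff of_nat_numeral primes_dvd_imp_eq two_is_prime_nat even_numeral)
  qed
  then have "\<not> int p dvd y * E" using y prime_int by (simp add: prime_dvd_mult_iff)
  then show ?thesis using E1 by (intro prime_power_part_one[OF a_closed tors(1) p]) auto
qed

lemma a_c_pow_commute:
  assumes "p ^ (2 * m) dvd r"
  shows "a \<otimes> c [^] r = c [^] r \<otimes> a"
proof -
  have "a [^] (1 * \<alpha> ^ r) = a [^] (1::int)"
    using power_prime_power_cong[OF odd_p m \<alpha>_dvd assms]
    by (intro int_pow_eq_mod[OF a_closed a_q3]) (simp add: algebra_simps)
  then show ?thesis using a_c[of 1 r] by simp
qed

text \<open>With a^(q^3) = 1 the factor \<open>c ^ r\<close> in \<open>b_pow_eq\<close> commutes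
  with a, so the power of b, of valuation 2m, commutes with a as well.\<close>

lemma b_q2_central: "b [^] (int p ^ (2 * m)) \<otimes> a = a \<otimes> b [^] (int p ^ (2 * m))"
proof -
  obtain y where y: "mac_exp \<beta> (nat \<beta>) = int p ^ (2 * m) * y" "\<not> int p dvd y"
    using macdonald_p.mac_exp_\<alpha>[OF swap_p] .
  obtain r x where rx: "b [^] mac_exp \<beta> (nat \<beta>) = c [^] (r::nat) \<otimes> a [^] (- (mac_exp \<alpha> (nat \<alpha>) * x))"
    "p ^ (2 * m) dvd r" using b_pow_eq .
  have "b [^] mac_exp \<beta> (nat \<beta>) \<otimes> a = a \<otimes> b [^] mac_exp \<beta> (nat \<beta>)"
  proof -
    let ?g = "- (mac_exp \<alpha> (nat \<alpha>) * x)"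
    have "a \<otimes> b [^] mac_exp \<beta> (nat \<beta>) = (a \<otimes> c [^] r) \<otimes> a [^] ?g"
      unfolding rx(1) by (simp only: m_assoc a_closed c_closed int_pow_closed nat_pow_closed)
    also have "\<dots> = c [^] r \<otimes> (a [^] ?g \<otimes> a)"
      unfolding a_c_pow_commute[OF rx(2)] using int_pow_commute[of a a ?g] by (simp add: m_assoc)
    finally show ?thesis unfolding rx(1) by (simp add: m_assoc)
  qed
  then show ?thesis
    using y by (intro prime_power_part_commute[OF b_closed tors(2) p]) auto
qed

lemma a_q2_central: "a [^] (int p ^ (2 * m)) \<otimes> b = b \<otimes> a [^] (int p ^ (2 * m))"
  using macdonald_p.b_q2_central[OF swap_p] .

lemma b_q3: "b [^] (int p ^ (3 * m)) = \<one>"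
  using macdonald_p.a_q3[OF swap_p] .

lemma c_q2: "c [^] (p ^ (2 * m)) = \<one>"
  by (rule c_pow_one[OF a_q2_central]) (use a_q3 in \<open>simp add: algebra_simps\<close>)

text \<open>Once c^(q^2) = 1, the factor \<open>c ^ r\<close> in \<open>b_pow_eq\<close> disappears.
  Because of this b contributes a factor q^2 and not q^3 to the group order.\<close>

lemma b_q2_eq:
  obtains k where "b [^] (int p ^ (2 * m)) = a [^] (int p ^ (2 * m) * k)"
proof -
  obtain y where y: "mac_exp \<beta> (nat \<beta>) = int p ^ (2 * m) * y" "\<not> int p dvd y"
    using macdonald_p.mac_exp_\<alpha>[OF swap_p] .
  obtain z where z: "mac_exp \<alpha> (nat \<alpha>) = int p ^ (2 * m) * z" using mac_exp_\<alpha> .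
  obtain r x where rx: "b [^] mac_exp \<beta> (nat \<beta>) = c [^] (r::nat) \<otimes> a [^] (- (mac_exp \<alpha> (nat \<alpha>) * x))"
    "p ^ (2 * m) dvd r" using b_pow_eq .
  have "c [^] r = \<one>" using rx(2) c_q2 by (auto simp flip: nat_pow_pow)
  then have 1: "b [^] (int p ^ (2 * m) * y) = a [^] (int p ^ (2 * m) * (- z * x))"
    using rx(1) unfolding y z by (simp add: mult_ac)
  obtain l where "b [^] (int p ^ (2 * m)) = (b [^] (int p ^ (2 * m) * y)) [^] (l::int)"
    using prime_power_part[OF b_closed tors(2) p y(2)] .
  then have "b [^] (int p ^ (2 * m)) = a [^] (int p ^ (2 * m) * (- z * x * l))"
    unfolding 1 by (simp add: int_pow_pow mult_ac)
  then show ?thesis by (rule that)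
qed

end

section \<open>Counting the elements\<close>

text \<open>The cosets b^j H with j below the least positive j0 for which b^j0 lies in H are
  disjoint and exhaust the product set, which need not be a subgroup. Divisibility of w by j0,
  stronger than j0 <= w, is what later controls the p-part of the group order.\<close>

lemma (in group) card_powers_mult:
  assumes H: "subgroup H G" "finite H" and b: "b \<in> carrier G" and w: "b [^] (w::nat) \<in> H" "w > 0"
  obtains j0 where "j0 > 0" "j0 dvd w" "b [^] j0 \<in> H"
    "card {b [^] (j::int) \<otimes> h | j h. h \<in> H} = j0 * card H"
    "finite {b [^] (j::int) \<otimes> h | j h. h \<in> H}"
proof -
  interpret H: subgroup H G by (rule H)
  define j0 where "j0 = (LEAST j. j > 0 \<and> b [^] (j::nat) \<in> H)"
  have j0: "j0 > 0 \<and> b [^] j0 \<in> H" unfolding j0_def by (rule LeastI[of _ w]) (use w in simp)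
  have min: "\<not> (k > 0 \<and> b [^] k \<in> H)" if "k < j0" for k
    using not_less_Least[of k] that unfolding j0_def by blast
  have j0_pow: "b [^] (int j0 * k) \<in> H" for k
    using subgroup_int_pow_closed[OF H(1), of "b [^] j0" k] j0 b by (simp add: int_pow_pow flip: int_pow_int)
  have small: "k = 0" if "b [^] int k \<in> H" "k < j0" for k
    using min[OF that(2)] that(1) by (auto simp: int_pow_int)
  have dvd: "int j0 dvd k" if "b [^] k \<in> H" for k
  proof -
    have "b [^] (k mod int j0) = inv (b [^] (int j0 * (k div int j0))) \<otimes> b [^] k"
      using b by (simp flip: int_pow_mult int_pow_neg add: minus_mult_div_eq_mod[symmetric])
    then have "b [^] (k mod int j0) \<in> H" using j0_pow that by auto
    then have "b [^] int (nat (k mod int j0)) \<in> H" using j0 by simp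
    then have "nat (k mod int j0) = 0" by (rule small) (use j0 in \<open>simp add: nat_less_iff\<close>)
    then have "k mod int j0 = 0" using j0 by (simp add: nat_eq_iff)
    then show ?thesis by auto
  qed
  define f where "f = (\<lambda>(j::nat, h). b [^] j \<otimes> h)"
  have img: "{b [^] (j::int) \<otimes> h | j h. h \<in> H} = f ` ({..<j0} \<times> H)"
  proof (intro equalityI subsetI)
    fix x assume "x \<in> {b [^] (j::int) \<otimes> h | j h. h \<in> H}"
    then obtain j h where x: "x = b [^] (j::int) \<otimes> h" and h: "h \<in> H" by blast
    have "j = int (nat (j mod int j0)) + int j0 * (j div int j0)" using j0 by simp
    then have "b [^] j = b [^] nat (j mod int j0) \<otimes> b [^] (int j0 * (j div int j0))"
      using b by (metis int_pow_int int_pow_mult)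
    then have "x = f (nat (j mod int j0), b [^] (int j0 * (j div int j0)) \<otimes> h)"
      using x h b by (simp add: f_def m_assoc)
    moreover have "b [^] (int j0 * (j div int j0)) \<otimes> h \<in> H" using j0_pow h by simp
    moreover have "nat (j mod int j0) < j0" using j0 by (simp add: nat_less_iff)
    ultimately show "x \<in> f ` ({..<j0} \<times> H)" by blast
  next
    fix x assume "x \<in> f ` ({..<j0} \<times> H)"
    then obtain j h where "x = b [^] int j \<otimes> h" "h \<in> H" by (auto simp: f_def int_pow_int)
    then show "x \<in> {b [^] (j::int) \<otimes> h | j h. h \<in> H}" by blast
  qed
  have inj: "inj_on f ({..<j0} \<times> H)"
  proof (rule inj_onI, clarsimp simp: f_def)
    fix i j x y assume ij: "i < j0" "j < j0" and xy: "x \<in> H" "y \<in> H" and eq: "b [^] i \<otimes> x = b [^] j \<otimes> y"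
    have "b [^] (int i - int j) = inv (b [^] j) \<otimes> (b [^] i \<otimes> x) \<otimes> inv x"
    proof -
      have "b [^] (int i - int j) = b [^] (- int j) \<otimes> b [^] int i" using b by (simp flip: int_pow_mult)
      then show ?thesis using b xy by (simp add: m_assoc int_pow_neg int_pow_int)
    qed
    also have "\<dots> = y \<otimes> inv x" unfolding eq using b xy by (simp add: m_assoc)
    finally have "b [^] (int i - int j) \<in> H" using xy by simp
    from dvd[OF this] have "i = j" using ij
      by (metis dvd_imp_mod_0 mod_eq_dvd_iff mod_pos_pos_trivial of_nat_0_le_iff of_nat_eq_iff of_nat_less_iff)
    then show "i = j \<and> x = y" using eq b xy by simp
  qed
  show ?thesis
  proof (rule that[of j0])
    show "j0 dvd w" using dvd[of "int w"] w by (simp add: int_pow_int)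
    show "card {b [^] (j::int) \<otimes> h | j h. h \<in> H} = j0 * card H"
      unfolding img card_image[OF inj] by (simp add: card_cartesian_product)
    show "finite {b [^] (j::int) \<otimes> h | j h. h \<in> H}" unfolding img using H by simp
  qed (use j0 in auto)
qed

text \<open>Generators of finite order have positive powers as inverses, so closure under right
  multiplication by the generators suffices.\<close>

lemma (in group) generate_subset_right_closed:
  assumes S: "S \<subseteq> carrier G" "\<And>s. s \<in> S \<Longrightarrow> ord s > 0"
    and T: "T \<subseteq> carrier G" "\<one> \<in> T" "\<And>t s. t \<in> T \<Longrightarrow> s \<in> S \<Longrightarrow> t \<otimes> s \<in> T"
  shows "generate G S \<subseteq> T"
proof -
  have pow: "t \<otimes> s [^] (n::nat) \<in> T" if "t \<in> T" "s \<in> S" for t s n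
  proof (induction n)
    case (Suc n)
    from T(3)[OF this that(2)] show ?case using that S(1) T(1) by (simp add: m_assoc subset_iff)
  qed (use that S T in auto)
  have "t \<otimes> x \<in> T" if "x \<in> generate G S" "t \<in> T" for x t
    using that
  proof (induction arbitrary: t rule: generate.induct)
    case (inv s)
    have s: "s \<in> carrier G" using inv S by auto
    have "s [^] (ord s - 1) \<otimes> s = \<one>"
      using S(2)[OF inv(1)] s by (metis Suc_diff_1 nat_pow_Suc pow_ord_eq_1)
    then have "inv s = s [^] (ord s - 1)" using s by (simp add: inv_equality)
    then show ?case using pow[OF inv(2,1)] by simp
  next
    case (eng x y)
    then have "x \<in> carrier G" "y \<in> carrier G" "t \<in> carrier G" using S(1) T(1) generate_in_carrier by blast+
    then have "t \<otimes> (x \<otimes> y) = t \<otimes> x \<otimes> y" by (simp add: m_assoc)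
    then show ?case using eng by simp
  qed (use T in auto)
  from this[OF _ T(2)] show ?thesis using generate_in_carrier[OF S(1)] by fastforce
qed

context macdonald
begin

lemma generate_ac_eq:
  assumes "ord a > 0" "ord c > 0"
  shows "generate G {a, c} = {c [^] (k::int) \<otimes> h | k h. h \<in> generate G {a}}" (is "_ = ?T")
proof (intro equalityI)
  let ?S = "generate G {a, c}"
  have sub: "subgroup ?S G" by (rule generate_is_subgroup) simp
  show "?T \<subseteq> ?S"
  proof clarify
    fix k h assume h: "h \<in> generate G {a}"
    have "h \<in> ?S" using h mono_generate[of "{a}" "{a, c}"] by auto
    moreover have "c [^] (k::int) \<in> ?S"
      by (rule subgroup_int_pow_closed[OF sub]) (auto intro: generate.incl)
    ultimately show "c [^] k \<otimes> h \<in> ?S" using sub by (simp add: subgroup.m_closed)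
  qed
  show "?S \<subseteq> ?T"
  proof (rule generate_subset_right_closed)
    show "?T \<subseteq> carrier G" using generate_in_carrier[of "{a}"] by auto
    have "\<one> = c [^] (0::int) \<otimes> \<one>" by simp
    then show "\<one> \<in> ?T" by (blast intro: generate.one)
    fix t s assume t: "t \<in> ?T" and s: "s \<in> {a, c}"
    obtain k h where t': "t = c [^] (k::int) \<otimes> h" and h: "h \<in> generate G {a}" using t by blast
    obtain i where i: "h = a [^] (i::int)" using h by (auto simp: generate_pow)
    show "t \<otimes> s \<in> ?T"
    proof (cases "s = a")
      case True
      have "t \<otimes> s = c [^] k \<otimes> a [^] (i + 1)" using t' i True by (simp add: m_assoc int_pow_mult)
      then show ?thesis by (auto simp: generate_pow)
    next
      case False
      then have "t \<otimes> s = c [^] k \<otimes> (a [^] i \<otimes> c [^] (1::nat))" using t' i s by (simp add: m_assoc)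
      also have "\<dots> = c [^] (k + 1) \<otimes> a [^] (i * \<alpha>)"
        unfolding a_c by (simp add: m_assoc int_pow_mult)
      finally show ?thesis by (auto simp: generate_pow)
    qed
  qed (use assms in auto)
qed

lemma c_in_generate: "c \<in> generate G {a, b}"
proof -
  have "c = inv a \<otimes> (inv b \<otimes> (a \<otimes> b))" unfolding ab by simp
  moreover have "subgroup (generate G {a, b}) G" by (rule generate_is_subgroup) simp
  ultimately show ?thesis
    by (metis generate.incl insertCI subgroup.m_closed subgroup.m_inv_closed)
qed

lemma generate_ab_eq:
  assumes "ord a > 0" "ord b > 0" "ord c > 0"
  shows "generate G {a, b} = {b [^] (j::int) \<otimes> h | j h. h \<in> generate G {a, c}}" (is "_ = ?T")
proof (intro equalityI)
  let ?S = "generate G {a, b}"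
  have sub: "subgroup ?S G" by (rule generate_is_subgroup) simp
  have acS: "generate G {a, c} \<subseteq> ?S"
    by (rule generate_subgroup_incl[OF _ sub]) (use c_in_generate in \<open>auto intro: generate.incl\<close>)
  show "?T \<subseteq> ?S"
  proof clarify
    fix k h assume h: "h \<in> generate G {a, c}"
    have "b [^] (k::int) \<in> ?S"
      by (rule subgroup_int_pow_closed[OF sub]) (auto intro: generate.incl)
    then show "b [^] k \<otimes> h \<in> ?S" using sub h acS by (auto simp: subgroup.m_closed)
  qed
  have subac: "subgroup (generate G {a, c}) G" by (rule generate_is_subgroup) simp
  have acs: "a \<in> generate G {a, c}" "c \<in> generate G {a, c}" by (auto intro: generate.incl)
  show "?S \<subseteq> ?T"
  proof (rule generate_subset_right_closed)
    show "?T \<subseteq> carrier G" using generate_in_carrier[of "{a, c}"] by auto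
    have "\<one> = b [^] (0::int) \<otimes> \<one>" by simp
    then show "\<one> \<in> ?T" by (blast intro: generate.one)
    fix t s assume t: "t \<in> ?T" and s: "s \<in> {a, b}"
    obtain j h where t': "t = b [^] (j::int) \<otimes> h" and h: "h \<in> generate G {a, c}" using t by blast
    have hc: "h \<in> carrier G" using h generate_in_carrier[of "{a, c}"] by auto
    show "t \<otimes> s \<in> ?T"
    proof (cases "s = a")
      case True
      have "t \<otimes> s = b [^] j \<otimes> (h \<otimes> a)" using t' True hc by (simp add: m_assoc)
      then show ?thesis using subgroup.m_closed[OF subac h acs(1)] by blast
    next
      case False
      obtain k i where ki: "h = c [^] (k::int) \<otimes> a [^] (i::int)"
        using h unfolding generate_ac_eq[OF assms(1,3)] by (auto simp: generate_pow)
      \<comment> \<open>The commutation rules \<open>b_c\<close> and \<open>a_pow_b\<close> are for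
        natural exponents of c and a, hence the reduction modulo their orders.\<close>
      define k' i' where "k' = nat (k mod int (ord c))" and "i' = nat (i mod int (ord a))"
      have "c [^] k = c [^] int k'" by (rule int_pow_cong) (use assms in \<open>simp_all add: k'_def dvd_minus_mod\<close>)
      moreover have "a [^] i = a [^] int i'" by (rule int_pow_cong) (use assms in \<open>simp_all add: i'_def dvd_minus_mod\<close>)
      ultimately have "t \<otimes> s = b [^] j \<otimes> (c [^] k' \<otimes> (a [^] int i' \<otimes> b))"
        using False s t' ki by (simp add: m_assoc int_pow_int)
      also have "\<dots> = b [^] j \<otimes> (c [^] k' \<otimes> b [^] (1::int)) \<otimes> (c [^] i' \<otimes> a [^] (\<alpha> * gsum \<alpha> i'))"
        unfolding a_pow_b by (simp add: m_assoc)
      also have "\<dots> = b [^] (j + \<beta> ^ k') \<otimes> (c [^] k' \<otimes> (c [^] i' \<otimes> a [^] (\<alpha> * gsum \<alpha> i')))"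
        unfolding b_c by (simp add: m_assoc int_pow_mult)
      also have "c [^] k' \<otimes> (c [^] i' \<otimes> a [^] (\<alpha> * gsum \<alpha> i')) \<in> generate G {a, c}"
        using subgroup_int_pow_closed[OF subac acs(1)] subgroup_int_pow_closed[OF subac acs(2)]
        by (metis int_pow_int subac subgroup.m_closed)
      then have "b [^] (j + \<beta> ^ k') \<otimes> (c [^] k' \<otimes> (c [^] i' \<otimes> a [^] (\<alpha> * gsum \<alpha> i'))) \<in> ?T" by blast
      finally show ?thesis .
    qed
  qed (use assms in auto)
qed

text \<open>Count <a>, then <c><a>, then <b><c><a>. For c the trivial relation with exponent
  \<open>ord c\<close> is used; for b the exponent w is left open, because a power of b below its
  order may already lie in <a>.\<close>

lemma card_generate_dvd:
  assumes "ord a > 0" "ord b > 0" "ord c > 0" and w: "b [^] (w::nat) \<in> generate G {a}" "w > 0"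
  shows "finite (generate G {a, b})" "card (generate G {a, b}) dvd ord a * ord c * w"
proof -
  have suba: "subgroup (generate G {a}) G" by (rule generate_is_subgroup) simp
  have carda: "card (generate G {a}) = ord a" by (simp add: generate_pow_card)
  then have fina: "finite (generate G {a})" using assms(1) by (simp add: card_ge_0_finite)
  have "c [^] ord c \<in> generate G {a}" by (simp add: generate.one)
  then obtain k0 where k0: "k0 dvd ord c" "card (generate G {a, c}) = k0 * ord a" "finite (generate G {a, c})"
    unfolding generate_ac_eq[OF assms(1,3)] carda[symmetric]
    by (rule card_powers_mult[OF suba fina c_closed _ assms(3)])
  have subac: "subgroup (generate G {a, c}) G" by (rule generate_is_subgroup) simp
  have "b [^] w \<in> generate G {a, c}" using w(1) mono_generate[of "{a}" "{a, c}"] by auto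
  then obtain j0 where j0: "j0 dvd w" "card (generate G {a, b}) = j0 * card (generate G {a, c})"
    "finite (generate G {a, b})"
    unfolding generate_ab_eq[OF assms(1-3)]
    by (rule card_powers_mult[OF subac k0(3) b_closed _ w(2)])
  show "finite (generate G {a, b})" by (rule j0)
  show "card (generate G {a, b}) dvd ord a * ord c * w"
    unfolding j0 k0 using j0(1) k0(1) by (metis mult.commute mult.assoc mult_dvd_mono dvd_refl)
qed

end

section \<open>Nilpotency class\<close>

context group
begin

lemma comm_mem_iff:
  assumes N: "N \<lhd> G" and "x \<in> carrier G" "y \<in> carrier G"
  shows "inv x \<otimes> inv y \<otimes> x \<otimes> y \<in> N \<longleftrightarrow> N #> (x \<otimes> y) = N #> (y \<otimes> x)"
proof -
  interpret N: normal N G by (rule N)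
  have "N #> (x \<otimes> y) = N #> (y \<otimes> x) \<longleftrightarrow> x \<otimes> y \<otimes> inv (y \<otimes> x) \<in> N"
  proof
    assume "N #> (x \<otimes> y) = N #> (y \<otimes> x)"
    then have "x \<otimes> y \<in> N #> (y \<otimes> x)"
      using rcos_self[OF _ N.subgroup_axioms] assms by (metis m_closed)
    then obtain n where n: "n \<in> N" "x \<otimes> y = n \<otimes> (y \<otimes> x)" by (auto simp: r_coset_def)
    then have "x \<otimes> y \<otimes> inv (y \<otimes> x) = n" using assms N.mem_carrier[OF n(1)] unfolding n(2) by (simp add: m_assoc inv_mult_group)
    then show "x \<otimes> y \<otimes> inv (y \<otimes> x) \<in> N" using n by simp
  next
    assume n: "x \<otimes> y \<otimes> inv (y \<otimes> x) \<in> N"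
    have "x \<otimes> y = (x \<otimes> y \<otimes> inv (y \<otimes> x)) \<otimes> (y \<otimes> x)" using assms by (simp add: m_assoc inv_mult_group)
    then have "N #> (x \<otimes> y) = (N #> (x \<otimes> y \<otimes> inv (y \<otimes> x))) #> (y \<otimes> x)"
      using assms N.subset by (metis coset_mult_assoc inv_closed m_closed)
    then show "N #> (x \<otimes> y) = N #> (y \<otimes> x)"
      using coset_join2[OF _ N.subgroup_axioms n] n by simp
  qed
  also have "\<dots> \<longleftrightarrow> inv x \<otimes> inv y \<otimes> x \<otimes> y \<in> N"
  proof -
    have *: "x \<otimes> y \<otimes> inv (y \<otimes> x) = (y \<otimes> x) \<otimes> (inv x \<otimes> inv y \<otimes> x \<otimes> y) \<otimes> inv (y \<otimes> x)"
      "inv x \<otimes> inv y \<otimes> x \<otimes> y = inv (y \<otimes> x) \<otimes> (x \<otimes> y \<otimes> inv (y \<otimes> x)) \<otimes> (y \<otimes> x)"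
      using assms by (simp_all add: m_assoc inv_mult_group)
    then show ?thesis using N.inv_op_closed1 N.inv_op_closed2 assms by (metis m_closed)
  qed
  finally show ?thesis by simp
qed

end

text \<open>The upper central series. Each of its steps can be tested on the two generators
  (\<open>ucs_SucI\<close>), which makes it the convenient side for bounding the class from
  above.\<close>

fun ucs :: "('a, 'b) monoid_scheme \<Rightarrow> nat \<Rightarrow> 'a set" where
  "ucs G 0 = {\<one>\<^bsub>G\<^esub>}"
| "ucs G (Suc n) = {x \<in> carrier G. \<forall>y\<in>carrier G.
     inv\<^bsub>G\<^esub> x \<otimes>\<^bsub>G\<^esub> inv\<^bsub>G\<^esub> y \<otimes>\<^bsub>G\<^esub> x \<otimes>\<^bsub>G\<^esub> y \<in> ucs G n}"

context group_hom
begin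

lemma hom_centralizer_subgroup:
  assumes x: "x \<in> carrier G"
  shows "subgroup {y \<in> carrier G. h (x \<otimes> y) = h (y \<otimes> x)} G" (is "subgroup ?C G")
proof (rule G.subgroupI)
  show "?C \<noteq> {}" using x by (auto intro!: exI[of _ \<one>])
  fix y assume "y \<in> ?C"
  then have y: "y \<in> carrier G" "h x \<otimes>\<^bsub>H\<^esub> h y = h y \<otimes>\<^bsub>H\<^esub> h x" using x by auto
  have "inv\<^bsub>H\<^esub> h y \<otimes>\<^bsub>H\<^esub> h x = h x \<otimes>\<^bsub>H\<^esub> inv\<^bsub>H\<^esub> h y"
    using H.conj_swap_iff[of "h x" "h y" "h x"] x y by simp
  then show "inv y \<in> ?C" using x y by simp
  fix z assume "z \<in> ?C"
  then have z: "z \<in> carrier G" "h x \<otimes>\<^bsub>H\<^esub> h z = h z \<otimes>\<^bsub>H\<^esub> h x" using x by auto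
  have "h x \<otimes>\<^bsub>H\<^esub> (h y \<otimes>\<^bsub>H\<^esub> h z) = (h y \<otimes>\<^bsub>H\<^esub> h z) \<otimes>\<^bsub>H\<^esub> h x"
  proof -
    have "h x \<otimes>\<^bsub>H\<^esub> (h y \<otimes>\<^bsub>H\<^esub> h z) = h y \<otimes>\<^bsub>H\<^esub> (h x \<otimes>\<^bsub>H\<^esub> h z)"
      using x y z(1) by (simp flip: H.m_assoc)
    also have "\<dots> = (h y \<otimes>\<^bsub>H\<^esub> h z) \<otimes>\<^bsub>H\<^esub> h x" using x y z by (simp add: H.m_assoc)
    finally show ?thesis .
  qed
  then show "y \<otimes> z \<in> ?C" using x y z by simp
qed auto

lemma hom_center_normal:
  "{x \<in> carrier G. \<forall>y\<in>carrier G. h (x \<otimes> y) = h (y \<otimes> x)} \<lhd> G" (is "?Z \<lhd> G")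
proof (rule G.normal_invI)
  have "?Z = (\<Inter>y\<in>carrier G. {x \<in> carrier G. h (y \<otimes> x) = h (x \<otimes> y)})" by force
  moreover have "subgroup (\<Inter>y\<in>carrier G. {x \<in> carrier G. h (y \<otimes> x) = h (x \<otimes> y)}) G"
    by (rule G.subgroups_Inter) (use hom_centralizer_subgroup in auto)
  ultimately show "subgroup ?Z G" by simp
  fix g x assume g: "g \<in> carrier G" and xZ: "x \<in> ?Z"
  then have x: "x \<in> carrier G" by simp
  from g xZ have "h g \<otimes>\<^bsub>H\<^esub> h x = h x \<otimes>\<^bsub>H\<^esub> h g" by auto
  then have "h (g \<otimes> x \<otimes> inv g) = h x" using g x by (simp add: H.m_assoc)
  then show "g \<otimes> x \<otimes> inv g \<in> ?Z" using g x xZ by simp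
qed

end

context group
begin

lemma central_mod_normal:
  assumes N: "N \<lhd> G"
  shows "{x \<in> carrier G. \<forall>y\<in>carrier G. inv x \<otimes> inv y \<otimes> x \<otimes> y \<in> N} \<lhd> G"
proof -
  interpret N: normal N G by (rule N)
  interpret Q: group "G Mod N" by (rule N.factorgroup_is_group)
  interpret h: group_hom G "G Mod N" "\<lambda>x. N #> x"
    by unfold_locales (rule N.r_coset_hom_Mod)
  have "{x \<in> carrier G. \<forall>y\<in>carrier G. inv x \<otimes> inv y \<otimes> x \<otimes> y \<in> N}
      = {x \<in> carrier G. \<forall>y\<in>carrier G. N #> (x \<otimes> y) = N #> (y \<otimes> x)}"
    using comm_mem_iff[OF N] by blast
  then show ?thesis using h.hom_center_normal by simp
qed

lemma ucs_normal: "ucs G n \<lhd> G"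
  by (induction n) (simp_all add: one_is_normal central_mod_normal del: One_nat_def)

lemma ucs_subgroup: "subgroup (ucs G n) G"
  using ucs_normal normal_imp_subgroup by blast

text \<open>The elements commuting with x modulo the n-th term form a subgroup, so it is enough that
  they include a and b.\<close>

lemma ucs_SucI:
  assumes gen: "carrier G = generate G {a, b}" and ab: "a \<in> carrier G" "b \<in> carrier G" and x: "x \<in> carrier G"
    and xa: "ucs G n #> (x \<otimes> a) = ucs G n #> (a \<otimes> x)"
    and xb: "ucs G n #> (x \<otimes> b) = ucs G n #> (b \<otimes> x)"
  shows "x \<in> ucs G (Suc n)"
proof -
  let ?N = "ucs G n"
  interpret N: normal ?N G by (rule ucs_normal)
  interpret Q: group "G Mod ?N" by (rule N.factorgroup_is_group)
  interpret h: group_hom G "G Mod ?N" "\<lambda>x. ?N #> x"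
    by unfold_locales (rule N.r_coset_hom_Mod)
  have "generate G {a, b} \<subseteq> {y \<in> carrier G. ?N #> (x \<otimes> y) = ?N #> (y \<otimes> x)}"
    by (rule generate_subgroup_incl[OF _ h.hom_centralizer_subgroup[OF x]]) (use ab xa xb in auto)
  then show ?thesis using comm_mem_iff[OF N.normal_axioms x] x gen by auto
qed

lemma ucs_mono: "ucs G n \<subseteq> ucs G (Suc n)"
proof
  interpret N: normal "ucs G n" G by (rule ucs_normal)
  fix x assume x: "x \<in> ucs G n"
  then have xc: "x \<in> carrier G" by (rule N.mem_carrier)
  have "inv x \<otimes> inv y \<otimes> x \<otimes> y \<in> ucs G n" if "y \<in> carrier G" for y
    using N.m_closed[OF N.m_inv_closed[OF x] N.inv_op_closed1[OF that x]] xc that by (simp add: m_assoc)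
  then show "x \<in> ucs G (Suc n)" using xc by simp
qed

lemma lcs_subset_ucs:
  assumes "lcs G 0 \<subseteq> ucs G c" "n \<le> c"
  shows "lcs G n \<subseteq> ucs G (c - n)"
  using assms(2)
proof (induction n)
  case (Suc n)
  then have IH: "lcs G n \<subseteq> ucs G (Suc (c - Suc n))" by (simp add: Suc_diff_Suc)
  show ?case unfolding lcs.simps
    by (rule generate_subgroup_incl[OF _ ucs_subgroup]) (use IH in auto)
qed (use assms in simp)

lemma coset_mult_right_absorb:
  assumes "N \<lhd> G" "x \<in> carrier G" "z \<in> N"
  shows "N #> (x \<otimes> z) = N #> x" "N #> (z \<otimes> x) = N #> x"
proof -
  interpret N: normal N G by (rule assms)
  have z: "z \<in> carrier G" using assms by auto
  have 1: "N #> (w \<otimes> x) = N #> x" if "w \<in> N" for w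
    using that coset_join2[OF _ N.subgroup_axioms that] assms(2) N.subset
    by (metis N.mem_carrier coset_mult_assoc)
  show "N #> (z \<otimes> x) = N #> x" by (rule 1[OF assms(3)])
  have "x \<otimes> z = (x \<otimes> z \<otimes> inv x) \<otimes> x" using assms(2) z by (simp add: m_assoc)
  then show "N #> (x \<otimes> z) = N #> x" using 1[OF N.inv_op_closed2[OF assms(2,3)]] by simp
qed

end

section \<open>The nilpotency class of the p-group\<close>

locale macdonald_p_gen = macdonald_p +
  assumes gen: "carrier G = generate G {a, b}"
begin

lemma swap_p_gen: "macdonald_p_gen G b a (inv c) \<beta> \<alpha> p m s v u"
  by (rule macdonald_p_gen.intro[OF swap_p]) (unfold_locales, use gen in \<open>simp add: insert_commute\<close>)

lemma ucs_absorb: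
  assumes "x \<in> carrier G" "z \<in> ucs G n"
  shows "ucs G n #> (x \<otimes> z) = ucs G n #> x" "ucs G n #> (z \<otimes> x) = ucs G n #> x"
  using coset_mult_right_absorb[OF ucs_normal assms] by auto

lemma ucs_pow: "x \<in> ucs G n \<Longrightarrow> x [^] (k::int) \<in> ucs G n"
  by (rule subgroup_int_pow_closed[OF ucs_subgroup])

lemma ucs_pow_dvd: "x \<in> carrier G \<Longrightarrow> x [^] (d::int) \<in> ucs G n \<Longrightarrow> d dvd k \<Longrightarrow> x [^] k \<in> ucs G n"
  using ucs_pow by (auto simp flip: int_pow_pow)

text \<open>The bottom of a ladder in which each rung rests on the lower ones: a^(q^2) and b^(q^2)
  lie in term 1, c^q in term 2, a^q and b^q in term 3, c in term 4, a and b in term 5.\<close>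

lemma a_q2_ucs: "a [^] (int p ^ (2 * m)) \<in> ucs G 1"
proof -
  have "a [^] (int p ^ (2 * m)) \<otimes> a = a \<otimes> a [^] (int p ^ (2 * m))" by (rule int_pow_commute) auto
  then show ?thesis using a_q2_central by (simp only: One_nat_def) (intro ucs_SucI[OF gen], auto)
qed

lemma b_q2_ucs: "b [^] (int p ^ (2 * m)) \<in> ucs G 1"
  using macdonald_p_gen.a_q2_ucs[OF swap_p_gen] .

lemma c_a_ucs:
  assumes "a [^] (\<alpha> ^ k - 1) \<in> ucs G n"
  shows "ucs G n #> (c [^] k \<otimes> a) = ucs G n #> (a \<otimes> c [^] k)"
proof -
  have "a \<otimes> c [^] k = c [^] k \<otimes> a [^] (1 + (\<alpha> ^ k - 1))" using a_c[of 1 k] by simp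
  also have "\<dots> = c [^] k \<otimes> a \<otimes> a [^] (\<alpha> ^ k - 1)" by (subst int_pow_mult) (simp_all add: m_assoc)
  finally show ?thesis using ucs_absorb(1)[OF _ assms] by simp
qed

lemma c_b_ucs:
  assumes "b [^] (\<beta> ^ k - 1) \<in> ucs G n"
  shows "ucs G n #> (c [^] k \<otimes> b) = ucs G n #> (b \<otimes> c [^] k)"
proof -
  have "c [^] k \<otimes> b = b [^] ((\<beta> ^ k - 1) + 1) \<otimes> c [^] k" using b_c[of k 1] by simp
  also have "\<dots> = b [^] (\<beta> ^ k - 1) \<otimes> (b \<otimes> c [^] k)" by (subst int_pow_mult) (simp_all add: m_assoc)
  finally show ?thesis using ucs_absorb(2)[OF _ assms] by simp
qed

lemma c_q_ucs: "c [^] (p ^ m) \<in> ucs G 2"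
proof -
  have "int p ^ (2 * m) dvd \<alpha> ^ (p ^ m) - 1"
    using power_prime_power_cong[OF odd_p m \<alpha>_dvd, of m "p ^ m"] by (simp add: mult_2)
  moreover have "int p ^ (2 * m) dvd \<beta> ^ (p ^ m) - 1"
    using power_prime_power_cong[OF odd_p m macdonald_p.\<alpha>_dvd[OF swap_p], of m "p ^ m"] by (simp add: mult_2)
  ultimately have "a [^] (\<alpha> ^ (p ^ m) - 1) \<in> ucs G 1" "b [^] (\<beta> ^ (p ^ m) - 1) \<in> ucs G 1"
    using ucs_pow_dvd a_q2_ucs b_q2_ucs by blast+
  then show ?thesis unfolding numeral_2_eq_2 One_nat_def[symmetric]
    by (intro ucs_SucI[OF gen] c_a_ucs c_b_ucs) auto
qed

lemma a_q_ucs: "a [^] (int p ^ m) \<in> ucs G 3"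
proof -
  have 1: "ucs G 1 \<subseteq> ucs G 2" using ucs_mono[of 1] by (simp add: numeral_2_eq_2)
  \<comment> \<open>The error made by conjugating a^q with b as if b changed only the power of c; it
    is a multiple of q^2 and hence already central.\<close>
  define k where "k = \<alpha> * gsum \<alpha> (p ^ m) - int p ^ m"
  have "int p ^ (2 * m) dvd k"
    using gsum_prime_power_cong[OF odd_p m \<alpha>_dvd, of m] by (simp add: mult_2 k_def)
  then have z: "a [^] k \<in> ucs G 2" using ucs_pow_dvd a_q2_ucs 1 by blast
  have "a [^] (int p ^ m) \<otimes> b = b \<otimes> (c [^] (p ^ m) \<otimes> a [^] (int p ^ m + k))"
    using a_pow_b[of "p ^ m"] by (simp add: k_def)
  also have "\<dots> = b \<otimes> (c [^] (p ^ m) \<otimes> a [^] (int p ^ m)) \<otimes> a [^] k"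
    by (subst int_pow_mult) (simp_all add: m_assoc)
  finally have "ucs G 2 #> (a [^] (int p ^ m) \<otimes> b) = ucs G 2 #> (b \<otimes> (c [^] (p ^ m) \<otimes> a [^] (int p ^ m)))"
    using ucs_absorb(1)[OF _ z] by simp
  also have "b \<otimes> (c [^] (p ^ m) \<otimes> a [^] (int p ^ m)) = (b \<otimes> c [^] (p ^ m) \<otimes> inv b) \<otimes> (b \<otimes> a [^] (int p ^ m))"
    by (simp add: m_assoc)
  also have "ucs G 2 #> \<dots> = ucs G 2 #> (b \<otimes> a [^] (int p ^ m))"
    by (rule ucs_absorb(2)) (use normal.inv_op_closed2[OF ucs_normal b_closed c_q_ucs] in auto)
  finally have "ucs G 2 #> (a [^] (int p ^ m) \<otimes> b) = ucs G 2 #> (b \<otimes> a [^] (int p ^ m))" .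
  moreover have "a [^] (int p ^ m) \<otimes> a = a \<otimes> a [^] (int p ^ m)" by (rule int_pow_commute) auto
  moreover have "(3::nat) = Suc 2" by simp
  ultimately show ?thesis by (metis ucs_SucI[OF gen] a_closed b_closed int_pow_closed)
qed

lemma b_q_ucs: "b [^] (int p ^ m) \<in> ucs G 3"
  using macdonald_p_gen.a_q_ucs[OF swap_p_gen] .

lemma c_ucs: "c \<in> ucs G 4"
proof -
  have "a [^] (\<alpha> ^ 1 - 1) \<in> ucs G 3" using ucs_pow_dvd[OF a_closed a_q_ucs] u by simp
  moreover have "b [^] (\<beta> ^ 1 - 1) \<in> ucs G 3" using ucs_pow_dvd[OF b_closed b_q_ucs] v by simp
  ultimately have "ucs G 3 #> (c [^] (1::nat) \<otimes> a) = ucs G 3 #> (a \<otimes> c [^] (1::nat))"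
    "ucs G 3 #> (c [^] (1::nat) \<otimes> b) = ucs G 3 #> (b \<otimes> c [^] (1::nat))"
    using c_a_ucs c_b_ucs by blast+
  moreover have "(4::nat) = Suc 3" by simp
  ultimately show ?thesis by (metis ucs_SucI[OF gen] a_closed b_closed c_closed nat_pow_eone)
qed

lemma lcs_5: "lcs G 5 = {\<one>}"
proof -
  have ab5: "ucs G 4 #> (a \<otimes> b) = ucs G 4 #> (b \<otimes> a)"
    unfolding ab using ucs_absorb(1)[OF _ c_ucs, of "b \<otimes> a"] by (simp add: m_assoc)
  have "(5::nat) = Suc 4" by simp
  then have "a \<in> ucs G 5" "b \<in> ucs G 5" using ab5
    by (metis ucs_SucI[OF gen] a_closed b_closed)+
  then have "carrier G \<subseteq> ucs G 5"
    unfolding gen by (intro generate_subgroup_incl[OF _ ucs_subgroup]) auto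
  then have "lcs G 5 \<subseteq> {\<one>}" using lcs_subset_ucs[of 5 5] by simp
  moreover have "\<one> \<in> lcs G 5" by (simp add: numeral_eq_Suc generate.one)
  ultimately show ?thesis by auto
qed

text \<open>An explicit commutator of weight 5 survives. With w = \<alpha> - 1: [c,a] = a^(-w),
  [a^w,b] = c^w a^k, and [c^w a^k,a] = a^(1-\<alpha>^w), whose exponent has valuation only
  2m.\<close>

lemma lcs_4:
  assumes "\<And>k::int. a [^] k = \<one> \<Longrightarrow> int p ^ (3 * m) dvd k"
  shows "lcs G 4 \<noteq> {\<one>}"
proof -
  have lcs_sub: "lcs G n \<subseteq> carrier G" for n
  proof (induction n)
    case (Suc n)
    then show ?case unfolding lcs.simps by (intro generate_incl) auto
  qed simp
  have mem: "inv x \<otimes> inv y \<otimes> x \<otimes> y \<in> lcs G (Suc n)" if "x \<in> lcs G n" "y \<in> carrier G" for x y n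
    unfolding lcs.simps by (rule generate.incl) (use that in blast)
  define w where "w = nat (\<alpha> - 1)"
  have w: "int w = \<alpha> - 1" using pos by (simp add: w_def)
  have "c \<in> lcs G 1"
  proof -
    have "inv a \<otimes> inv b \<otimes> a \<otimes> b = c" using ab by (simp add: m_assoc)
    then show ?thesis using mem[of a 0 b] by simp
  qed
  from mem[OF this a_closed] have "inv c \<otimes> inv a \<otimes> c \<otimes> a \<in> lcs G 2" by (simp add: numeral_2_eq_2)
  moreover have "inv c \<otimes> inv a \<otimes> c \<otimes> a = a [^] (- int w)"
  proof -
    have "a [^] (-1::int) \<otimes> c = c \<otimes> a [^] (-1 * \<alpha>)" using a_c[of "-1" 1] by simp
    then have "inv c \<otimes> inv a \<otimes> c = a [^] (-1 * \<alpha>)" by (simp add: int_pow_neg m_assoc)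
    then have "inv c \<otimes> inv a \<otimes> c \<otimes> a = a [^] (-1 * \<alpha> + 1)" by (simp only: int_pow_mult a_closed int_pow_1)
    then show ?thesis by (simp add: w)
  qed
  ultimately have "a [^] (- int w) \<in> lcs G 2" by simp
  moreover have "subgroup (lcs G 2) G"
    unfolding numeral_2_eq_2 lcs.simps(2)[of G "Suc 0"]
    by (rule generate_is_subgroup) (use lcs_sub[of "Suc 0"] in auto)
  ultimately have "a [^] int w \<in> lcs G 2"
    using subgroup_int_pow_closed[of "lcs G 2" "a [^] (- int w)" "-1"] by (simp add: int_pow_pow)
  from mem[OF this b_closed] have "inv (a [^] int w) \<otimes> inv b \<otimes> a [^] int w \<otimes> b \<in> lcs G 3"
    by (simp add: eval_nat_numeral)
  moreover define k where "k = \<alpha> * gsum \<alpha> w - int w * \<alpha> ^ w"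
  have "inv (a [^] int w) \<otimes> inv b \<otimes> a [^] int w \<otimes> b = c [^] w \<otimes> a [^] k"
  proof -
    have "inv (a [^] int w) \<otimes> inv b \<otimes> a [^] int w \<otimes> b = inv (a [^] int w) \<otimes> (inv b \<otimes> (a [^] int w \<otimes> b))"
      by (simp add: m_assoc)
    also have "\<dots> = (a [^] (- int w) \<otimes> c [^] w) \<otimes> a [^] (\<alpha> * gsum \<alpha> w)"
      unfolding a_pow_b by (simp add: m_assoc int_pow_neg)
    also have "\<dots> = c [^] w \<otimes> (a [^] (- int w * \<alpha> ^ w) \<otimes> a [^] (\<alpha> * gsum \<alpha> w))"
      unfolding a_c by (simp add: m_assoc)
    finally show ?thesis by (simp add: k_def algebra_simps flip: int_pow_mult)
  qed
  ultimately have "c [^] w \<otimes> a [^] k \<in> lcs G 3" by simp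
  from mem[OF this a_closed]
  have in4: "inv (c [^] w \<otimes> a [^] k) \<otimes> inv a \<otimes> (c [^] w \<otimes> a [^] k) \<otimes> a \<in> lcs G 4"
    by (simp add: eval_nat_numeral)
  have "inv (c [^] w \<otimes> a [^] k) \<otimes> inv a \<otimes> (c [^] w \<otimes> a [^] k) \<otimes> a = a [^] (1 - \<alpha> ^ w)"
  proof -
    have 1: "inv a \<otimes> c [^] w = c [^] w \<otimes> a [^] (- (\<alpha> ^ w))" using a_c[of "-1" w] by (simp add: int_pow_neg)
    have "inv (c [^] w \<otimes> a [^] k) \<otimes> inv a \<otimes> (c [^] w \<otimes> a [^] k) \<otimes> a
        = inv (a [^] k) \<otimes> inv (c [^] w) \<otimes> (inv a \<otimes> c [^] w) \<otimes> (a [^] k \<otimes> a)"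
      by (simp add: m_assoc inv_mult_group)
    also have "\<dots> = a [^] (- k) \<otimes> (a [^] (- (\<alpha> ^ w)) \<otimes> (a [^] k \<otimes> a [^] (1::int)))"
      unfolding 1 by (simp add: m_assoc int_pow_neg)
    also have "\<dots> = a [^] (- k + (- (\<alpha> ^ w) + (k + 1)))" by (simp only: int_pow_mult a_closed)
    finally show ?thesis by simp
  qed
  with in4 have in4: "a [^] (1 - \<alpha> ^ w) \<in> lcs G 4" by simp
  show ?thesis
  proof
    assume "lcs G 4 = {\<one>}"
    with in4 have "int p ^ (3 * m) dvd 1 - \<alpha> ^ w" using assms by simp
    then have "int p ^ (3 * m) dvd \<alpha> ^ w - 1" by (simp add: dvd_diff_commute)
    also have "\<alpha> ^ w - 1 = int p ^ m * (u * gsum \<alpha> w)" unfolding gsum_eq[symmetric] u by simp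
    also have "int p ^ (3 * m) = int p ^ m * int p ^ (2 * m)" by (simp flip: power_add)
    finally have "int p ^ (2 * m) dvd u * gsum \<alpha> w" using prime_int by simp
    moreover have "coprime (int p ^ (2 * m)) u" using u prime_int by (simp add: prime_imp_coprime)
    ultimately have 1: "int p ^ (2 * m) dvd gsum \<alpha> w" by (simp add: coprime_dvd_mult_right_iff)
    \<comment> \<open>Both \<alpha> - 1 and w carry q, so \<open>gsum \<alpha> w\<close> agrees with
      w modulo q^2; then q^2 would divide w = q u.\<close>
    have "2 * int p ^ m * int p ^ m dvd 2 * (gsum \<alpha> w - int w) - (\<alpha> - 1) * int w * (int w - 1)"
      by (rule gsum_cong_length2[OF \<alpha>_dvd])
    moreover have "int p ^ m * int p ^ m dvd (\<alpha> - 1) * int w * (int w - 1)"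
      unfolding w u by (rule dvd_mult2) (simp add: mult_ac mult_dvd_mono)
    ultimately have "int p ^ m * int p ^ m dvd 2 * (gsum \<alpha> w - int w)"
      by (metis dvd_of_dvd_diff dvd_mult_right mult.assoc)
    moreover have pp: "int p ^ (2 * m) = int p ^ m * int p ^ m" by (simp flip: power_add mult_2)
    ultimately have "int p ^ (2 * m) dvd 2 * (gsum \<alpha> w - int w)" by (simp only: pp)
    moreover have "coprime (int p ^ (2 * m)) 2" using odd_p by simp
    ultimately have "int p ^ (2 * m) dvd gsum \<alpha> w - int w" by (meson coprime_dvd_mult_right_iff)
    then have "int p ^ (2 * m) dvd int w" using dvd_diff[OF 1] by fastforce
    then have "int p ^ m * int p ^ m dvd int p ^ m * u" by (simp only: w u pp)
    then have "int p ^ m dvd u" using prime_int by simp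
    then show False using u(2) m by (meson dvd_power dvd_trans)
  qed
qed

lemma nil_class_5:
  assumes "\<And>k::int. a [^] k = \<one> \<Longrightarrow> int p ^ (3 * m) dvd k"
  shows "nil_class G = 5"
  unfolding nil_class_def
proof (rule Least_equality)
  show "lcs G 5 = {\<one>}" by (rule lcs_5)
  fix n assume n: "lcs G n = {\<one>}"
  have step: "lcs G (Suc k) = {\<one>}" if "lcs G k = {\<one>}" for k
  proof -
    have "inv x \<otimes> inv y \<otimes> x \<otimes> y \<in> {\<one>}" if "x \<in> lcs G k" "y \<in> carrier G" for x y
    proof -
      have "x = \<one>" using that(1) unfolding \<open>lcs G k = {\<one>}\<close> by simp
      then show ?thesis using that(2) by simp
    qed
    then have "{inv x \<otimes> inv y \<otimes> x \<otimes> y | x y. x \<in> lcs G k \<and> y \<in> carrier G} \<subseteq> {\<one>}" by blast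
    then have "generate G {inv x \<otimes> inv y \<otimes> x \<otimes> y | x y. x \<in> lcs G k \<and> y \<in> carrier G} \<subseteq> {\<one>}"
      by (rule generate_subgroup_incl) (rule triv_subgroup)
    then show ?thesis unfolding lcs.simps using generate.one by blast
  qed
  have "lcs G (n + k) = {\<one>}" for k
  proof (induction k)
    case 0
    show ?case using n by simp
  next
    case (Suc k)
    show ?case using step[OF Suc] by (simp only: add_Suc_right)
  qed
  then have "\<not> n \<le> 4" using lcs_4[OF assms] by (metis le_add_diff_inverse)
  then show "5 \<le> n" by simp
qed

end

section \<open>Congruences for the permutation model\<close>

text \<open>The binomial coefficients of i + 1 over 2 and, for \<open>tet\<close>, of i + 1 over 3,
  extended to all integers.\<close>

definition tri :: "int \<Rightarrow> int" where "tri i = i * (i + 1) div 2"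
definition tet :: "int \<Rightarrow> int" where "tet i = (i - 1) * i * (i + 1) div 6"

lemma tri: "2 * tri i = i * (i + 1)"
  unfolding tri_def by (rule dvd_mult_div_cancel) simp

lemma six_dvd_tet: "(6::int) dvd (i - 1) * i * (i + 1)"
proof -
  have "even ((i - 1) * i * (i + 1))" by simp
  moreover have "(3::int) dvd (i - 1) * i * (i + 1)"
  proof -
    consider "i mod 3 = 0" | "i mod 3 = 1" | "i mod 3 = 2" by linarith
    then show ?thesis
    proof cases
      case 1
      then have "3 dvd i" by presburger
      then show ?thesis by simp
    next
      case 2
      then have "3 dvd i - 1" by presburger
      then show ?thesis by simp
    next
      case 3
      then have "3 dvd i + 1" by presburger
      then show ?thesis by simp
    qed
  qed
  moreover have "coprime (2::int) 3" by simp
  ultimately have "2 * 3 dvd (i - 1) * i * (i + 1)" by (rule divides_mult)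
  then show ?thesis by simp
qed

lemma tet: "6 * tet i = (i - 1) * i * (i + 1)"
  unfolding tet_def by (rule dvd_mult_div_cancel[OF six_dvd_tet])

text \<open>The parameters encode \<alpha> = 1 + q r and \<beta> = \<alpha> + q^2 s; here q is any
  odd positive integer.\<close>

locale mac_model =
  fixes q r s :: int
  assumes q_pos: "q > 0" and q_odd: "odd q"
begin

text \<open>The exponents are \<open>1 + u\<close> and \<open>1 + v\<close>. Modulo the cube of \<open>q\<close>, \<open>i + g i\<close> is the sum of the powers of \<open>1 + u\<close>
  with exponents from \<open>1\<close> to \<open>i\<close>, and \<open>bb k\<close> is \<open>(1 + v) ^ k\<close>; as truncated binomial expansions both make
  sense for negative arguments.\<close>
definition u where "u = q * r"
definition v where "v = q * (r + q * s)"
definition g where "g i = u * tri i + u\<^sup>2 * tet i"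
definition bb where "bb k = 1 + k * v + v\<^sup>2 * tri (k - 1)"

text \<open>A modulus in which denominators 3 may be cleared: 12 x = 0 modulo it implies x = 0 modulo the cube of q.\<close>
definition Q where "Q = (if 3 dvd q then 3 * q ^ 3 else q ^ 3)"

lemma coprime_4: "coprime (q ^ n) 4"
proof -
  have "coprime (q ^ n) (2 * 2)" using q_odd by (simp only: coprime_mult_right_iff coprime_right_2_iff_odd even_power) simp
  then show ?thesis by simp
qed

lemma coprime_12: "\<not> 3 dvd q \<Longrightarrow> coprime (q ^ n) 12"
proof -
  assume "\<not> 3 dvd q"
  then have "coprime (q ^ n) 3" 
  proof -
    have "Factorial_Ring.prime (3::int)" by simp
    with \<open>\<not> 3 dvd q\<close> have "coprime 3 q" by (simp add: prime_imp_coprime)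
    then show ?thesis by (simp add: coprime_commute)
  qed
  then have "coprime (q ^ n) (4 * 3)" using coprime_4 by (simp only: coprime_mult_right_iff)
  then show ?thesis by simp
qed

text \<open>The error terms of the expansions below are collected as multiples of 3 q^3 and of q^4,
  and both kinds vanish modulo Q.\<close>

lemma Q_dvd3: "Q dvd 3 * q ^ 3 * x" by (simp add: Q_def)

lemma Q_dvd4: "Q dvd q ^ 4 * x"
proof (cases "3 dvd q")
  case True
  then have "3 * q ^ 3 dvd q * q ^ 3" by (rule mult_dvd_mono) simp
  then show ?thesis using True by (simp add: Q_def power_Suc[symmetric] eval_nat_numeral dvd_mult2)
qed (simp add: Q_def eval_nat_numeral)

lemma Q_cancel: "Q dvd 12 * x \<Longrightarrow> q ^ 3 dvd x"
proof (cases "3 dvd q")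
  case True
  assume "Q dvd 12 * x"
  then have "3 * q ^ 3 dvd 3 * (4 * x)" using True by (simp add: Q_def)
  then have "q ^ 3 dvd 4 * x" unfolding dvd_mult_cancel_left by simp
  then show ?thesis using coprime_4 by (meson coprime_dvd_mult_right_iff)
next
  case False
  assume "Q dvd 12 * x"
  then have "q ^ 3 dvd 12 * x" using False by (simp add: Q_def)
  then show ?thesis using coprime_12[OF False] by (meson coprime_dvd_mult_right_iff)
qed

text \<open>The subtracted shape is that of the discrepancy
  \<open>6 * u\<^sup>2 * i - u ^ 3 * i\<close> in \<open>i_final\<close>, which survives modulo Q
  but is harmless for a coordinate taken modulo q^2.\<close>

lemma Q_cancel2:
  assumes "Q dvd 12 * x - (3 * q\<^sup>2 * y + q ^ 3 * z)"
  shows "q\<^sup>2 dvd x"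
proof (cases "3 dvd q")
  case True
  then obtain t where t: "q = 3 * t" by blast
  have "3 * q\<^sup>2 dvd Q" using True by (simp add: Q_def power3_eq_cube power2_eq_square)
  then have "3 * q\<^sup>2 dvd 12 * x - (3 * q\<^sup>2 * y + q ^ 3 * z)" using assms dvd_trans by blast
  moreover have "3 * q\<^sup>2 * y + q ^ 3 * z = 3 * q\<^sup>2 * (y + t * z)"
    by (simp add: t power3_eq_cube power2_eq_square algebra_simps)
  ultimately have "3 * q\<^sup>2 dvd 12 * x" by (metis dvd_of_dvd_diff dvd_triv_left)
  then have "3 * q\<^sup>2 dvd 3 * (4 * x)" by simp
  then have "q\<^sup>2 dvd 4 * x" unfolding dvd_mult_cancel_left by simp
  then show ?thesis using coprime_4 by (meson coprime_dvd_mult_right_iff)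
next
  case False
  then have "q\<^sup>2 dvd Q" by (simp add: Q_def power3_eq_cube power2_eq_square)
  then have "q\<^sup>2 dvd 12 * x - (3 * q\<^sup>2 * y + q ^ 3 * z)" using assms dvd_trans by blast
  moreover have "3 * q\<^sup>2 * y + q ^ 3 * z = q\<^sup>2 * (3 * y + q * z)"
    by (simp add: power3_eq_cube power2_eq_square algebra_simps)
  ultimately have "q\<^sup>2 dvd 12 * x" by (metis dvd_of_dvd_diff dvd_triv_left)
  then show ?thesis using coprime_12[OF False] by (meson coprime_dvd_mult_right_iff)
qed

lemma odd_cancel: "q ^ n dvd 2 * x \<Longrightarrow> q ^ n dvd x"
proof -
  assume 1: "q ^ n dvd 2 * x"
  have "coprime (q ^ n) 2" using q_odd by simp
  then show ?thesis using 1 by (meson coprime_dvd_mult_right_iff)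
qed

lemma tri_cong: "q ^ n dvd x - y \<Longrightarrow> q ^ n dvd tri x - tri y"
proof (rule odd_cancel)
  assume "q ^ n dvd x - y"
  moreover have "2 * (tri x - tri y) = (x - y) * (x + y + 1)"
    unfolding right_diff_distrib tri by (simp add: algebra_simps)
  ultimately show "q ^ n dvd 2 * (tri x - tri y)" by simp
qed

text \<open>The denominator 6 may cost a factor 3, so a congruence modulo q^2 is weakened to one
  modulo q. In g this is compensated by the coefficient u^2.\<close>

lemma tet_cong: "q\<^sup>2 dvd x - y \<Longrightarrow> q dvd tet x - tet y"
proof -
  assume "q\<^sup>2 dvd x - y"
  moreover have "6 * (tet x - tet y) = (x - y) * (x * x + x * y + y * y - 1)"
    unfolding right_diff_distrib tet by (simp add: algebra_simps)
  ultimately have 6: "q\<^sup>2 dvd 6 * (tet x - tet y)" by simp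
  have "q dvd 2 * (tet x - tet y)"
  proof (cases "3 dvd q")
    case True
    then obtain t where t: "q = 3 * t" by blast
    have "3 * (3 * t\<^sup>2) dvd 3 * (2 * (tet x - tet y))" using 6 by (simp add: t power2_eq_square)
    then have "3 * t\<^sup>2 dvd 2 * (tet x - tet y)" unfolding dvd_mult_cancel_left by simp
    moreover have "q dvd 3 * t\<^sup>2" by (simp add: t power2_eq_square)
    ultimately show ?thesis by (rule dvd_trans[rotated])
  next
    case False
    have "q ^ 1 dvd 12 * (tet x - tet y)" 
    proof -
      have "q dvd 6 * (tet x - tet y)" using 6 by (simp only: power2_eq_square dvd_mult_left)
      then have "q dvd 2 * (6 * (tet x - tet y))" by (rule dvd_mult)
      then show ?thesis by simp
    qed
    then have "q ^ 1 dvd tet x - tet y" using coprime_12[OF False] by (meson coprime_dvd_mult_right_iff)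
    then show ?thesis by (simp only: power_one_right dvd_mult)
  qed
  then show ?thesis using odd_cancel[of 1 "tet x - tet y"] by simp
qed

lemma u_dvd: "q dvd u" and v_dvd: "q dvd v" by (simp_all add: u_def v_def)

lemma g_dvd: "q dvd g i" by (simp add: g_def u_def power2_eq_square)

text \<open>With \<open>g_cong2\<close> and \<open>bb_cong\<close> this makes right multiplication
  by B well defined and injective on triples of residues.\<close>

lemma g_cong1: "q dvd x - y \<Longrightarrow> q\<^sup>2 dvd g x - g y"
proof -
  assume "q dvd x - y"
  then have "q dvd tri x - tri y" using tri_cong[of 1 x y] by simp
  then obtain z where z: "tri x - tri y = q * z" by blast
  have "g x - g y = u * (tri x - tri y) + u\<^sup>2 * (tet x - tet y)" by (simp add: g_def algebra_simps)
  also have "\<dots> = q\<^sup>2 * (r * z + r\<^sup>2 * (tet x - tet y))"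
    unfolding z by (simp add: u_def power2_eq_square algebra_simps)
  finally show ?thesis by simp
qed

lemma g_cong2: "q\<^sup>2 dvd x - y \<Longrightarrow> q ^ 3 dvd g x - g y"
proof -
  assume a: "q\<^sup>2 dvd x - y"
  obtain z where z: "tri x - tri y = q\<^sup>2 * z" using tri_cong[OF a] by blast
  obtain w where w: "tet x - tet y = q * w" using tet_cong[OF a] by blast
  have "g x - g y = u * (tri x - tri y) + u\<^sup>2 * (tet x - tet y)" by (simp add: g_def algebra_simps)
  also have "\<dots> = q ^ 3 * (r * z + r\<^sup>2 * w)"
    unfolding z w by (simp add: u_def power2_eq_square power3_eq_cube algebra_simps)
  finally show ?thesis by simp
qed

lemma bb_cong: "q\<^sup>2 dvd x - y \<Longrightarrow> q ^ 3 dvd bb x - bb y"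
proof -
  assume a: "q\<^sup>2 dvd x - y"
  obtain z where z: "tri (x - 1) - tri (y - 1) = q\<^sup>2 * z" using tri_cong[of 2 "x - 1" "y - 1"] a by auto
  obtain w where w: "x - y = q\<^sup>2 * w" using a by blast
  have "bb x - bb y = v * (x - y) + v\<^sup>2 * (tri (x - 1) - tri (y - 1))" by (simp add: bb_def algebra_simps)
  also have "\<dots> = q ^ 3 * ((r + q * s) * w + q * (r + q * s)\<^sup>2 * z)"
    unfolding z w by (simp add: v_def power2_eq_square power3_eq_cube algebra_simps)
  finally show ?thesis by simp
qed

lemma g6: "6 * g i = 3 * u * i * (i + 1) + u\<^sup>2 * ((i - 1) * i * (i + 1))"
proof -
  have "6 * g i = 3 * u * (2 * tri i) + u\<^sup>2 * (6 * tet i)" by (simp add: g_def algebra_simps)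
  then show ?thesis unfolding tri tet by (simp add: algebra_simps)
qed

text \<open>The recursion s(i+1) = (1 + s(i)) \<alpha> for s(i) = \<alpha> + ... + \<alpha>^i; the
  truncation loses only u^3 times \<open>tet i\<close>.\<close>

lemma g_Suc: "q ^ 3 dvd (i + 1 + g (i + 1)) - (i + 1 + g i) * (1 + u)"
proof -
  have t1: "tri (i + 1) = tri i + (i + 1)" using tri[of i] tri[of "i + 1"] by (simp add: algebra_simps)
  have "6 * tet (i + 1) = 6 * tet i + 3 * (2 * tri i)" unfolding tri tet by (simp add: algebra_simps)
  then have t2: "tet (i + 1) = tet i + tri i" by simp
  have "(i + 1 + g (i + 1)) - (i + 1 + g i) * (1 + u) = q ^ 3 * (- (r ^ 3 * tet i))"
    unfolding g_def t1 t2 by (simp add: u_def algebra_simps power2_eq_square power3_eq_cube)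
  then show ?thesis by simp
qed

text \<open>The coordinates of the iterates of right multiplication by \<open>B\<close> (see \<open>fB_pow\<close> below).\<close>
primrec I :: "int \<Rightarrow> nat \<Rightarrow> int" where
  "I i 0 = i"
| "I i (Suc t) = I i t + g (I i t)"

primrec S :: "int \<Rightarrow> nat \<Rightarrow> int" where
  "S i 0 = 0"
| "S i (Suc t) = S i t + I i t"

primrec T :: "int \<Rightarrow> int \<Rightarrow> nat \<Rightarrow> int" where
  "T k i 0 = 0"
| "T k i (Suc t) = T k i t + bb (k + S i t)"

lemma I_cong: "q\<^sup>2 dvd I i t - (i + int t * g i)"
proof (induction t)
  case (Suc t)
  have "q dvd I i t - i"
  proof -
    have "q dvd I i t - (i + int t * g i)" using Suc by (simp add: power2_eq_square dvd_mult_left)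
    then have "q dvd (I i t - (i + int t * g i)) + int t * g i" using g_dvd by (intro dvd_add) auto
    then show ?thesis by simp
  qed
  then have "q\<^sup>2 dvd g (I i t) - g i" by (rule g_cong1)
  then have "q\<^sup>2 dvd (I i t - (i + int t * g i)) + (g (I i t) - g i)" using Suc by (rule dvd_add[rotated])
  then show ?case by (simp add: algebra_simps)
qed simp

section \<open>Second-order expansion of the iterates of B\<close>

text \<open>The derivative of 6 g.\<close>

definition L where "L i = 3 * u * (2 * i + 1) + u\<^sup>2 * (3 * i * i - 1)"

text \<open>Taylor expansion: after t steps the point has moved by about t g(i), which changes the
  next increment g by t g(i) g'(i). Summing over the steps gives t(t-1)/2, and 12 clears the
  denominators.\<close>

lemma I_sum: "Q dvd 12 * (I i t - (i + int t * g i)) - g i * L i * int t * (int t - 1)"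
proof (induction t)
  case (Suc t)
  obtain z where z: "I i t - (i + int t * g i) = q\<^sup>2 * z" using I_cong by blast
  obtain h where h: "g i = q * h" using g_dvd by blast
  define y where "y = int t * h + q * z"
  have x: "I i t = i + q * y" using z by (simp add: h y_def algebra_simps power2_eq_square)
  have "12 * (g (I i t) - g i) - 2 * g i * L i * int t
      = 2 * (6 * g (I i t)) - 2 * (6 * g i) - 2 * (q * h) * L i * int t" by (simp add: h)
  also have "\<dots> = 3 * q ^ 3 * (2 * z * r * (2 * i + 1) + 2 * r * y * y)
      + q ^ 4 * (2 * z * r\<^sup>2 * (3 * i * i - 1) + 2 * r\<^sup>2 * (3 * i * y * y + q * y ^ 3))"
  proof -
    have e1: "2 * (6 * g (I i t)) - 2 * (6 * g i)
       = 2 * (q * y * L i + 3 * u * (q * y)\<^sup>2 + u\<^sup>2 * (3 * i * (q * y)\<^sup>2 + (q * y) ^ 3))"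
      unfolding g6 x L_def by (simp add: algebra_simps power2_eq_square power3_eq_cube)
    have e2: "q * y * L i - q * h * L i * int t = q * q * z * L i" by (simp add: y_def algebra_simps)
    have "2 * (6 * g (I i t)) - 2 * (6 * g i) - 2 * (q * h) * L i * int t
       = 2 * (q * y * L i - q * h * L i * int t) + 2 * (3 * u * (q * y)\<^sup>2 + u\<^sup>2 * (3 * i * (q * y)\<^sup>2 + (q * y) ^ 3))"
      unfolding e1 by (simp add: algebra_simps)
    also have "\<dots> = 3 * q ^ 3 * (2 * z * r * (2 * i + 1) + 2 * r * y * y)
      + q ^ 4 * (2 * z * r\<^sup>2 * (3 * i * i - 1) + 2 * r\<^sup>2 * (3 * i * y * y + q * y ^ 3))"
      unfolding e2 unfolding L_def u_def by (simp add: algebra_simps eval_nat_numeral)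
    finally show ?thesis .
  qed
  finally have "Q dvd 12 * (g (I i t) - g i) - 2 * g i * L i * int t"
    using Q_dvd3 Q_dvd4 by simp
  then have "Q dvd (12 * (I i t - (i + int t * g i)) - g i * L i * int t * (int t - 1))
     + (12 * (g (I i t) - g i) - 2 * g i * L i * int t)" using Suc by (rule dvd_add[rotated])
  also have "(12 * (I i t - (i + int t * g i)) - g i * L i * int t * (int t - 1))
     + (12 * (g (I i t) - g i) - 2 * g i * L i * int t)
     = 12 * (I i (Suc t) - (i + int (Suc t) * g i)) - g i * L i * int (Suc t) * (int (Suc t) - 1)"
    by (simp add: algebra_simps)
  finally show ?case .
qed simp

lemma I_final:
  assumes "q dvd int n - 1"
  shows "Q dvd 12 * (I i n - (i + int n * g i))"
proof -
  obtain e where e: "int n - 1 = q * e" using assms by blast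
  obtain h where h: "g i = q * h" using g_dvd by blast
  have "g i * L i * int n * (int n - 1)
     = 3 * q ^ 3 * (h * r * (2 * i + 1) * int n * e) + q ^ 4 * (h * r\<^sup>2 * (3 * i * i - 1) * int n * e)"
    unfolding h e L_def u_def by (simp add: algebra_simps eval_nat_numeral)
  then have "Q dvd g i * L i * int n * (int n - 1)" using Q_dvd3 Q_dvd4 by simp
  then show ?thesis using I_sum dvd_of_dvd_diff by blast
qed

text \<open>The subtracted discrepancy does not vanish modulo Q. It reappears identically in
  \<open>T_final\<close>, and the relation needs modulo q^3 only the difference of the two.\<close>

lemma i_final:
  fixes i :: int
  assumes n: "q ^ 3 dvd int n - (1 + v)"
  defines "i' \<equiv> i * (1 + u)"
  shows "Q dvd 12 * (I i n * (1 + u) - (i' + g i')) - (6 * u\<^sup>2 * i - u ^ 3 * i)"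
proof -
  obtain w where "int n - (1 + v) = q ^ 3 * w" using n by blast
  then have n': "int n = 1 + u + q\<^sup>2 * (s + q * w)"
    by (simp add: u_def v_def algebra_simps power2_eq_square power3_eq_cube)
  obtain h where h: "g i = q * h" using g_dvd by blast
  have "q dvd int n - 1" unfolding n' by (simp add: u_def power2_eq_square)
  then have "Q dvd 12 * (I i n - (i + int n * g i)) * (1 + u)" using I_final by (meson dvd_mult2)
  moreover have "12 * (i + int n * g i) * (1 + u) - 12 * (i' + g i') - (6 * u\<^sup>2 * i - u ^ 3 * i)
     = 3 * q ^ 3 * (4 * (1 + u) * (s + q * w) * h + r ^ 3 * (i - 4 * tet i)) 
       + q ^ 4 * (- 2 * r ^ 4 * (2 * i ^ 3 + i + u * i ^ 3))"
  proof -
    have "12 * (i + int n * g i) * (1 + u) - 12 * (i' + g i')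
      = 12 * q\<^sup>2 * (s + q * w) * (1 + u) * g i + ((1 + u)\<^sup>2 * (2 * (6 * g i)) - 2 * (6 * g i'))"
      unfolding n' i'_def by (simp add: algebra_simps power2_eq_square)
    also have "(1 + u)\<^sup>2 * (2 * (6 * g i)) - 2 * (6 * g i')
      = 6 * u\<^sup>2 * i * (1 + u) - 2 * u ^ 3 * ((1 + u)\<^sup>2 * i ^ 3 + i * (1 + u))"
      unfolding g6 i'_def by (simp add: algebra_simps eval_nat_numeral)
    also have "\<dots> = 6 * u\<^sup>2 * i - u ^ 3 * i + u ^ 3 * (3 * i - 2 * ((i - 1) * i * (i + 1))) - 2 * u ^ 4 * (2 * i ^ 3 + i + u * i ^ 3)"
      by (simp add: algebra_simps eval_nat_numeral)
    also have "(i - 1) * i * (i + 1) = 6 * tet i" by (simp only: tet)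
    finally show ?thesis unfolding h u_def by (simp add: algebra_simps eval_nat_numeral)
  qed
  then have "Q dvd 12 * (i + int n * g i) * (1 + u) - 12 * (i' + g i') - (6 * u\<^sup>2 * i - u ^ 3 * i)"
    using Q_dvd3 Q_dvd4 by simp
  ultimately have "Q dvd 12 * (I i n - (i + int n * g i)) * (1 + u)
     + (12 * (i + int n * g i) * (1 + u) - 12 * (i' + g i') - (6 * u\<^sup>2 * i - u ^ 3 * i))" by (rule dvd_add)
  then show ?thesis by (simp add: algebra_simps)
qed

lemma S_cong: "q\<^sup>2 dvd 2 * S i t - (2 * int t * i + int t * (int t - 1) * g i)"
proof (induction t)
  case (Suc t)
  have "q\<^sup>2 dvd (2 * S i t - (2 * int t * i + int t * (int t - 1) * g i)) + 2 * (I i t - (i + int t * g i))"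
    using Suc I_cong by (intro dvd_add dvd_mult)
  then show ?case by (simp add: algebra_simps)
qed simp

lemma S_final:
  assumes n: "q ^ 3 dvd int n - (1 + v)"
  shows "q\<^sup>2 dvd S i n - i * (1 + u)"
proof -
  obtain w where "int n - (1 + v) = q ^ 3 * w" using n by blast
  then have n': "int n = 1 + u + q\<^sup>2 * (s + q * w)"
    by (simp add: u_def v_def algebra_simps power2_eq_square power3_eq_cube)
  obtain h where h: "g i = q * h" using g_dvd by blast
  have "2 * int n * i + int n * (int n - 1) * g i - 2 * (i * (1 + u))
    = q\<^sup>2 * (2 * (s + q * w) * i + int n * (r + q * (s + q * w)) * h)"
  proof -
    have "int n - 1 = q * (r + q * (s + q * w))" unfolding n' by (simp add: u_def algebra_simps power2_eq_square)
    then have "int n * (int n - 1) * g i = q\<^sup>2 * (int n * (r + q * (s + q * w)) * h)"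
      by (simp add: h power2_eq_square algebra_simps)
    moreover have "2 * int n * i - 2 * (i * (1 + u)) = q\<^sup>2 * (2 * (s + q * w) * i)"
      unfolding n' by (simp add: algebra_simps)
    ultimately show ?thesis by (simp add: distrib_left)
  qed
  then have "q\<^sup>2 dvd 2 * int n * i + int n * (int n - 1) * g i - 2 * (i * (1 + u))" by simp
  with S_cong[of i n] have "q\<^sup>2 dvd (2 * S i n - (2 * int n * i + int n * (int n - 1) * g i))
     + (2 * int n * i + int n * (int n - 1) * g i - 2 * (i * (1 + u)))" by (rule dvd_add)
  then have "q\<^sup>2 dvd 2 * (S i n - i * (1 + u))" by (simp add: algebra_simps)
  then show ?thesis by (rule odd_cancel)
qed

text \<open>Twelve times the sum over j < t of bb(k + x) - bb(k), where x is \<open>S i j\<close>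
  approximated by j i + j(j-1)/2 g(i) in the term linear in v, and by j i in the term with
  v^2.\<close>

definition R where "R k i t = 6 * v * i * t * (t - 1) + 2 * v * g i * t * (t - 1) * (t - 2)
    + 6 * v\<^sup>2 * k * i * t * (t - 1) + v\<^sup>2 * i\<^sup>2 * t * (t - 1) * (2 * t - 1) - 3 * v\<^sup>2 * i * t * (t - 1)"

lemma bb_diff: "2 * (bb (k + x) - bb k) = 2 * v * x + v\<^sup>2 * (2 * k * x + x * x - x)"
proof -
  have "2 * (bb (k + x) - bb k) = 2 * v * x + v\<^sup>2 * (2 * tri (k + x - 1)) - v\<^sup>2 * (2 * tri (k - 1))"
    by (simp add: bb_def algebra_simps)
  then show ?thesis unfolding tri by (simp add: algebra_simps)
qed

lemma T_sum: "Q dvd 12 * (T k i t - int t * bb k) - R k i (int t)"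
proof (induction t)
  case 0
  then show ?case by (simp add: R_def)
next
  case (Suc t)
  define x where "x = S i t"
  obtain z where z: "2 * x - (2 * int t * i + int t * (int t - 1) * g i) = q\<^sup>2 * z"
    unfolding x_def using S_cong by blast
  have "q dvd x - int t * i"
  proof -
    have "2 * (x - int t * i) = q\<^sup>2 * z + int t * (int t - 1) * g i" using z by (simp add: algebra_simps)
    then have "q ^ 1 dvd 2 * (x - int t * i)" using g_dvd by (simp add: power2_eq_square)
    from odd_cancel[OF this] show ?thesis by simp
  qed
  then obtain y where y: "x - int t * i = q * y" by blast
  have "12 * (bb (k + x) - bb k) - (R k i (int (Suc t)) - R k i (int t))
     = 3 * q ^ 3 * (2 * (r + q * s) * z + 2 * (r + q * s)\<^sup>2 * y * (2 * k + x + int t * i - 1))"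
  proof -
    have "12 * (bb (k + x) - bb k) = 6 * v * (2 * x) + 6 * v\<^sup>2 * (2 * k * x + x * x - x)"
      using bb_diff[of k x] by (simp add: algebra_simps)
    moreover have "R k i (int (Suc t)) - R k i (int t)
       = 6 * v * (2 * int t * i + int t * (int t - 1) * g i) + 6 * v\<^sup>2 * (2 * k * (int t * i) + (int t * i) * (int t * i) - int t * i)"
      by (simp add: R_def algebra_simps power2_eq_square)
    ultimately have "12 * (bb (k + x) - bb k) - (R k i (int (Suc t)) - R k i (int t))
      = 6 * v * (2 * x - (2 * int t * i + int t * (int t - 1) * g i)) + 6 * v\<^sup>2 * ((x - int t * i) * (2 * k + x + int t * i - 1))"
      by (simp add: algebra_simps)
    then show ?thesis unfolding y z by (simp add: v_def algebra_simps eval_nat_numeral)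
  qed
  then have "Q dvd 12 * (bb (k + x) - bb k) - (R k i (int (Suc t)) - R k i (int t))" using Q_dvd3 by simp
  then have "Q dvd (12 * (T k i t - int t * bb k) - R k i (int t))
     + (12 * (bb (k + x) - bb k) - (R k i (int (Suc t)) - R k i (int t)))" using Suc by (rule dvd_add[rotated])
  also have "\<dots> = 12 * (T k i (Suc t) - int (Suc t) * bb k) - R k i (int (Suc t))"
    by (simp add: x_def algebra_simps)
  finally show ?case .
qed

lemma T_final:
  assumes n: "q ^ 3 dvd int n - (1 + v)"
  shows "Q dvd 12 * (T k i n - bb (k + 1)) - (6 * u\<^sup>2 * i - u ^ 3 * i)"
proof -
  obtain w where w: "int n - (1 + v) = q ^ 3 * w" using n by blast
  define f e' v' where "f = s + q * w" and "e' = r + q * f" and "v' = r + q * s"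
  define D where "D = r * f + r * s + q * s * f"
  have ve: "v' * e' = r\<^sup>2 + q * D" by (simp add: v'_def e'_def D_def algebra_simps power2_eq_square)
  have v: "v = q * v'" by (simp add: v_def v'_def)
  have nn: "int n = 1 + q * e'"
    using w by (simp add: v_def e'_def f_def algebra_simps power2_eq_square power3_eq_cube)
  \<comment> \<open>Modulo Q, the parts of R at n reduce as follows: \<open>p1\<close> leaves 6 u^2
    i, \<open>p2\<close> leaves -u^3 i(i+1), \<open>p4\<close> leaves u^3 i^2, and the parts in
    \<open>p3\<close> vanish, as does the difference in \<open>p5\<close>. The sum is the
    discrepancy of \<open>i_final\<close>.\<close>
  have p1: "6 * v * i * int n * (int n - 1) - 6 * u\<^sup>2 * i = 3 * q ^ 3 * (2 * i * (D + (v' * e') * e'))"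
  proof -
    have "6 * v * i * int n * (int n - 1) = 6 * q\<^sup>2 * i * ((v' * e') + q * (v' * e') * e')"
      unfolding nn v by (simp add: algebra_simps power2_eq_square)
    note eq = this
    show ?thesis unfolding eq ve by (simp add: u_def algebra_simps power2_eq_square power3_eq_cube)
  qed
  have p2: "2 * v * g i * int n * (int n - 1) * (int n - 2) + u ^ 3 * i * (i + 1)
     = q ^ 4 * (i * (i + 1) * r * (q * (v' * e') * e'\<^sup>2 - D) + 2 * (v' * e') * r\<^sup>2 * tet i * (q\<^sup>2 * e'\<^sup>2 - 1))"
  proof -
    have "2 * g i = u * (2 * tri i) + 2 * u\<^sup>2 * tet i" by (simp add: g_def algebra_simps)
    then have g2: "2 * g i = q * (r * (i * (i + 1)) + 2 * q * r\<^sup>2 * tet i)"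
      unfolding tri by (simp add: u_def algebra_simps power2_eq_square)
    have n2: "int n * (int n - 2) = q\<^sup>2 * e'\<^sup>2 - 1" unfolding nn by (simp add: algebra_simps power2_eq_square)
    have n1: "v * (int n - 1) = q\<^sup>2 * (v' * e')" unfolding nn v by (simp add: power2_eq_square)
    have "2 * v * g i * int n * (int n - 1) * (int n - 2)
       = (2 * g i) * (v * (int n - 1)) * (int n * (int n - 2))" by (simp add: algebra_simps)
    also have "\<dots> = q ^ 3 * ((r * (i * (i + 1)) + 2 * q * r\<^sup>2 * tet i) * (v' * e') * (q\<^sup>2 * e'\<^sup>2 - 1))"
      unfolding g2 n1 n2 by (simp add: power2_eq_square power3_eq_cube)
    also have "\<dots> = q ^ 4 * (2 * (v' * e') * r\<^sup>2 * tet i * (q\<^sup>2 * e'\<^sup>2 - 1))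
        + q ^ 3 * (i * (i + 1) * r * ((v' * e') * (q\<^sup>2 * e'\<^sup>2) - (v' * e')))"
      by (simp add: algebra_simps eval_nat_numeral)
    also have "(v' * e') * (q\<^sup>2 * e'\<^sup>2) - (v' * e') = q * (q * (v' * e') * e'\<^sup>2 - D) - r\<^sup>2"
      unfolding ve by (simp add: algebra_simps eval_nat_numeral)
    finally show ?thesis by (simp add: u_def algebra_simps eval_nat_numeral)
  qed
  have p3: "6 * v\<^sup>2 * k * i * int n * (int n - 1) = 3 * q ^ 3 * (2 * v'\<^sup>2 * k * i * int n * e')"
    "3 * v\<^sup>2 * i * int n * (int n - 1) = 3 * q ^ 3 * (v'\<^sup>2 * i * int n * e')"
    unfolding v by (simp_all add: nn power2_eq_square power3_eq_cube)
  have p4: "v\<^sup>2 * i\<^sup>2 * int n * (int n - 1) * (2 * int n - 1) - u ^ 3 * i\<^sup>2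
     = q ^ 4 * (i\<^sup>2 * (v' * D + r\<^sup>2 * s + v' * (v' * e') * e' * (3 + 2 * q * e')))"
  proof -
    have "int n * (2 * int n - 1) = 1 + q * e' * (3 + 2 * q * e')" unfolding nn by (simp add: algebra_simps)
    then have "v\<^sup>2 * i\<^sup>2 * int n * (int n - 1) * (2 * int n - 1)
       = q ^ 3 * i\<^sup>2 * (v' * (v' * e') + q * (v' * (v' * e') * e' * (3 + 2 * q * e')))"
      unfolding v by (simp add: nn algebra_simps eval_nat_numeral)
    moreover have "v' * (v' * e') = r ^ 3 + q * (v' * D + r\<^sup>2 * s)"
      unfolding ve by (simp add: v'_def algebra_simps eval_nat_numeral)
    ultimately have "v\<^sup>2 * i\<^sup>2 * int n * (int n - 1) * (2 * int n - 1)
       = q ^ 3 * i\<^sup>2 * (r ^ 3 + q * (v' * D + r\<^sup>2 * s) + q * (v' * (v' * e') * e' * (3 + 2 * q * e')))" by simp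
    then show ?thesis by (simp add: u_def algebra_simps eval_nat_numeral)
  qed
  have p5: "12 * (int n * bb k - bb (k + 1)) = 3 * q ^ 3 * (4 * v' ^ 3 * tri (k - 1) + 4 * w * bb k)"
  proof -
    have "2 * tri k = 2 * tri (k - 1) + 2 * k" unfolding tri by (simp add: algebra_simps)
    then have "tri k = tri (k - 1) + k" by simp
    then have "bb (k + 1) = bb k + v + v\<^sup>2 * k" by (simp add: bb_def algebra_simps)
    moreover have "int n = 1 + v + q ^ 3 * w" using w by simp
    ultimately have "int n * bb k - bb (k + 1) = v * bb k - v - v\<^sup>2 * k + q ^ 3 * w * bb k"
      by (simp add: algebra_simps)
    also have "v * bb k - v - v\<^sup>2 * k = v ^ 3 * tri (k - 1)"
      by (simp add: bb_def algebra_simps power2_eq_square power3_eq_cube)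
    finally show ?thesis by (simp add: v algebra_simps power_mult_distrib)
  qed
  have "R k i (int n) + 12 * (int n * bb k - bb (k + 1)) - (6 * u\<^sup>2 * i - u ^ 3 * i)
     = (6 * v * i * int n * (int n - 1) - 6 * u\<^sup>2 * i)
     + (2 * v * g i * int n * (int n - 1) * (int n - 2) + u ^ 3 * i * (i + 1))
     + 6 * v\<^sup>2 * k * i * int n * (int n - 1)
     + (v\<^sup>2 * i\<^sup>2 * int n * (int n - 1) * (2 * int n - 1) - u ^ 3 * i\<^sup>2)
     - 3 * v\<^sup>2 * i * int n * (int n - 1) + 12 * (int n * bb k - bb (k + 1))"
    unfolding R_def by (simp add: algebra_simps power2_eq_square)
  also have "Q dvd \<dots>"
    unfolding p1 p2 p3 p4 p5 by (intro dvd_add dvd_diff Q_dvd3 Q_dvd4)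
  finally have "Q dvd R k i (int n) + 12 * (int n * bb k - bb (k + 1)) - (6 * u\<^sup>2 * i - u ^ 3 * i)" .
  with T_sum[of k i n] have "Q dvd (12 * (T k i n - int n * bb k) - R k i (int n))
     + (R k i (int n) + 12 * (int n * bb k - bb (k + 1)) - (6 * u\<^sup>2 * i - u ^ 3 * i))" by (rule dvd_add)
  then show ?thesis by (simp add: algebra_simps)
qed

text \<open>The coordinates i and d of the relation c b = b^\<beta> c in the model. The common
  discrepancy vanishes modulo q^2 in the first and cancels in the second.\<close>

lemma relation_B:
  fixes i k :: int
  assumes n: "q ^ 3 dvd int n - (1 + v)"
  defines "i' \<equiv> i * (1 + u)"
  shows "q\<^sup>2 dvd I i n * (1 + u) - (i' + g i')"
    and "q ^ 3 dvd (T k i n - I i n * (1 + u)) - (bb (k + 1) - (i' + g i'))"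
proof -
  have 1: "Q dvd 12 * (I i n * (1 + u) - (i' + g i')) - (6 * u\<^sup>2 * i - u ^ 3 * i)"
    unfolding i'_def by (rule i_final[OF n])
  have eq: "6 * u\<^sup>2 * i - u ^ 3 * i = 3 * q\<^sup>2 * (2 * r\<^sup>2 * i) + q ^ 3 * (- (r ^ 3) * i)"
    by (simp add: u_def power_mult_distrib)
  show "q\<^sup>2 dvd I i n * (1 + u) - (i' + g i')" by (rule Q_cancel2[OF 1[unfolded eq]])
  have "Q dvd (12 * (T k i n - bb (k + 1)) - (6 * u\<^sup>2 * i - u ^ 3 * i))
     - (12 * (I i n * (1 + u) - (i' + g i')) - (6 * u\<^sup>2 * i - u ^ 3 * i))"
    using T_final[OF n] 1 by (rule dvd_diff)
  then have "Q dvd 12 * ((T k i n - I i n * (1 + u)) - (bb (k + 1) - (i' + g i')))"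
    by (simp add: algebra_simps)
  then show "q ^ 3 dvd (T k i n - I i n * (1 + u)) - (bb (k + 1) - (i' + g i'))" by (rule Q_cancel)
qed

end

section \<open>The presented group and its permutation representations\<close>

lemma inv_letter_inv_letter [simp]: "inv_letter (inv_letter x) = x"
  by (simp add: inv_letter_def)

lemma inv_word_append [simp]: "inv_word (u @ v) = inv_word v @ inv_word u"
  by (simp add: inv_word_def)

lemma pres_eq_context: "pres_eq R u v \<Longrightarrow> pres_eq R (s @ u @ t) (s @ v @ t)"
proof (induction rule: pres_eq.induct)
  case (pe_cancel u x v)
  show ?case using pres_eq.pe_cancel[of R "s @ u" x "v @ t"] by simp
next
  case (pe_rel r u v)
  then show ?case using pres_eq.pe_rel[of r R "s @ u" "v @ t"] by simp
qed (blast intro: pres_eq.intros)+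

lemma pres_eq_append: "pres_eq R u u' \<Longrightarrow> pres_eq R v v' \<Longrightarrow> pres_eq R (u @ v) (u' @ v')"
  using pres_eq_context[of R u u' "[]" v] pres_eq_context[of R v v' u' "[]"]
  by (auto intro: pe_trans)

lemma pres_eq_inv_word: "pres_eq R (inv_word w @ w) []"
proof (induction w)
  case (Cons x w)
  have "inv_word (x # w) @ x # w = inv_word w @ [inv_letter x, inv_letter (inv_letter x)] @ w"
    by (simp add: inv_word_def)
  then have "pres_eq R (inv_word (x # w) @ x # w) (inv_word w @ w)" using pe_cancel by metis
  then show ?case using Cons by (rule pe_trans)
qed (simp add: inv_word_def pe_refl)

lemma word_class_eq_iff: "word_class R u = word_class R v \<longleftrightarrow> pres_eq R u v"
proof
  assume "word_class R u = word_class R v"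
  moreover have "v \<in> word_class R v" by (simp add: word_class_def pe_refl)
  ultimately have "v \<in> word_class R u" by simp
  then show "pres_eq R u v" by (simp add: word_class_def)
next
  assume "pres_eq R u v"
  then show "word_class R u = word_class R v"
    unfolding word_class_def by (blast intro: pe_trans pe_sym)
qed

lemma some_in_word_class: "pres_eq R u (SOME x. x \<in> word_class R u)"
proof -
  have "(SOME x. x \<in> word_class R u) \<in> word_class R u"
    by (rule someI[of _ u]) (simp add: word_class_def pe_refl)
  then show ?thesis by (simp add: word_class_def)
qed

lemma presented_group_mult:
  "word_class R u \<otimes>\<^bsub>presented_group R\<^esub> word_class R v = word_class R (u @ v)"
  unfolding presented_group_def
  by (simp add: word_class_eq_iff) (intro pe_sym[OF pres_eq_append] some_in_word_class)

lemma presented_group_one: "\<one>\<^bsub>presented_group R\<^esub> = word_class R []"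
  and presented_group_carrier: "carrier (presented_group R) = range (word_class R)"
  by (simp_all add: presented_group_def)

lemma presented_group_is_group: "group (presented_group R)"
proof (rule groupI)
  fix x assume "x \<in> carrier (presented_group R)"
  then obtain w where w: "x = word_class R w" by (auto simp: presented_group_carrier)
  have "word_class R (inv_word w) \<otimes>\<^bsub>presented_group R\<^esub> x = \<one>\<^bsub>presented_group R\<^esub>"
    unfolding w presented_group_mult presented_group_one word_class_eq_iff by (rule pres_eq_inv_word)
  then show "\<exists>y\<in>carrier (presented_group R). y \<otimes>\<^bsub>presented_group R\<^esub> x = \<one>\<^bsub>presented_group R\<^esub>"
    by (auto simp: presented_group_carrier)
qed (auto simp: presented_group_carrier presented_group_one presented_group_mult)

lemma presented_group_inv:
  "inv\<^bsub>presented_group R\<^esub> word_class R w = word_class R (inv_word w)"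
proof -
  interpret group "presented_group R" by (rule presented_group_is_group)
  show ?thesis
    by (rule inv_equality)
      (auto simp: presented_group_carrier presented_group_mult presented_group_one word_class_eq_iff pres_eq_inv_word)
qed

lemma presented_group_nat_pow:
  "word_class R w [^]\<^bsub>presented_group R\<^esub> (n::nat) = word_class R (concat (replicate n w))"
proof -
  interpret group "presented_group R" by (rule presented_group_is_group)
  show ?thesis
  proof (induction n)
    case (Suc n)
    have "concat (replicate n w) @ w = concat (replicate (Suc n) w)" by (induction n) auto
    then show ?case using Suc by (simp add: presented_group_mult)
  qed (simp add: presented_group_one)
qed

lemma presented_group_int_pow:
  "word_class R w [^]\<^bsub>presented_group R\<^esub> (k::int) = word_class R (wpow w k)"
proof -
  interpret group "presented_group R" by (rule presented_group_is_group)
  have w: "word_class R w \<in> carrier (presented_group R)" by (simp add: presented_group_carrier)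
  show ?thesis
  proof (cases "k \<ge> 0")
    case True
    then have "word_class R w [^]\<^bsub>presented_group R\<^esub> k = word_class R w [^]\<^bsub>presented_group R\<^esub> (nat k)"
      by (metis int_nat_eq int_pow_int)
    then show ?thesis using True by (simp only: presented_group_nat_pow wpow_def if_True)
  next
    case False
    then have "word_class R w [^]\<^bsub>presented_group R\<^esub> k = word_class R w [^]\<^bsub>presented_group R\<^esub> (- int (nat (-k)))"
      by simp
    also have "\<dots> = (inv\<^bsub>presented_group R\<^esub> word_class R w) [^]\<^bsub>presented_group R\<^esub> (nat (-k))"
      using w by (simp only: int_pow_neg_int nat_pow_inv)
    finally show ?thesis using False
      by (simp only: presented_group_inv presented_group_nat_pow wpow_def if_False)
  qed
qed

lemma Gab_is_group: "group (Gab \<alpha> \<beta>)"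
  unfolding Gab_def by (rule presented_group_is_group)

lemma Gab_macdonald: "macdonald (Gab \<alpha> \<beta>) (genA \<alpha> \<beta>) (genB \<alpha> \<beta>) (genC \<alpha> \<beta>) \<alpha> \<beta>"
proof -
  let ?R = "G_rels \<alpha> \<beta>"
  interpret group "Gab \<alpha> \<beta>" by (rule Gab_is_group)
  note defs = Gab_def genA_def genB_def genC_def
  have cl: "genA \<alpha> \<beta> \<in> carrier (Gab \<alpha> \<beta>)" "genB \<alpha> \<beta> \<in> carrier (Gab \<alpha> \<beta>)" "genC \<alpha> \<beta> \<in> carrier (Gab \<alpha> \<beta>)"
    by (auto simp: defs presented_group_carrier)
  have C: "genC \<alpha> \<beta> = inv\<^bsub>Gab \<alpha> \<beta>\<^esub> genA \<alpha> \<beta> \<otimes>\<^bsub>Gab \<alpha> \<beta>\<^esub> inv\<^bsub>Gab \<alpha> \<beta>\<^esub> genB \<alpha> \<beta> \<otimes>\<^bsub>Gab \<alpha> \<beta>\<^esub> genA \<alpha> \<beta> \<otimes>\<^bsub>Gab \<alpha> \<beta>\<^esub> genB \<alpha> \<beta>"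
    by (simp add: defs presented_group_inv presented_group_mult comm_word_def)
  have C': "inv\<^bsub>Gab \<alpha> \<beta>\<^esub> genC \<alpha> \<beta> = word_class ?R (comm_word wB wA)"
    unfolding C using cl
    by (simp add: inv_mult_group m_assoc) (simp add: defs presented_group_inv presented_group_mult comm_word_def)
  have rel: "word_class ?R r = \<one>\<^bsub>Gab \<alpha> \<beta>\<^esub>" if "r \<in> ?R" for r
    using pe_rel[OF that, of "[]" "[]"] by (simp add: defs presented_group_one word_class_eq_iff)
  note calc = defs presented_group_inv presented_group_mult presented_group_int_pow conj_word_def G_rels_def
  show ?thesis
  proof (rule macdonaldI[OF cl(1,2) C])
    let ?r = "conj_word wA (comm_word wA wB) @ inv_word (wpow wA \<alpha>)"
    show "inv\<^bsub>Gab \<alpha> \<beta>\<^esub> genC \<alpha> \<beta> \<otimes>\<^bsub>Gab \<alpha> \<beta>\<^esub> (genA \<alpha> \<beta> \<otimes>\<^bsub>Gab \<alpha> \<beta>\<^esub> genC \<alpha> \<beta>)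
        \<otimes>\<^bsub>Gab \<alpha> \<beta>\<^esub> inv\<^bsub>Gab \<alpha> \<beta>\<^esub> (genA \<alpha> \<beta> [^]\<^bsub>Gab \<alpha> \<beta>\<^esub> \<alpha>) = \<one>\<^bsub>Gab \<alpha> \<beta>\<^esub>"
      using rel[of ?r] by (simp add: calc)
    let ?r = "conj_word wB (comm_word wB wA) @ inv_word (wpow wB \<beta>)"
    have "inv\<^bsub>Gab \<alpha> \<beta>\<^esub> (inv\<^bsub>Gab \<alpha> \<beta>\<^esub> genC \<alpha> \<beta>) \<otimes>\<^bsub>Gab \<alpha> \<beta>\<^esub> (genB \<alpha> \<beta> \<otimes>\<^bsub>Gab \<alpha> \<beta>\<^esub> inv\<^bsub>Gab \<alpha> \<beta>\<^esub> genC \<alpha> \<beta>)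
        \<otimes>\<^bsub>Gab \<alpha> \<beta>\<^esub> inv\<^bsub>Gab \<alpha> \<beta>\<^esub> (genB \<alpha> \<beta> [^]\<^bsub>Gab \<alpha> \<beta>\<^esub> \<beta>) = \<one>\<^bsub>Gab \<alpha> \<beta>\<^esub>"
      unfolding C' using rel[of ?r] by (simp add: calc)
    then show "genC \<alpha> \<beta> \<otimes>\<^bsub>Gab \<alpha> \<beta>\<^esub> (genB \<alpha> \<beta> \<otimes>\<^bsub>Gab \<alpha> \<beta>\<^esub> inv\<^bsub>Gab \<alpha> \<beta>\<^esub> genC \<alpha> \<beta>)
        \<otimes>\<^bsub>Gab \<alpha> \<beta>\<^esub> inv\<^bsub>Gab \<alpha> \<beta>\<^esub> (genB \<alpha> \<beta> [^]\<^bsub>Gab \<alpha> \<beta>\<^esub> \<beta>) = \<one>\<^bsub>Gab \<alpha> \<beta>\<^esub>"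
      using cl by simp
  qed
qed

lemma Gab_generated: "carrier (Gab \<alpha> \<beta>) = generate (Gab \<alpha> \<beta>) {genA \<alpha> \<beta>, genB \<alpha> \<beta>}"
proof -
  interpret macdonald "Gab \<alpha> \<beta>" "genA \<alpha> \<beta>" "genB \<alpha> \<beta>" "genC \<alpha> \<beta>" \<alpha> \<beta> by (rule Gab_macdonald)
  let ?S = "generate (Gab \<alpha> \<beta>) {genA \<alpha> \<beta>, genB \<alpha> \<beta>}"
  have sub: "subgroup ?S (Gab \<alpha> \<beta>)" by (rule generate_is_subgroup) simp
  have letter: "word_class (G_rels \<alpha> \<beta>) [l] \<in> ?S" for l
  proof -
    have "word_class (G_rels \<alpha> \<beta>) [(x, False)] \<in> ?S" for x
      by (cases x) (auto simp: genA_def genB_def wA_def wB_def intro: generate.incl)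
    moreover from subgroup.m_inv_closed[OF sub this] have "word_class (G_rels \<alpha> \<beta>) [(x, True)] \<in> ?S" for x
      by (simp add: Gab_def presented_group_inv inv_word_def inv_letter_def)
    ultimately show ?thesis by (cases l; cases "snd l") auto
  qed
  have "word_class (G_rels \<alpha> \<beta>) w \<in> ?S" for w
  proof (induction w)
    case Nil
    show ?case using generate.one[of "Gab \<alpha> \<beta>"] by (simp add: Gab_def presented_group_one)
  next
    case (Cons l w)
    from subgroup.m_closed[OF sub letter[of l] Cons] show ?case by (simp add: Gab_def presented_group_mult)
  qed
  then have "carrier (Gab \<alpha> \<beta>) \<subseteq> ?S" by (auto simp: Gab_def presented_group_carrier)
  then show ?thesis using generate_incl[of "{genA \<alpha> \<beta>, genB \<alpha> \<beta>}"] by auto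
qed

section \<open>Actions of the presented group\<close>

text \<open>Words act from the right, first letter first, so the relation a b = b a c reads as in
  \<open>AB\<close>. Possibly negative exponents are represented by all natural n congruent to them
  modulo N; that N is a period of the generators then follows from \<open>AC\<close> and
  \<open>CB\<close>.\<close>

locale perm_rep =
  fixes \<Omega> :: "'x set" and PA PB PC :: "'x \<Rightarrow> 'x" and N :: nat and \<alpha> \<beta> :: int
  assumes N: "N > 0"
    and bij: "bij_betw PA \<Omega> \<Omega>" "bij_betw PB \<Omega> \<Omega>" "bij_betw PC \<Omega> \<Omega>"
    and AB: "x \<in> \<Omega> \<Longrightarrow> PB (PA x) = PC (PA (PB x))"
    and AC: "x \<in> \<Omega> \<Longrightarrow> int N dvd int n - \<alpha> \<Longrightarrow> PC (PA x) = (PA ^^ n) (PC x)"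
    and CB: "x \<in> \<Omega> \<Longrightarrow> int N dvd int n - \<beta> \<Longrightarrow> PB (PC x) = PC ((PB ^^ n) x)"
begin

definition act_letter :: "letter \<Rightarrow> 'x \<Rightarrow> 'x" where
  "act_letter l = (let P = if fst l then PB else PA in if snd l then inv_into \<Omega> P else P)"

definition act :: "word \<Rightarrow> 'x \<Rightarrow> 'x" where
  "act = fold act_letter"

lemma bij_letter: "bij_betw (act_letter l) \<Omega> \<Omega>"
  using bij by (simp add: act_letter_def Let_def bij_betw_inv_into)

lemma act_letter_inv: "x \<in> \<Omega> \<Longrightarrow> act_letter (inv_letter l) (act_letter l x) = x"
  using bij by (auto simp: act_letter_def inv_letter_def Let_def bij_betw_inv_into_left bij_betw_inv_into_right)

lemma act_append [simp]: "act (u @ v) x = act v (act u x)"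
  by (simp add: act_def)

lemma act_Nil [simp]: "act [] x = x"
  by (simp add: act_def)

lemma act_Cons: "act (l # w) x = act w (act_letter l x)"
  by (simp add: act_def)

lemma act_letter_closed: "x \<in> \<Omega> \<Longrightarrow> act_letter l x \<in> \<Omega>"
  using bij_betwE[OF bij_letter] by blast

lemma act_closed [simp]: "x \<in> \<Omega> \<Longrightarrow> act w x \<in> \<Omega>"
  by (induction w arbitrary: x) (simp_all add: act_Cons act_letter_closed)

lemma act_inv_word [simp]: "x \<in> \<Omega> \<Longrightarrow> act (inv_word w) (act w x) = x"
proof (induction w arbitrary: x)
  case (Cons l w)
  have "act_letter l x \<in> \<Omega>" using Cons.prems by (rule act_letter_closed)
  then show ?case using Cons.IH[of "act_letter l x"] act_letter_inv[OF Cons.prems]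
    by (simp add: inv_word_def act_Cons)
qed (simp add: inv_word_def)

lemma act_inv_word' [simp]: "x \<in> \<Omega> \<Longrightarrow> act w (act (inv_word w) x) = x"
proof -
  assume "x \<in> \<Omega>"
  then have "act (inv_word (inv_word w)) (act (inv_word w) x) = x" by simp
  moreover have "inv_word (inv_word w) = w" by (simp add: inv_word_def rev_map comp_def)
  ultimately show ?thesis by simp
qed

lemma act_wA [simp]: "act wA x = PA x" and act_wB [simp]: "act wB x = PB x"
  by (simp_all add: wA_def wB_def act_Cons act_letter_def)

lemma PC_closed: "x \<in> \<Omega> \<Longrightarrow> PC x \<in> \<Omega>" using bij(3) bij_betwE by blast
lemma PA_closed: "x \<in> \<Omega> \<Longrightarrow> PA x \<in> \<Omega>" using bij(1) bij_betwE by blast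

lemma act_comm: "x \<in> \<Omega> \<Longrightarrow> act (comm_word wA wB) x = PC x"
proof -
  assume x: "x \<in> \<Omega>"
  define y where "y = act (inv_word wB) (act (inv_word wA) x)"
  have y: "y \<in> \<Omega>" using x by (simp add: y_def)
  have "PA (PB y) = x"
    using x act_inv_word'[of "act (inv_word wA) x" wB] act_inv_word'[of x wA] by (simp add: y_def)
  then show ?thesis using AB[OF y] by (simp add: comm_word_def y_def)
qed

lemma act_comm': "x \<in> \<Omega> \<Longrightarrow> act (comm_word wB wA) (PC x) = x"
proof -
  assume x: "x \<in> \<Omega>"
  have "comm_word wB wA = inv_word (comm_word wA wB)"
    by (simp add: comm_word_def inv_word_def wA_def wB_def inv_letter_def)
  then show ?thesis using act_inv_word[OF x, of "comm_word wA wB"] act_comm[OF x] by simp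
qed

lemma PC_surj: "x \<in> \<Omega> \<Longrightarrow> \<exists>y\<in>\<Omega>. x = PC y"
  using bij(3) by (auto simp: bij_betw_def)

lemma act_replicate: "act (concat (replicate n w)) x = (act w ^^ n) x"
proof (induction n arbitrary: x)
  case (Suc n)
  then show ?case by (simp add: funpow_swap1)
qed simp

lemma funpow_closed: "x \<in> \<Omega> \<Longrightarrow> (act w ^^ n) x \<in> \<Omega>"
  by (induction n) auto

lemma funpow_inv: "x \<in> \<Omega> \<Longrightarrow> (act (inv_word w) ^^ n) ((act w ^^ n) x) = x"
proof (induction n)
  case (Suc n)
  have "(act (inv_word w) ^^ Suc n) ((act w ^^ Suc n) x)
     = (act (inv_word w) ^^ n) (act (inv_word w) (act w ((act w ^^ n) x)))" by (simp add: funpow_swap1)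
  then show ?case using Suc funpow_closed[OF Suc.prems] by simp
qed simp

text \<open>A period N of the word allows any natural representative of an integer exponent,
  including a negative one.\<close>

lemma act_wpow:
  assumes period: "\<And>x. x \<in> \<Omega> \<Longrightarrow> (act w ^^ N) x = x" and x: "x \<in> \<Omega>" and n: "int N dvd int n - k"
  shows "act (wpow w k) x = (act w ^^ n) x"
proof -
  have period': "(act w ^^ (N * j)) y = y" if "y \<in> \<Omega>" for j y
    using that by (induction j) (simp_all add: funpow_add period)
  have eq: "(act w ^^ i) y = (act w ^^ j) y" if y: "y \<in> \<Omega>" and "int N dvd int i - int j" for i j y
  proof -
    have *: "(act w ^^ i) y = (act w ^^ j) y" if "i \<ge> j" "int N dvd int i - int j" for i j
    proof -
      have "N dvd i - j" using that by (metis of_nat_diff of_nat_dvd_iff)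
      then obtain l where "i - j = N * l" by blast
      then have "i = j + N * l" using that(1) by simp
      then show ?thesis using period'[OF y] by (simp add: funpow_add)
    qed
    show ?thesis
    proof (cases "i \<ge> j")
      case False
      then have "(act w ^^ j) y = (act w ^^ i) y" using that(2) by (intro *) (simp_all add: dvd_diff_commute)
      then show ?thesis by simp
    qed (use * that(2) in simp)
  qed
  show ?thesis
  proof (cases "k \<ge> 0")
    case True
    then have "act (wpow w k) x = (act w ^^ nat k) x" by (simp add: wpow_def act_replicate)
    also have "\<dots> = (act w ^^ n) x" using n True x by (intro eq) (auto simp: dvd_diff_commute)
    finally show ?thesis .
  next
    case False
    define l where "l = nat (- k)"
    have k: "k = - int l" using False by (simp add: l_def)
    have "(act w ^^ l) ((act w ^^ n) x) = (act w ^^ (l + n)) x" by (simp add: funpow_add)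
    also have "\<dots> = (act w ^^ 0) x" using n x by (intro eq) (auto simp: k add.commute)
    finally have "x = (act w ^^ l) ((act w ^^ n) x)" by simp
    then have "(act (inv_word w) ^^ l) x = (act w ^^ n) x"
      using funpow_inv[OF funpow_closed[OF x], of l w n w] by simp
    then show ?thesis using False by (simp add: wpow_def act_replicate l_def)
  qed
qed

lemma exists_rep: "\<exists>n. int N dvd int n - k"
  by (rule exI[of _ "nat (k mod int N)"]) (use N in \<open>simp add: dvd_diff_commute[of _ "k mod int N"] dvd_minus_mod\<close>)

lemma funpow_act: "(act wA ^^ n) = (PA ^^ n)" "(act wB ^^ n) = (PB ^^ n)"
proof -
  have "act wA = PA" "act wB = PB" by auto
  then show "(act wA ^^ n) = (PA ^^ n)" "(act wB ^^ n) = (PB ^^ n)" by auto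
qed

lemma funpow_surj: "x \<in> \<Omega> \<Longrightarrow> \<exists>y\<in>\<Omega>. x = (act w ^^ n) y"
proof (induction n arbitrary: x)
  case (Suc n)
  obtain y where y: "y \<in> \<Omega>" "act (inv_word w) x = (act w ^^ n) y"
    using Suc.IH[of "act (inv_word w) x"] Suc.prems by auto
  then have "x = (act w ^^ Suc n) y" using Suc.prems by (simp flip: y(2))
  then show ?case using y by blast
qed auto

text \<open>Comparing \<open>AC\<close> for n and for N + n shows that the powers of PA with these
  exponents agree on the image of PC, which is everything.\<close>

lemma period_A: "x \<in> \<Omega> \<Longrightarrow> (act wA ^^ N) x = x"
proof -
  assume x: "x \<in> \<Omega>"
  obtain n where n: "int N dvd int n - \<alpha>" using exists_rep by blast
  then have n': "int N dvd int (N + n) - \<alpha>" by (metis add_diff_eq dvd_add_triv_left_iff of_nat_add)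
  obtain y where y: "y \<in> \<Omega>" "x = (act wA ^^ n) y" using funpow_surj[OF x] by blast
  obtain z where z: "z \<in> \<Omega>" "y = PC z" using PC_surj y by blast
  have "(PA ^^ n) y = (PA ^^ (N + n)) y" using AC[OF z(1) n] AC[OF z(1) n'] z by simp
  then show ?thesis using y by (simp add: funpow_act funpow_add)
qed

lemma period_B: "x \<in> \<Omega> \<Longrightarrow> (act wB ^^ N) x = x"
proof -
  assume x: "x \<in> \<Omega>"
  obtain n where n: "int N dvd int n - \<beta>" using exists_rep by blast
  then have n': "int N dvd int (N + n) - \<beta>" by (metis add_diff_eq dvd_add_triv_left_iff of_nat_add)
  obtain y where y: "y \<in> \<Omega>" "x = (act wB ^^ n) y" using funpow_surj[OF x] by blast
  have "PC ((PB ^^ n) y) = PC ((PB ^^ (N + n)) y)" using CB[OF y(1) n] CB[OF y(1) n'] by simp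
  moreover have "(PB ^^ k) y \<in> \<Omega>" for k using funpow_closed[OF y(1), where w = wB and n = k] by (simp add: funpow_act)
  ultimately have "(PB ^^ n) y = (PB ^^ (N + n)) y"
    using bij(3) by (meson bij_betw_imp_inj_on inj_onD)
  then show ?thesis using y by (simp add: funpow_act funpow_add)
qed

lemma act_relator:
  assumes r: "r \<in> G_rels \<alpha> \<beta>" and x: "x \<in> \<Omega>"
  shows "act r x = x"
proof -
  consider "r = conj_word wA (comm_word wA wB) @ inv_word (wpow wA \<alpha>)"
    | "r = conj_word wB (comm_word wB wA) @ inv_word (wpow wB \<beta>)" using r by (auto simp: G_rels_def)
  then show ?thesis
  proof cases
    case 1
    obtain n where n: "int N dvd int n - \<alpha>" using exists_rep by blast
    obtain y where y: "y \<in> \<Omega>" "x = PC y" using PC_surj[OF x] by blast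
    have "act (inv_word (comm_word wA wB)) x = y"
      using act_inv_word[OF y(1), of "comm_word wA wB"] by (simp add: act_comm y)
    then have "act (conj_word wA (comm_word wA wB)) x = PC (PA y)"
      by (simp add: conj_word_def act_comm PA_closed y(1))
    also have "\<dots> = (act wA ^^ n) x" using AC[OF y(1) n] y by (simp add: funpow_act)
    also have "\<dots> = act (wpow wA \<alpha>) x" using act_wpow[OF period_A x n] by simp
    finally show ?thesis using x by (simp add: 1)
  next
    case 2
    obtain n where n: "int N dvd int n - \<beta>" using exists_rep by blast
    have "act (inv_word (comm_word wB wA)) x = PC x"
      using act_inv_word[OF PC_closed[OF x], of "comm_word wB wA"] by (simp add: act_comm'[OF x])
    then have "act (conj_word wB (comm_word wB wA)) x = act (comm_word wB wA) (PB (PC x))"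
      by (simp add: conj_word_def)
    also have "\<dots> = (act wB ^^ n) x"
      unfolding CB[OF x n] funpow_act[symmetric] by (rule act_comm'[OF funpow_closed[OF x]])
    also have "\<dots> = act (wpow wB \<beta>) x" using act_wpow[OF period_B x n] by simp
    finally show ?thesis using x by (simp add: 2)
  qed
qed

lemma act_pres_eq: "pres_eq (G_rels \<alpha> \<beta>) w w' \<Longrightarrow> x \<in> \<Omega> \<Longrightarrow> act w x = act w' x"
proof (induction arbitrary: x rule: pres_eq.induct)
  case (pe_cancel u l v)
  then show ?case by (simp add: act_Cons act_letter_inv)
next
  case (pe_rel r u v)
  then show ?case by (simp add: act_relator)
qed auto

definition rep :: "word set \<Rightarrow> 'x \<Rightarrow> 'x" where
  "rep g = act (SOME w. w \<in> g)"

lemma rep_word_class: "x \<in> \<Omega> \<Longrightarrow> rep (word_class (G_rels \<alpha> \<beta>) w) x = act w x"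
  unfolding rep_def using act_pres_eq[OF some_in_word_class] by metis

lemma rep_mult:
  assumes "g \<in> carrier (Gab \<alpha> \<beta>)" "h \<in> carrier (Gab \<alpha> \<beta>)" "x \<in> \<Omega>"
  shows "rep (g \<otimes>\<^bsub>Gab \<alpha> \<beta>\<^esub> h) x = rep h (rep g x)"
  using assms by (auto simp: Gab_def presented_group_carrier presented_group_mult rep_word_class)

lemma rep_one: "x \<in> \<Omega> \<Longrightarrow> rep \<one>\<^bsub>Gab \<alpha> \<beta>\<^esub> x = x"
  by (simp add: Gab_def presented_group_one rep_word_class)

lemma rep_closed: "g \<in> carrier (Gab \<alpha> \<beta>) \<Longrightarrow> x \<in> \<Omega> \<Longrightarrow> rep g x \<in> \<Omega>"
  by (auto simp: Gab_def presented_group_carrier rep_word_class)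

lemma rep_pow:
  assumes "g \<in> carrier (Gab \<alpha> \<beta>)" "x \<in> \<Omega>"
  shows "rep (g [^]\<^bsub>Gab \<alpha> \<beta>\<^esub> (n::nat)) x = (rep g ^^ n) x"
proof (induction n)
  case (Suc n)
  interpret group "Gab \<alpha> \<beta>" by (rule Gab_is_group)
  show ?case using Suc assms by (simp add: rep_mult)
qed (simp add: rep_one assms)

lemma rep_gen:
  assumes "x \<in> \<Omega>"
  shows "rep (genA \<alpha> \<beta>) x = PA x" "rep (genB \<alpha> \<beta>) x = PB x" "rep (genC \<alpha> \<beta>) x = PC x"
  using assms by (simp_all add: genA_def genB_def genC_def rep_word_class act_comm)

end

section \<open>The permutation model\<close>

context mac_model
begin

text \<open>The triple \<open>(d, k, i)\<close> stands for the element \<open>B ^ (d + i) C ^ k A ^ i\<close>, and \<open>fA\<close>, \<open>fB\<close>, \<open>fC\<close> are the right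
  multiplications by \<open>A\<close>, \<open>B\<close>, \<open>C\<close>. Recording \<open>d\<close> instead of the exponent of \<open>B\<close> builds in the relation
  \<open>A ^ (q ^ 2) B ^ (q ^ 2) = 1\<close>.\<close>
definition nrm :: "int \<times> int \<times> int \<Rightarrow> int \<times> int \<times> int" where
  "nrm = (\<lambda>(d, k, i). (d mod q ^ 3, k mod q\<^sup>2, i mod q\<^sup>2))"

definition fA :: "int \<times> int \<times> int \<Rightarrow> int \<times> int \<times> int" where
  "fA = (\<lambda>(d, k, i). (d - 1, k, i + 1))"

text \<open>From A^i B = B C^i A^(i + g i) and C^k B = B^(bb k) C^k. The exponent of B becomes d + i
  + bb k, and subtracting the new exponent i + g i of A gives the new d.\<close>

definition fB :: "int \<times> int \<times> int \<Rightarrow> int \<times> int \<times> int" where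
  "fB = (\<lambda>(d, k, i). (d + bb k - g i, k + i, i + g i))"

definition fC :: "int \<times> int \<times> int \<Rightarrow> int \<times> int \<times> int" where
  "fC = (\<lambda>(d, k, i). (d - i * u, k + 1, i * (1 + u)))"

lemma nrm_eq_iff:
  "nrm (d, k, i) = nrm (d', k', i') \<longleftrightarrow> q ^ 3 dvd d - d' \<and> q\<^sup>2 dvd k - k' \<and> q\<^sup>2 dvd i - i'"
  by (simp add: nrm_def mod_eq_dvd_iff)

lemma nrm_nrm [simp]: "nrm (nrm x) = nrm x"
  by (cases x) (simp add: nrm_def)

lemma dvd_shift: "d dvd y \<Longrightarrow> d dvd x + y \<longleftrightarrow> d dvd (x::int)" by (simp add: dvd_add_left_iff)

lemma fA_iff: "nrm (fA x) = nrm (fA y) \<longleftrightarrow> nrm x = nrm y"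
  by (cases x; cases y) (simp add: fA_def nrm_eq_iff)

lemma fB_iff: "nrm (fB x) = nrm (fB y) \<longleftrightarrow> nrm x = nrm y"
proof -
  obtain d k i where x: "x = (d, k, i)" by (cases x)
  obtain d' k' i' where y: "y = (d', k', i')" by (cases y)
  note xy = x y
  have i_iff: "q\<^sup>2 dvd (i + g i) - (i' + g i') \<longleftrightarrow> q\<^sup>2 dvd i - i'"
  proof
    assume 1: "q\<^sup>2 dvd (i + g i) - (i' + g i')"
    \<comment> \<open>First modulo q, where g vanishes; the congruence of i and i' found there makes
      the values of g agree modulo q^2.\<close>
    then have "q dvd (i + g i) - (i' + g i')" unfolding power2_eq_square by (rule dvd_mult_left)
    then have "q dvd (i + g i) - (i' + g i') - (g i - g i')" by (rule dvd_diff[OF _ dvd_diff[OF g_dvd g_dvd]])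
    then have "q dvd i - i'" by (simp add: algebra_simps)
    then have "q\<^sup>2 dvd g i - g i'" by (rule g_cong1)
    from dvd_diff[OF 1 this] show "q\<^sup>2 dvd i - i'" by (simp add: algebra_simps)
  next
    assume "q\<^sup>2 dvd i - i'"
    moreover from this have "q\<^sup>2 dvd g i - g i'"
      by (intro dvd_trans[OF _ g_cong2]) (simp_all add: le_imp_power_dvd)
    ultimately have "q\<^sup>2 dvd (i - i') + (g i - g i')" by (rule dvd_add)
    then show "q\<^sup>2 dvd (i + g i) - (i' + g i')" by (simp add: algebra_simps)
  qed
  have k_iff: "q\<^sup>2 dvd (k + i) - (k' + i') \<longleftrightarrow> q\<^sup>2 dvd k - k'" if "q\<^sup>2 dvd i - i'"
    using dvd_shift[OF that, of "k - k'"] by (simp add: algebra_simps)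
  have d_iff: "q ^ 3 dvd (d + bb k - g i) - (d' + bb k' - g i') \<longleftrightarrow> q ^ 3 dvd d - d'"
    if "q\<^sup>2 dvd i - i'" "q\<^sup>2 dvd k - k'"
    using dvd_shift[OF dvd_diff[OF bb_cong[OF that(2)] g_cong2[OF that(1)]], of "d - d'"]
    by (simp add: algebra_simps)
  show ?thesis unfolding xy fB_def using i_iff k_iff d_iff by (auto simp: nrm_eq_iff)
qed

lemma fC_iff: "nrm (fC x) = nrm (fC y) \<longleftrightarrow> nrm x = nrm y"
proof -
  obtain d k i where x: "x = (d, k, i)" by (cases x)
  obtain d' k' i' where y: "y = (d', k', i')" by (cases y)
  note xy = x y
  have "coprime (q\<^sup>2) (1 + u)" using coprime_of_dvd_diff_one[of q "1 + u"] u_dvd by simp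
  moreover have "i * (1 + u) - i' * (1 + u) = (1 + u) * (i - i')" by (simp add: algebra_simps)
  ultimately have i_iff: "q\<^sup>2 dvd i * (1 + u) - i' * (1 + u) \<longleftrightarrow> q\<^sup>2 dvd i - i'"
    by (simp add: coprime_dvd_mult_right_iff)
  have d_iff: "q ^ 3 dvd (d - i * u) - (d' - i' * u) \<longleftrightarrow> q ^ 3 dvd d - d'" if "q\<^sup>2 dvd i - i'"
  proof -
    have "q ^ 3 dvd - ((i - i') * u)"
      using mult_dvd_mono[OF that u_dvd] by (simp add: power3_eq_cube power2_eq_square)
    from dvd_shift[OF this, of "d - d'"] show ?thesis by (simp add: algebra_simps)
  qed
  show ?thesis unfolding xy fC_def using i_iff d_iff by (auto simp: nrm_eq_iff)
qed

definition pA where "pA x = nrm (fA x)"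
definition pB where "pB x = nrm (fB x)"
definition pC where "pC x = nrm (fC x)"

definition pts :: "(int \<times> int \<times> int) set" where
  "pts = {0..<q ^ 3} \<times> {0..<q\<^sup>2} \<times> {0..<q\<^sup>2}"

lemma finite_pts: "finite pts" by (simp add: pts_def)

lemma card_pts: "card pts = nat q ^ 7"
proof -
  have "card pts = nat (q ^ 3) * (nat (q\<^sup>2) * nat (q\<^sup>2))" by (simp add: pts_def card_cartesian_product)
  then show ?thesis using q_pos by (simp add: nat_power_eq flip: power_add)
qed

lemma nrm_in_pts: "nrm x \<in> pts"
  using q_pos by (cases x) (simp add: nrm_def pts_def)

lemma nrm_id: "x \<in> pts \<Longrightarrow> nrm x = x"
  by (cases x) (auto simp: nrm_def pts_def)

lemma bij_nrm:
  assumes "\<And>x y. nrm (f x) = nrm (f y) \<longleftrightarrow> nrm x = nrm y"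
  shows "bij_betw (\<lambda>x. nrm (f x)) pts pts"
proof -
  have "inj_on (\<lambda>x. nrm (f x)) pts" by (rule inj_onI) (use assms nrm_id in metis)
  moreover have "(\<lambda>x. nrm (f x)) ` pts \<subseteq> pts" by (blast intro: nrm_in_pts)
  ultimately show ?thesis using finite_pts by (simp add: bij_betw_def endo_inj_surj)
qed

lemma pA_nrm: "pA (nrm x) = nrm (fA x)" by (simp add: pA_def fA_iff)
lemma pB_nrm: "pB (nrm x) = nrm (fB x)" by (simp add: pB_def fB_iff)
lemma pC_nrm: "pC (nrm x) = nrm (fC x)" by (simp add: pC_def fC_iff)

lemma fA_pow: "(pA ^^ n) (nrm (d, k, i)) = nrm (d - int n, k, i + int n)"
  by (induction n) (simp_all add: pA_nrm fA_def algebra_simps)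

lemma fB_pow: "(pB ^^ n) (nrm (d, k, i)) = nrm (d + T k i n - (I i n - i), k + S i n, I i n)"
  by (induction n) (simp_all add: pB_nrm fB_def algebra_simps)

lemma perm_rep_pts: "perm_rep pts pA pB pC (nat (q ^ 3)) (1 + u) (1 + v)"
proof
  show "nat (q ^ 3) > 0" using q_pos by simp
  show "bij_betw pA pts pts" "bij_betw pB pts pts" "bij_betw pC pts pts"
    using bij_nrm[of fA] bij_nrm[of fB] bij_nrm[of fC] fA_iff fB_iff fC_iff
    by (simp_all add: pA_def[abs_def] pB_def[abs_def] pC_def[abs_def])
next
  fix x assume "x \<in> pts"
  then have x: "x = nrm x" by (simp add: nrm_id)
  obtain d k i where dki: "x = (d, k, i)" by (cases x)
  have 1: "q ^ 3 dvd (i + 1 + g (i + 1)) - (i + 1 + g i) * (1 + u)" by (rule g_Suc)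
  then have 2: "q\<^sup>2 dvd (i + 1 + g (i + 1)) - (i + 1 + g i) * (1 + u)"
    by (rule dvd_trans[rotated]) (simp add: le_imp_power_dvd)
  have "nrm (fB (fA x)) = nrm (fC (fA (fB x)))"
    unfolding dki fA_def fB_def fC_def using 1 2
    by (simp add: nrm_eq_iff) (simp add: algebra_simps dvd_diff_commute)
  then show "pB (pA x) = pC (pA (pB x))" by (subst (1 2) x) (simp add: pA_nrm pB_nrm pC_nrm)
next
  fix x and n :: nat assume "x \<in> pts" and n: "int (nat (q ^ 3)) dvd int n - (1 + u)"
  then have x: "x = nrm x" by (simp add: nrm_id)
  obtain d k i where dki: "x = (d, k, i)" by (cases x)
  have n3: "q ^ 3 dvd int n - (1 + u)" using n q_pos by simp
  then have n2: "q\<^sup>2 dvd int n - (1 + u)" by (rule dvd_trans[rotated]) (simp add: le_imp_power_dvd)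
  have "pC (pA x) = nrm (fC (fA x))" by (subst x) (simp add: pA_nrm pC_nrm)
  also have "\<dots> = nrm (d - i * u - int n, k + 1, i * (1 + u) + int n)"
    unfolding dki fA_def fC_def using n3 n2 by (simp add: nrm_eq_iff) (simp add: algebra_simps dvd_diff_commute)
  also have "\<dots> = (pA ^^ n) (nrm (fC x))" unfolding dki fC_def by (simp add: fA_pow)
  also have "nrm (fC x) = pC x" by (simp add: pC_def)
  finally show "pC (pA x) = (pA ^^ n) (pC x)" .
next
  fix x and n :: nat assume "x \<in> pts" and n: "int (nat (q ^ 3)) dvd int n - (1 + v)"
  then have x: "x = nrm x" by (simp add: nrm_id)
  obtain d k i where dki: "x = (d, k, i)" by (cases x)
  have n3: "q ^ 3 dvd int n - (1 + v)" using n q_pos by simp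
  define i' where "i' = i * (1 + u)"
  note R1 = relation_B(1)[OF n3, where i = i, folded i'_def]
  note R2 = relation_B(2)[OF n3, where i = i and k = k, folded i'_def]
  have "pC ((pB ^^ n) x) = nrm (fC (d + T k i n - (I i n - i), k + S i n, I i n))"
    by (subst x, unfold dki fB_pow) (simp add: pC_nrm)
  also have "\<dots> = nrm (fB (fC x))"
  proof -
    have k: "q\<^sup>2 dvd (k + S i n + 1) - (k + 1 + i')" using S_final[OF n3, of i] by (simp add: i'_def algebra_simps)
    have "(d + T k i n - (I i n - i) - I i n * u) - (d - i * u + bb (k + 1) - g i')
      = (T k i n - I i n * (1 + u)) - (bb (k + 1) - (i' + g i'))"
      by (simp add: i'_def algebra_simps)
    then have d: "q ^ 3 dvd (d + T k i n - (I i n - i) - I i n * u) - (d - i * u + bb (k + 1) - g i')"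
      using R2 by (simp only:)
    show ?thesis unfolding dki fB_def fC_def using R1 k d by (simp add: nrm_eq_iff i'_def)
  qed
  finally show "pB (pC x) = pC ((pB ^^ n) x)" by (subst (1) x) (simp add: pB_nrm pC_nrm)
qed

lemma I_0: "I 0 n = 0" by (induction n) (simp_all add: g_def tri_def tet_def)

lemma S_0: "S 0 n = 0" by (induction n) (simp_all add: I_0)

lemma T_0: "T 0 0 n = int n" by (induction n) (simp_all add: S_0 bb_def tri_def)

lemma pB_pow_0: "(pB ^^ n) (nrm (0, 0, 0)) = nrm (int n, 0, 0)"
  by (simp add: fB_pow I_0 S_0 T_0)

lemma pC_pow_0: "(pC ^^ n) (nrm (d, k, 0)) = nrm (d, k + int n, 0)"
  by (induction n) (simp_all add: pC_nrm fC_def algebra_simps)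

end

section \<open>p-components and normal subgroups\<close>

lemma multiplicity_eq_of_dvd:
  fixes p n e j :: nat
  assumes p: "Factorial_Ring.prime p" and "p ^ j dvd n" "n dvd e * p ^ j" "\<not> p dvd e"
  shows "multiplicity p n = j"
proof (rule multiplicity_eqI[OF assms(2)])
  show "\<not> p ^ Suc j dvd n"
  proof
    assume "p ^ Suc j dvd n"
    then have "p ^ Suc j dvd e * p ^ j" using assms(3) dvd_trans by blast
    then have "p ^ j * p dvd p ^ j * e" by (simp add: mult.commute)
    then have "p dvd e" using p by (simp add: prime_gt_0_nat)
    then show False using assms(4) by simp
  qed
qed

text \<open>Whatever e the choice operator picks, it is a unit modulo the p-part q of the order and
  a multiple of the cofactor n, so a k-th power of g^e is trivial exactly when q divides k.\<close>

lemma (in group) ord_pcomp: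
  assumes p: "Factorial_Ring.prime p" and g: "g \<in> carrier G" "ord g > 0"
  shows "ord (pcomp G p g) = p ^ multiplicity p (ord g)"
proof -
  define q where "q = p ^ multiplicity p (ord g)"
  have "q dvd ord g" unfolding q_def by (rule multiplicity_dvd)
  then obtain n where n: "ord g = q * n" by blast
  have q0: "q > 0" using p by (simp add: q_def prime_gt_0_nat)
  have "\<not> p dvd n"
  proof
    assume "p dvd n"
    then have "q * p dvd q * n" by (intro mult_dvd_mono) auto
    then have "p ^ Suc (multiplicity p (ord g)) dvd ord g" by (metis n power_Suc2 q_def)
    moreover have "\<not> is_unit p" using p not_prime_unit by blast
    ultimately have "Suc (multiplicity p (ord g)) \<le> multiplicity p (ord g)"
      using g(2) by (intro multiplicity_geI) auto
    then show False by simp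
  qed
  then have cop: "coprime q n" using p by (simp add: q_def prime_imp_coprime)
  have div: "ord g div q = n" using n q0 by simp
  define e where "e = (SOME e::nat. [e = 1] (mod q) \<and> [e = 0] (mod (ord g div q)))"
  have "\<exists>e::nat. [e = 1] (mod q) \<and> [e = 0] (mod (ord g div q))"
    unfolding div by (rule binary_chinese_remainder_nat[OF cop])
  then have "[e = 1] (mod q) \<and> [e = 0] (mod (ord g div q))" unfolding e_def by (rule someI_ex)
  then have e: "[e = 1] (mod q)" "[e = 0] (mod n)" unfolding div by blast+
  have "coprime e q" using e(1) by (metis cong_imp_coprime cong_sym coprime_1_left)
  have "n dvd e" using e(2) by (simp add: cong_0_iff)
  then obtain e' where e': "e = n * e'" by blast
  have "q dvd k \<longleftrightarrow> (g [^] e) [^] k = \<one>" for k :: nat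
  proof -
    have "(g [^] e) [^] k = \<one> \<longleftrightarrow> q * n dvd e * k" using g by (simp add: nat_pow_pow pow_eq_id n)
    also have "\<dots> \<longleftrightarrow> q dvd k"
    proof
      assume "q * n dvd e * k"
      then have "q dvd e * k" by (rule dvd_mult_left)
      then show "q dvd k" using \<open>coprime e q\<close> by (simp add: coprime_commute coprime_dvd_mult_right_iff)
    next
      assume "q dvd k"
      then show "q * n dvd e * k" using \<open>n dvd e\<close> by (metis mult.commute mult_dvd_mono)
    qed
    finally show ?thesis by simp
  qed
  then have "ord (g [^] e) = q" using g by (simp add: ord_unique)
  moreover have "pcomp G p g = g [^] e" by (simp add: pcomp_def Let_def e_def q_def)
  ultimately show ?thesis by (simp add: q_def)
qed

lemma (in group) conj_preimage_subgroup:
  assumes K: "subgroup K G" and g: "g \<in> carrier G"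
  shows "subgroup {s \<in> carrier G. inv g \<otimes> s \<otimes> g \<in> K} G" (is "subgroup ?K G")
proof (rule subgroupI)
  interpret K: subgroup K G by (rule K)
  have "\<one> \<in> ?K" using g by simp
  then show "?K \<noteq> {}" by blast
  fix x assume "x \<in> ?K"
  then have x: "x \<in> carrier G" "inv g \<otimes> x \<otimes> g \<in> K" by auto
  have "inv (inv g \<otimes> x \<otimes> g) = inv g \<otimes> inv x \<otimes> g"
    using g x(1) by (simp add: inv_mult_group m_assoc)
  then show "inv x \<in> ?K" using K.m_inv_closed[OF x(2)] x(1) by simp
  fix y assume "y \<in> ?K"
  then have y: "y \<in> carrier G" "inv g \<otimes> y \<otimes> g \<in> K" by auto
  have "(inv g \<otimes> x \<otimes> g) \<otimes> (inv g \<otimes> y \<otimes> g) = inv g \<otimes> (x \<otimes> y) \<otimes> g"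
    using g x(1) y(1) by (simp add: m_assoc)
  then show "x \<otimes> y \<in> ?K" using K.m_closed[OF x(2) y(2)] x(1) y(1) by simp
qed auto

text \<open>Since the generators of G have finite order, invariance under conjugation by them in one
  direction gives invariance under the whole group.\<close>

lemma (in group) normal_generateI_finite:
  assumes gen: "carrier G = generate G gs" and gs: "gs \<subseteq> carrier G" "\<And>x. x \<in> gs \<Longrightarrow> ord x > 0"
    and hs: "hs \<subseteq> carrier G" "\<And>x y. x \<in> gs \<Longrightarrow> y \<in> hs \<Longrightarrow> inv x \<otimes> y \<otimes> x \<in> generate G hs"
  shows "generate G hs \<lhd> G"
proof -
  let ?S = "generate G hs"
  have sub: "subgroup ?S G" by (rule generate_is_subgroup[OF hs(1)])
  interpret S: subgroup ?S G by (rule sub)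
  have conj: "inv x \<otimes> s \<otimes> x \<in> ?S" if "x \<in> gs" "s \<in> ?S" for x s
  proof -
    have xc: "x \<in> carrier G" using that gs by auto
    have "hs \<subseteq> {s \<in> carrier G. inv x \<otimes> s \<otimes> x \<in> ?S}" using hs that(1) by auto
    from generate_subgroup_incl[OF this conj_preimage_subgroup[OF sub xc]] that(2) show ?thesis by auto
  qed
  let ?T = "{g \<in> carrier G. \<forall>s\<in>?S. inv g \<otimes> s \<otimes> g \<in> ?S}"
  have "generate G gs \<subseteq> ?T"
  proof (rule generate_subset_right_closed[OF gs])
    show "\<one> \<in> ?T" by simp
    fix g x assume "g \<in> ?T" and x: "x \<in> gs"
    then have g: "g \<in> carrier G" "\<And>s. s \<in> ?S \<Longrightarrow> inv g \<otimes> s \<otimes> g \<in> ?S" by auto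
    have xc: "x \<in> carrier G" using x gs by auto
    have "inv (g \<otimes> x) \<otimes> s \<otimes> (g \<otimes> x) \<in> ?S" if s: "s \<in> ?S" for s
    proof -
      have "inv (g \<otimes> x) \<otimes> s \<otimes> (g \<otimes> x) = inv x \<otimes> (inv g \<otimes> s \<otimes> g) \<otimes> x"
        using g(1) xc S.mem_carrier[OF s] by (simp add: inv_mult_group m_assoc)
      then show ?thesis using conj[OF x g(2)[OF s]] by simp
    qed
    then show "g \<otimes> x \<in> ?T" using g(1) xc by simp
  qed auto
  then have T: "inv g \<otimes> s \<otimes> g \<in> ?S" if "g \<in> carrier G" "s \<in> ?S" for g s
    using that gen by auto
  show ?thesis
  proof (rule normal_invI[OF sub])
    fix x h assume "x \<in> carrier G" "h \<in> ?S"
    then show "x \<otimes> h \<otimes> inv x \<in> ?S" using T[of "inv x" h] by simp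
  qed
qed

text \<open>The image of x in the quotient has p-power order, and this order also divides an index
  prime to p. This is what makes the Sylow subgroup unique.\<close>

lemma (in group) p_element_in_normal:
  assumes S: "S \<lhd> G" and fin: "finite (carrier G)" and cop: "coprime p (card (rcosets S))"
    and x: "x \<in> carrier G" "x [^] (p ^ k) = \<one>"
  shows "x \<in> S"
proof -
  interpret N: normal S G by (rule S)
  interpret Q: group "G Mod S" by (rule N.factorgroup_is_group)
  interpret h: group_hom G "G Mod S" "\<lambda>x. S #> x" by unfold_locales (rule N.r_coset_hom_Mod)
  have "Q.ord (S #> x) dvd p ^ k"
    using h.hom_nat_pow[OF x(1), of "p ^ k"] x h.hom_closed[OF x(1)] by (simp add: Q.pow_eq_id[symmetric])
  moreover have "Q.ord (S #> x) dvd card (rcosets S)"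
  proof -
    have "Q.ord (S #> x) dvd order (G Mod S)"
      using h.hom_closed[OF x(1)] by (rule Q.ord_dvd_group_order)
    then show ?thesis by (simp add: order_def FactGroup_def)
  qed
  ultimately have "Q.ord (S #> x) = 1" using cop by (metis coprime_common_divisor coprime_power_left_iff nat_dvd_1_iff_1)
  then have "S #> x = \<one>\<^bsub>G Mod S\<^esub>" using h.hom_closed[OF x(1)] Q.ord_eq_1 by blast
  then have "S #> x = S" by simp
  then show ?thesis using coset_join1[OF _ x(1) N.subgroup_axioms] by simp
qed

section \<open>The Sylow subgroup\<close>

locale mac_sylow =
  fixes p :: nat and \<alpha> \<beta> :: int and m :: nat
  assumes p: "Factorial_Ring.prime p"
    and \<alpha>1: "\<alpha> \<noteq> 1" and \<beta>1: "\<beta> \<noteq> 1"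
    and small: "p > 3 \<or> (p = 3 \<and> \<not> [\<alpha> = 7] (mod 9) \<and> \<not> [\<beta> = 7] (mod 9))"
    and m\<alpha>: "multiplicity (int p) (\<alpha> - 1) = m" and m\<beta>: "multiplicity (int p) (\<beta> - 1) = m"
    and m: "m > 0"
    and diff: "\<alpha> = \<beta> \<or> 2 * m \<le> multiplicity (int p) (\<alpha> - \<beta>)"
begin

abbreviation "q \<equiv> int p ^ m"
abbreviation "GG \<equiv> Gab \<alpha> \<beta>"
abbreviation "A \<equiv> genA \<alpha> \<beta>"
abbreviation "B \<equiv> genB \<alpha> \<beta>"
abbreviation "C \<equiv> genC \<alpha> \<beta>"

sublocale macdonald GG A B C \<alpha> \<beta> by (rule Gab_macdonald)

lemma p_ge_3: "p \<ge> 3" using small by auto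

lemma odd_p: "odd p" using p p_ge_3 by (metis One_nat_def Suc_leD numeral_2_eq_2 numeral_3_eq_3 prime_odd_nat Suc_le_lessD)

lemma prime_int_p: "Factorial_Ring.prime (int p)" using p by simp

lemma decompose:
  assumes "x \<noteq> 1" "multiplicity (int p) (x - 1) = m"
  obtains r where "x - 1 = q * r" "\<not> int p dvd r"
proof -
  have nu: "\<not> is_unit (int p)" using prime_int_p not_prime_unit by blast
  have nz: "x - 1 \<noteq> 0" using assms(1) by simp
  obtain y where y: "x - 1 = int p ^ multiplicity (int p) (x - 1) * y" "\<not> int p dvd y"
    by (rule multiplicity_decompose'[OF nz nu])
  show ?thesis by (rule that[OF _ y(2)]) (use y(1) in \<open>simp only: assms(2)\<close>)
qed

lemma diff_dvd: "int p ^ (2 * m) dvd \<alpha> - \<beta>"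
  using diff by (auto intro: multiplicity_dvd')

lemma exponents_nontrivial:
  assumes "x \<noteq> 1" "multiplicity (int p) (x - 1) = m"
  shows "\<bar>x\<bar> \<noteq> 1" "x \<noteq> 0"
proof -
  obtain r where "x - 1 = q * r" using decompose[OF assms] .
  then have "int p dvd x - 1" using m by (simp add: dvd_power)
  moreover have "\<not> int p dvd 1" "\<not> int p dvd 2" using p_ge_3 by (auto dest: zdvd_imp_le)
  ultimately have "x - 1 \<noteq> - 1" "x - 1 \<noteq> - 2" by (metis dvd_minus_iff)+
  then show "\<bar>x\<bar> \<noteq> 1" "x \<noteq> 0" using assms(1) by auto
qed

lemma ord_A_pos: "ord A > 0"
  using ord_a_pos exponents_nontrivial[OF \<alpha>1 m\<alpha>] exponents_nontrivial[OF \<beta>1 m\<beta>] \<alpha>1 by blast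

lemma ord_B_pos: "ord B > 0"
  using macdonald.ord_a_pos[OF swap] exponents_nontrivial[OF \<alpha>1 m\<alpha>] exponents_nontrivial[OF \<beta>1 m\<beta>] \<beta>1 by blast

lemma ord_C_pos: "ord C > 0"
  using ord_c_dvd ord_A_pos by (metis dvd_pos_nat nat_0_less_mult_iff)

end

locale mac_sylow_model = mac_sylow +
  fixes r s :: int
  assumes r: "\<alpha> - 1 = q * r" and s: "\<beta> - \<alpha> = q * q * s"
begin

sublocale M: mac_model q r s
  by unfold_locales (use p odd_p in \<open>auto simp: prime_gt_0_nat\<close>)

lemma model_u: "1 + M.u = \<alpha>" using r by (simp add: M.u_def)

lemma model_v: "1 + M.v = \<beta>" using r s by (simp add: M.v_def algebra_simps)

sublocale P: perm_rep M.pts M.pA M.pB M.pC "nat (q ^ 3)" \<alpha> \<beta>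
  using M.perm_rep_pts by (simp only: model_u model_v)

lemma rep_iterate:
  assumes "\<And>y. y \<in> M.pts \<Longrightarrow> P.rep g y = f y" "g \<in> carrier GG" "x \<in> M.pts"
  shows "P.rep (g [^]\<^bsub>GG\<^esub> (n::nat)) x = (f ^^ n) x"
  unfolding P.rep_pow[OF assms(2,3)]
proof (induction n)
  case (Suc n)
  have "(P.rep g ^^ n) x \<in> M.pts" by (induction n) (simp_all add: assms(3) P.rep_closed[OF assms(2)])
  then show ?case using Suc assms(1) by simp
qed simp

lemma rep_powers:
  "P.rep (B [^]\<^bsub>GG\<^esub> (n::nat)) (M.nrm (0, 0, 0)) = M.nrm (int n, 0, 0)"
  "P.rep (C [^]\<^bsub>GG\<^esub> (n::nat)) (M.nrm (d, 0, 0)) = M.nrm (d, int n, 0)"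
  "P.rep (A [^]\<^bsub>GG\<^esub> (n::nat)) (M.nrm (d, k, 0)) = M.nrm (d - int n, k, int n)"
  using rep_iterate[OF P.rep_gen(1)] rep_iterate[OF P.rep_gen(2)] rep_iterate[OF P.rep_gen(3)]
  by (simp_all add: M.nrm_in_pts M.pB_pow_0 M.pC_pow_0 M.fA_pow)

text \<open>The powers of B, C and A move the base point along separate residues modulo q^3, q^2 and
  q^3, so a trivial power must have an exponent divisible by that modulus.\<close>

lemma ord_lower: "p ^ (3 * m) dvd ord A" "p ^ (3 * m) dvd ord B" "p ^ (2 * m) dvd ord C"
proof -
  have "q ^ 3 dvd int (ord B)"
    using rep_powers(1)[of "ord B"] P.rep_one[OF M.nrm_in_pts] by (simp add: M.nrm_eq_iff)
  moreover have "q\<^sup>2 dvd int (ord C)" using rep_powers(2)[of "ord C" 0] P.rep_one[OF M.nrm_in_pts] by (simp add: M.nrm_eq_iff)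
  moreover have "q ^ 3 dvd int (ord A)" using rep_powers(3)[of "ord A" 0 0] P.rep_one[OF M.nrm_in_pts] by (simp add: M.nrm_eq_iff)
  ultimately have "int (p ^ (3 * m)) dvd int (ord A)" "int (p ^ (3 * m)) dvd int (ord B)" "int (p ^ (2 * m)) dvd int (ord C)"
    by (simp_all add: power_mult[symmetric] mult.commute)
  then show "p ^ (3 * m) dvd ord A" "p ^ (3 * m) dvd ord B" "p ^ (2 * m) dvd ord C"
    by (simp_all only: of_nat_dvd_iff)
qed

end

locale mac_sylow_idem = mac_sylow_model +
  fixes e t N :: nat
  assumes cop: "coprime (p ^ t) N" and e1: "p ^ t dvd e - 1" and e0: "e > 0" and Ne: "N dvd e"
    and ordA: "ord A dvd p ^ t * N" and ordB: "ord B dvd p ^ t * N" and ordC: "ord C dvd p ^ t * N"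
    and t: "t > 0"
begin

abbreviation "a \<equiv> A [^]\<^bsub>GG\<^esub> e"
abbreviation "b \<equiv> B [^]\<^bsub>GG\<^esub> e"
abbreviation "c \<equiv> C [^]\<^bsub>GG\<^esub> e"
abbreviation "SS \<equiv> generate GG {a, b}"

lemmas idem = idempotent_power[OF cop e1 e0 Ne ordA ordB ordC ord_A_pos ord_B_pos]

lemma p_not_dvd_e: "\<not> p dvd e"
proof
  assume "p dvd e"
  moreover have "p dvd e - 1" using e1 t by (meson dvd_power dvd_trans)
  ultimately have "p dvd 1" using e0 by (metis dvd_diffD1 Suc_leI One_nat_def)
  then show False using p by (simp add: prime_nat_iff)
qed

lemma q3_dvd: "int p ^ (3 * m) dvd int e - 1"
proof -
  have "p ^ (3 * m) dvd p ^ t * N" using ord_lower(1) ordA dvd_trans by blast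
  moreover have "coprime (p ^ (3 * m)) N" using cop t by simp
  ultimately have "p ^ (3 * m) dvd e - 1" using e1 by (meson coprime_dvd_mult_left_iff dvd_trans)
  then have "int (p ^ (3 * m)) dvd int (e - 1)" by (simp only: of_nat_dvd_iff)
  then show ?thesis using e0 by (simp add: of_nat_diff)
qed

lemma torsion:
  assumes "x \<in> carrier GG" "ord x dvd p ^ t * N"
  shows "(x [^]\<^bsub>GG\<^esub> e) [^]\<^bsub>GG\<^esub> (int p ^ t) = \<one>\<^bsub>GG\<^esub>"
proof -
  have "ord x dvd e * p ^ t" using assms(2) Ne by (metis dvd_trans mult.commute mult_dvd_mono dvd_refl)
  then have "(x [^]\<^bsub>GG\<^esub> e) [^]\<^bsub>GG\<^esub> (p ^ t) = \<one>\<^bsub>GG\<^esub>" using assms(1) by (simp add: nat_pow_pow pow_eq_id)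
  then show ?thesis by (metis int_pow_int of_nat_power)
qed

text \<open>The modulus is large enough to preserve several things at once: t for powers of
  \<open>p ^ t\<close>-torsion elements, 3m for the valuation m and the congruence modulo q^2, and 2
  for the residue modulo 9 when p = 3.\<close>

lemma positive_exponents:
  fixes x y :: int
  defines "x' \<equiv> x mod int p ^ (t + 3 * m + 2) + int p ^ (t + 3 * m + 2)"
  assumes x: "x - 1 = q * y" "\<not> int p dvd y"
  shows "x' > 0" "\<exists>r'. x' - 1 = q * r' \<and> \<not> int p dvd r'" "int p ^ (t + 3 * m + 2) dvd x' - x"
proof -
  let ?D = "int p ^ (t + 3 * m + 2)"
  have D: "?D > 0" using p by (simp add: prime_gt_0_nat)
  then show "x' > 0" by (simp add: x'_def add_nonneg_pos)
  show dvd: "?D dvd x' - x" unfolding x'_def by (simp add: mod_eq_dvd_iff[symmetric])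
  then obtain z where z: "x' - x = ?D * z" by blast
  have "?D = q * (int p * int p ^ (t + 2 * m + 1))" by (simp add: add.commute flip: power_add power_Suc)
  then have "x' - 1 = q * (y + int p * (int p ^ (t + 2 * m + 1) * z))"
    using z x(1) by (simp add: algebra_simps)
  moreover have "\<not> int p dvd y + int p * (int p ^ (t + 2 * m + 1) * z)"
    using x(2) by (simp add: dvd_add_left_iff)
  ultimately show "\<exists>r'. x' - 1 = q * r' \<and> \<not> int p dvd r'" by blast
qed

lemma idem_p:
  obtains \<alpha>' \<beta>' u v where "macdonald_p GG a b c \<alpha>' \<beta>' p m t u v"
proof -
  define D where "D = int p ^ (t + 3 * m + 2)"
  define \<alpha>' \<beta>' where "\<alpha>' = \<alpha> mod D + D" and "\<beta>' = \<beta> mod D + D"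
  obtain r where r: "\<alpha> - 1 = q * r" "\<not> int p dvd r" using decompose[OF \<alpha>1 m\<alpha>] .
  obtain r2 where r2: "\<beta> - 1 = q * r2" "\<not> int p dvd r2" using decompose[OF \<beta>1 m\<beta>] .
  note pa = positive_exponents[OF r, folded D_def, folded \<alpha>'_def]
  note pb = positive_exponents[OF r2, folded D_def, folded \<beta>'_def]
  obtain u where u: "\<alpha>' - 1 = q * u" "\<not> int p dvd u" using pa by blast
  obtain v where v: "\<beta>' - 1 = q * v" "\<not> int p dvd v" using pb by blast
  interpret i: macdonald GG a b c \<alpha> \<beta> by (rule idem(1))
  have Dt: "int p ^ t dvd D" "int p ^ (2 * m) dvd D" by (simp_all add: D_def le_imp_power_dvd)
  have pow: "a [^]\<^bsub>GG\<^esub> \<alpha>' = a [^]\<^bsub>GG\<^esub> \<alpha>" "b [^]\<^bsub>GG\<^esub> \<beta>' = b [^]\<^bsub>GG\<^esub> \<beta>"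
    using int_pow_eq_mod[OF _ torsion[OF a_closed ordA] dvd_trans[OF Dt(1) pa(3)]]
      int_pow_eq_mod[OF _ torsion[OF b_closed ordB] dvd_trans[OF Dt(1) pb(3)]] by simp_all
  interpret i': macdonald GG a b c \<alpha>' \<beta>' by (rule i.change_exponents[OF pow])
  have "int p ^ (2 * m) dvd (\<alpha>' - \<alpha>) + (\<alpha> - \<beta>) - (\<beta>' - \<beta>)"
    by (rule dvd_diff[OF dvd_add[OF dvd_trans[OF Dt(2) pa(3)] diff_dvd] dvd_trans[OF Dt(2) pb(3)]])
  then have diff': "int p ^ (2 * m) dvd \<alpha>' - \<beta>'" by (simp add: algebra_simps)
  have small': "p > 3 \<or> p = 3 \<and> \<not> [\<alpha>' = 7] (mod 9) \<and> \<not> [\<beta>' = 7] (mod 9)"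
  proof (cases "p = 3")
    case True
    have "int p ^ 2 dvd D" unfolding D_def by (rule le_imp_power_dvd) simp
    then have 9: "9 dvd D" using True by simp
    have "[\<alpha>' = \<alpha>] (mod 9)" "[\<beta>' = \<beta>] (mod 9)"
      using dvd_trans[OF 9 pa(3)] dvd_trans[OF 9 pb(3)] by (simp_all add: cong_iff_dvd_diff)
    then show ?thesis using small True by (metis cong_sym cong_trans)
  qed (use small in auto)
  have "macdonald_p GG a b c \<alpha>' \<beta>' p m t u v"
    by unfold_locales
      (use p odd_p m pa(1) pb(1) u v diff' small' torsion[OF a_closed ordA] torsion[OF b_closed ordB] in auto)
  then show ?thesis by (rule that)
qed

lemma upper: "a [^]\<^bsub>GG\<^esub> (p ^ (3 * m)) = \<one>\<^bsub>GG\<^esub>" "b [^]\<^bsub>GG\<^esub> (p ^ (3 * m)) = \<one>\<^bsub>GG\<^esub>"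
  "c [^]\<^bsub>GG\<^esub> (p ^ (2 * m)) = \<one>\<^bsub>GG\<^esub>" "b [^]\<^bsub>GG\<^esub> (p ^ (2 * m)) \<in> generate GG {a}"
proof -
  obtain \<alpha>' \<beta>' u v where "macdonald_p GG a b c \<alpha>' \<beta>' p m t u v" using idem_p .
  then interpret i: macdonald_p GG a b c \<alpha>' \<beta>' p m t u v .
  show "a [^]\<^bsub>GG\<^esub> (p ^ (3 * m)) = \<one>\<^bsub>GG\<^esub>" using i.a_q3 by (metis int_pow_int of_nat_power)
  show "b [^]\<^bsub>GG\<^esub> (p ^ (3 * m)) = \<one>\<^bsub>GG\<^esub>" using i.b_q3 by (metis int_pow_int of_nat_power)
  show "c [^]\<^bsub>GG\<^esub> (p ^ (2 * m)) = \<one>\<^bsub>GG\<^esub>" by (rule i.c_q2)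
  obtain k where "b [^]\<^bsub>GG\<^esub> (int p ^ (2 * m)) = a [^]\<^bsub>GG\<^esub> (int p ^ (2 * m) * k)" using i.b_q2_eq .
  then have "b [^]\<^bsub>GG\<^esub> (p ^ (2 * m)) = a [^]\<^bsub>GG\<^esub> (int p ^ (2 * m) * k)" by (metis int_pow_int of_nat_power)
  then show "b [^]\<^bsub>GG\<^esub> (p ^ (2 * m)) \<in> generate GG {a}" by (auto simp: generate_pow)
qed

lemma ord_upper: "ord A dvd e * p ^ (3 * m)" "ord B dvd e * p ^ (3 * m)" "ord C dvd e * p ^ (2 * m)"
  using upper by (simp_all add: nat_pow_pow pow_eq_id)

lemma mult_ord: "multiplicity p (ord A) = 3 * m" "multiplicity p (ord B) = 3 * m" "multiplicity p (ord C) = 2 * m"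
  using multiplicity_eq_of_dvd[OF p _ _ p_not_dvd_e] ord_lower ord_upper by blast+

lemma subgroup_SS: "subgroup SS GG" by (rule generate_is_subgroup) simp

lemma card_SS_upper: "finite SS" "card SS dvd p ^ (7 * m)"
proof -
  interpret i: macdonald GG a b c \<alpha> \<beta> by (rule idem(1))
  have p0: "p > 0" using p by (simp add: prime_gt_0_nat)
  have o: "ord a dvd p ^ (3 * m)" "ord b dvd p ^ (3 * m)" "ord c dvd p ^ (2 * m)"
    using upper by (simp_all add: pow_eq_id)
  then have "ord a > 0" "ord b > 0" "ord c > 0"
    using p0 dvd_pos_nat[OF _ o(1)] dvd_pos_nat[OF _ o(2)] dvd_pos_nat[OF _ o(3)] by simp_all
  note card = i.card_generate_dvd[OF this upper(4)]
  show "finite SS" using card(1) p0 by simp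
  have "card SS dvd ord a * ord c * p ^ (2 * m)" using card(2) p0 by simp
  also have "\<dots> dvd p ^ (3 * m) * p ^ (2 * m) * p ^ (2 * m)" using o by (intro mult_dvd_mono) auto
  finally show "card SS dvd p ^ (7 * m)" by (simp flip: power_add)
qed

text \<open>The upper bound is the coset count; the lower bound holds because the orbit of the base
  point under S already covers all q^7 points.\<close>

lemma card_SS: "card SS = p ^ (7 * m)"
proof (rule antisym)
  show "card SS \<le> p ^ (7 * m)"
    using card_SS_upper p by (intro dvd_imp_le) (auto simp: prime_gt_0_nat)
  interpret i: macdonald GG a b c \<alpha> \<beta> by (rule idem(1))
  have e3: "q ^ 3 dvd int e - 1" using q3_dvd by (simp add: power_mult[symmetric] mult.commute)
  then have e2: "q\<^sup>2 dvd int e - 1" by (rule dvd_trans[rotated]) (simp add: le_imp_power_dvd)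
  have ee: "d dvd int (e * n) - int n" if "d dvd int e - 1" for d n
    using that by (metis dvd_mult2 left_diff_distrib mult_1 of_nat_mult)
  have "M.pts \<subseteq> (\<lambda>g. P.rep g (M.nrm (0, 0, 0))) ` SS"
  proof
    fix x assume x: "x \<in> M.pts"
    obtain d k i where dki: "x = (d, k, i)" by (cases x)
    \<comment> \<open>The first coordinate is the exponent of B minus that of A, so b needs the
      exponent d + i, and i must be kept modulo q^3 although its own coordinate is read modulo q^2.
      As e is 1 modulo q^3, the powers of a, b, c act here like those of A, B, C.\<close>
    define j' k' i' where "j' = nat ((d + i) mod q ^ 3)" and "k' = nat (k mod q\<^sup>2)" and "i' = nat (i mod q ^ 3)"
    have pos: "int p > 0" using p by (simp add: prime_gt_0_nat)
    have j': "int j' = (d + i) mod q ^ 3" and k': "int k' = k mod q\<^sup>2" and i': "int i' = i mod q ^ 3"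
      using pos by (simp_all add: j'_def k'_def i'_def)
    define h where "h = b [^]\<^bsub>GG\<^esub> j' \<otimes>\<^bsub>GG\<^esub> (c [^]\<^bsub>GG\<^esub> k' \<otimes>\<^bsub>GG\<^esub> a [^]\<^bsub>GG\<^esub> i')"
    have "b [^]\<^bsub>GG\<^esub> j' \<in> SS" "c [^]\<^bsub>GG\<^esub> k' \<in> SS" "a [^]\<^bsub>GG\<^esub> i' \<in> SS"
      using subgroup_int_pow_closed[OF subgroup_SS, of b "int j'"]
        subgroup_int_pow_closed[OF subgroup_SS, of c "int k'"]
        subgroup_int_pow_closed[OF subgroup_SS, of a "int i'"] i.c_in_generate
      by (auto simp: int_pow_int intro: generate.incl)
    then have h: "h \<in> SS" unfolding h_def using subgroup.m_closed[OF subgroup_SS] by blast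
    have "P.rep h (M.nrm (0, 0, 0)) = M.nrm (int (e * j') - int (e * i'), int (e * k'), int (e * i'))"
    proof -
      have "P.rep h (M.nrm (0, 0, 0)) = P.rep (c [^]\<^bsub>GG\<^esub> k' \<otimes>\<^bsub>GG\<^esub> a [^]\<^bsub>GG\<^esub> i') (M.nrm (int (e * j'), 0, 0))"
        unfolding h_def by (subst P.rep_mult) (auto simp: M.nrm_in_pts rep_powers(1) nat_pow_pow simp del: of_nat_mult)
      also have "\<dots> = P.rep (a [^]\<^bsub>GG\<^esub> i') (M.nrm (int (e * j'), int (e * k'), 0))"
        by (subst P.rep_mult) (auto simp: M.nrm_in_pts rep_powers(2) nat_pow_pow simp del: of_nat_mult)
      finally show ?thesis by (simp add: rep_powers(3) nat_pow_pow del: of_nat_mult)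
    qed
    also have "\<dots> = M.nrm (d, k, i)"
    proof -
      have a1: "q ^ 3 dvd (d + i) - int j'" "q\<^sup>2 dvd k - int k'" "q ^ 3 dvd i - int i'"
        unfolding j' k' i' by (simp_all add: dvd_minus_mod)
      have a2: "q\<^sup>2 dvd i - int i'" using a1(3) by (rule dvd_trans[rotated]) (simp add: le_imp_power_dvd)
      have "q ^ 3 dvd (int (e * j') - int j') - ((d + i) - int j') - (int (e * i') - int i') + (i - int i')"
        by (rule dvd_add[OF dvd_diff[OF dvd_diff[OF ee[OF e3] a1(1)] ee[OF e3]] a1(3)])
      moreover have "q\<^sup>2 dvd (int (e * k') - int k') - (k - int k')" by (rule dvd_diff[OF ee[OF e2] a1(2)])
      moreover have "q\<^sup>2 dvd (int (e * i') - int i') - (i - int i')" by (rule dvd_diff[OF ee[OF e2] a2])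
      ultimately show ?thesis unfolding M.nrm_eq_iff by (simp add: algebra_simps)
    qed
    also have "\<dots> = x" using x dki M.nrm_id by blast
    finally show "x \<in> (\<lambda>g. P.rep g (M.nrm (0, 0, 0))) ` SS" using h by blast
  qed
  from surj_card_le[OF card_SS_upper(1) this] show "p ^ (7 * m) \<le> card SS" using M.card_pts by (simp add: nat_power_eq power_mult[symmetric] mult.commute)
qed

text \<open>The coset count for S, repeated for the whole group with every bound multiplied by e,
  gives a divisor of e^3 q^7; as p does not divide e, the p-part is q^7.\<close>

lemma finite_GG: "finite (carrier GG)" and mult_order: "multiplicity p (order GG) = 7 * m"
proof -
  have p0: "p > 0" using p by (simp add: prime_gt_0_nat)
  have "B [^]\<^bsub>GG\<^esub> (e * p ^ (2 * m)) \<in> generate GG {A}"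
  proof -
    have "generate GG {a} \<subseteq> generate GG {A}"
      by (rule generate_subgroup_incl[OF _ generate_is_subgroup])
        (auto simp: generate_pow intro!: exI[of _ "int e"] int_pow_int[symmetric])
    then show ?thesis using upper(4) by (auto simp: nat_pow_pow)
  qed
  note card = card_generate_dvd[OF ord_A_pos ord_B_pos ord_C_pos this]
  show fin: "finite (carrier GG)" unfolding Gab_generated using card(1) e0 p0 by simp
  have "order GG dvd ord A * ord C * (e * p ^ (2 * m))"
    unfolding order_def Gab_generated using card(2) e0 p0 by simp
  also have "\<dots> dvd (e * p ^ (3 * m)) * (e * p ^ (2 * m)) * (e * p ^ (2 * m))"
    using ord_upper by (intro mult_dvd_mono) auto
  also have "\<dots> = e ^ 3 * p ^ (7 * m)" by (simp add: power3_eq_cube mult_ac flip: power_add)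
  finally have "order GG dvd e ^ 3 * p ^ (7 * m)" .
  moreover have "p ^ (7 * m) dvd order GG"
    using card_SS lagrange[OF subgroup_SS] by (metis dvd_triv_right)
  moreover have "\<not> p dvd e ^ 3" using p_not_dvd_e p prime_dvd_power by blast
  ultimately show "multiplicity p (order GG) = 7 * m" using multiplicity_eq_of_dvd[OF p] by blast
qed

text \<open>The mixed relations of \<open>idempotent_power\<close> show that B conjugates a to a c
  and that A conjugates b to b times the inverse of c.\<close>

lemma SS_normal: "SS \<lhd> GG"
proof -
  interpret S: subgroup SS GG by (rule subgroup_SS)
  interpret i: macdonald GG a b c \<alpha> \<beta> by (rule idem(1))
  have gens: "a \<in> SS" "b \<in> SS" "c \<in> SS" using i.c_in_generate by (auto intro: generate.incl)
  have self: "inv\<^bsub>GG\<^esub> g \<otimes>\<^bsub>GG\<^esub> g [^]\<^bsub>GG\<^esub> e \<otimes>\<^bsub>GG\<^esub> g = g [^]\<^bsub>GG\<^esub> e" if "g \<in> carrier GG" for g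
    using that nat_pow_comm[of g e 1] by (simp add: m_assoc)
  have "inv\<^bsub>GG\<^esub> A \<otimes>\<^bsub>GG\<^esub> b \<otimes>\<^bsub>GG\<^esub> A = b \<otimes>\<^bsub>GG\<^esub> inv\<^bsub>GG\<^esub> c"
    using idem(3) by (simp add: m_assoc nat_pow_inv)
  then have cA: "inv\<^bsub>GG\<^esub> A \<otimes>\<^bsub>GG\<^esub> b \<otimes>\<^bsub>GG\<^esub> A \<in> SS" using gens S.m_closed S.m_inv_closed by metis
  have "inv\<^bsub>GG\<^esub> B \<otimes>\<^bsub>GG\<^esub> a \<otimes>\<^bsub>GG\<^esub> B = a \<otimes>\<^bsub>GG\<^esub> c"
    using idem(2) by (simp add: m_assoc)
  then have cB: "inv\<^bsub>GG\<^esub> B \<otimes>\<^bsub>GG\<^esub> a \<otimes>\<^bsub>GG\<^esub> B \<in> SS" using gens S.m_closed by metis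
  show ?thesis
    by (rule normal_generateI_finite[OF Gab_generated])
      (use cA cB self[OF a_closed] self[OF b_closed] gens ord_A_pos ord_B_pos in auto)
qed

text \<open>A Sylow subgroup consists of elements of p-power order, and S is normal of index prime
  to p, so it contains all of them.\<close>

lemma sylow_iff: "is_sylow GG p P \<longleftrightarrow> P = SS"
proof
  assume "P = SS"
  then show "is_sylow GG p P" by (simp add: is_sylow_def subgroup_SS card_SS mult_order)
next
  assume P: "is_sylow GG p P"
  then have sub: "subgroup P GG" and card: "card P = p ^ (7 * m)" by (simp_all add: is_sylow_def mult_order)
  have cop: "coprime p (card (rcosets\<^bsub>GG\<^esub> SS))"
  proof -
    have lag: "card (rcosets\<^bsub>GG\<^esub> SS) * p ^ (7 * m) = order GG" using lagrange[OF subgroup_SS] card_SS by simp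
    have "\<not> p dvd card (rcosets\<^bsub>GG\<^esub> SS)"
    proof
      assume "p dvd card (rcosets\<^bsub>GG\<^esub> SS)"
      then have "p * p ^ (7 * m) dvd order GG" unfolding lag[symmetric] by (intro mult_dvd_mono) auto
      then have "p ^ Suc (7 * m) dvd order GG" by simp
      moreover have "order GG \<noteq> 0" using finite_GG order_gt_0_iff_finite by simp
      moreover have "\<not> is_unit p" using p not_prime_unit by blast
      ultimately have "Suc (7 * m) \<le> multiplicity p (order GG)" by (intro multiplicity_geI) auto
      then show False by (simp add: mult_order)
    qed
    then show ?thesis using p by (simp add: prime_imp_coprime)
  qed
  have "P \<subseteq> SS"
  proof
    fix x assume x: "x \<in> P"
    interpret P: group "GG\<lparr>carrier := P\<rparr>" by (rule subgroup_imp_group[OF sub])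
    have "x [^]\<^bsub>GG\<lparr>carrier := P\<rparr>\<^esub> order (GG\<lparr>carrier := P\<rparr>) = \<one>\<^bsub>GG\<^esub>"
      using P.pow_order_eq_1[of x] x by simp
    then have "x [^]\<^bsub>GG\<^esub> (p ^ (7 * m)) = \<one>\<^bsub>GG\<^esub>"
      using nat_pow_consistent[of x _ P] card by (simp add: order_def)
    then show "x \<in> SS"
      using x subgroup.mem_carrier[OF sub] by (intro p_element_in_normal[OF SS_normal finite_GG cop]) auto
  qed
  then show "P = SS" using card card_SS card_SS_upper(1) by (simp add: card_subset_eq)
qed

lemma nil_class_SS: "nil_class (GG\<lparr>carrier := SS\<rparr>) = 5"
proof -
  let ?H = "GG\<lparr>carrier := SS\<rparr>"
  obtain \<alpha>' \<beta>' u v where "macdonald_p GG a b c \<alpha>' \<beta>' p m t u v" using idem_p .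
  then interpret i: macdonald_p GG a b c \<alpha>' \<beta>' p m t u v .
  interpret H: group ?H by (rule subgroup_imp_group[OF subgroup_SS])
  have gens: "a \<in> SS" "b \<in> SS" "c \<in> SS" using i.c_in_generate by (auto intro: generate.incl)
  have pow: "x [^]\<^bsub>?H\<^esub> (k::int) = x [^]\<^bsub>GG\<^esub> k" if "x \<in> SS" for x k
    using int_pow_consistent[OF subgroup_SS that] by simp
  interpret h: macdonald ?H a b c \<alpha>' \<beta>'
    by unfold_locales (use gens i.ab i.ac i.cb in \<open>simp_all add: pow\<close>)
  interpret h: macdonald_p ?H a b c \<alpha>' \<beta>' p m t u v
    by unfold_locales (use i.p i.odd_p i.m i.pos i.u i.v i.diff i.small i.tors gens in \<open>simp_all add: pow\<close>)
  interpret h: macdonald_p_gen ?H a b c \<alpha>' \<beta>' p m t u v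
    by unfold_locales (use generate_consistent[OF _ subgroup_SS, of "{a, b}"] gens in auto)
  show ?thesis
  proof (rule h.nil_class_5)
    fix k :: int assume "a [^]\<^bsub>?H\<^esub> k = \<one>\<^bsub>?H\<^esub>"
    then have "A [^]\<^bsub>GG\<^esub> (int e * k) = \<one>\<^bsub>GG\<^esub>"
      using gens by (simp add: pow int_pow_pow[symmetric] int_pow_int)
    then have "int (ord A) dvd int e * k" by (simp add: int_pow_eq_id)
    moreover have "int (p ^ (3 * m)) dvd int (ord A)" using ord_lower(1) by (simp only: of_nat_dvd_iff)
    ultimately have "int p ^ (3 * m) dvd int e * k" by (metis dvd_trans of_nat_power)
    moreover have "coprime (int p ^ (3 * m)) (int e)" using p_not_dvd_e p by (simp add: prime_imp_coprime)
    ultimately show "int p ^ (3 * m) dvd k" by (simp add: coprime_dvd_mult_right_iff)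
  qed
qed

end

lemma (in mac_sylow_model) idempotent_exponent: "\<exists>e t N. mac_sylow_idem p \<alpha> \<beta> m r s e t N"
proof -
  \<comment> \<open>The additional factor p forces t > 0, so that e is 1 modulo p and hence prime to
    p.\<close>
  define K where "K = p * (ord A * ord B * ord C)"
  have K0: "K > 0" using ord_A_pos ord_B_pos ord_C_pos p by (simp add: K_def prime_gt_0_nat)
  have unit: "\<not> is_unit p" using p not_prime_unit by blast
  define t where "t = multiplicity p K"
  obtain N where N: "K = p ^ t * N" "\<not> p dvd N"
    unfolding t_def by (rule multiplicity_decompose'[OF _ unit, of K]) (use K0 in auto)
  have "p ^ 1 dvd K" by (simp add: K_def)
  then have t0: "t > 0" using K0 unit multiplicity_geI[of K p 1] by (simp add: t_def)
  have cop: "coprime (p ^ t) N" using N p by (simp add: prime_imp_coprime)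
  obtain e where e: "[e = 1] (mod p ^ t)" "[e = 0] (mod N)"
    using binary_chinese_remainder_nat[OF cop] by blast
  have pt: "p ^ t > 1" using one_less_power[OF prime_gt_1_nat[OF p] t0] .
  have "e > 0" using e(1) pt by (cases "e = 0") (auto simp: cong_def)
  moreover have "p ^ t dvd e - 1" using e(1) by (rule cong_to_1_nat)
  moreover have "N dvd e" using e(2) by (simp add: cong_0_iff)
  moreover have "ord A dvd p ^ t * N" "ord B dvd p ^ t * N" "ord C dvd p ^ t * N"
    unfolding N(1)[symmetric] K_def by (simp_all add: dvd_mult)
  ultimately have "mac_sylow_idem p \<alpha> \<beta> m r s e t N"
    using cop t0 by unfold_locales auto
  then show ?thesis by blast
qed

theorem theorem8p1:
  fixes p :: nat and \<alpha> \<beta> :: int and m :: nat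
  assumes "Factorial_Ring.prime p"
    and "\<alpha> \<noteq> 1" and "\<beta> \<noteq> 1"
    and "p > 3 \<or> (p = 3 \<and> \<not> [\<alpha> = 7] (mod 9) \<and> \<not> [\<beta> = 7] (mod 9))"
    and "multiplicity (int p) (\<alpha> - 1) = m" and "multiplicity (int p) (\<beta> - 1) = m"
    and "m > 0"
    and "\<alpha> = \<beta> \<or> 2 * m \<le> multiplicity (int p) (\<alpha> - \<beta>)"
  shows "(\<exists>P. is_sylow (Gab \<alpha> \<beta>) p P)
    \<and> (\<forall>P. is_sylow (Gab \<alpha> \<beta>) p P \<longrightarrow>
          card P = p ^ (7 * m) \<and> nil_class ((Gab \<alpha> \<beta>)\<lparr>carrier := P\<rparr>) = 5)
    \<and> group.ord (Gab \<alpha> \<beta>) (pcomp (Gab \<alpha> \<beta>) p (genA \<alpha> \<beta>)) = p ^ (3 * m)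
    \<and> group.ord (Gab \<alpha> \<beta>) (pcomp (Gab \<alpha> \<beta>) p (genB \<alpha> \<beta>)) = p ^ (3 * m)
    \<and> group.ord (Gab \<alpha> \<beta>) (pcomp (Gab \<alpha> \<beta>) p (genC \<alpha> \<beta>)) = p ^ (2 * m)"
proof -
  interpret M: mac_sylow p \<alpha> \<beta> m by unfold_locales (use assms in auto)
  obtain r where r: "\<alpha> - 1 = int p ^ m * r" using M.decompose[OF M.\<alpha>1 M.m\<alpha>] .
  obtain s where s: "\<beta> - \<alpha> = int p ^ m * int p ^ m * s"
  proof -
    have "int p ^ m * int p ^ m dvd \<beta> - \<alpha>"
      using M.diff_dvd by (simp add: dvd_diff_commute flip: power_add mult_2)
    then show ?thesis using that by blast
  qed
  interpret R: mac_sylow_model p \<alpha> \<beta> m r s by unfold_locales (use r s in auto)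
  obtain e t N where "mac_sylow_idem p \<alpha> \<beta> m r s e t N" using R.idempotent_exponent by blast
  then interpret I: mac_sylow_idem p \<alpha> \<beta> m r s e t N .
  show ?thesis
    using I.sylow_iff I.card_SS I.nil_class_SS I.mult_ord
      M.ord_pcomp[OF assms(1) M.a_closed M.ord_A_pos]
      M.ord_pcomp[OF assms(1) M.b_closed M.ord_B_pos]
      M.ord_pcomp[OF assms(1) M.c_closed M.ord_C_pos]
    by simp
qed

end
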